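(* Let $M$ be a connected compact surface without boundary embedded in $(\mathbb{R}^3,\|\cdot\|)$ whose Minkowski mean curvature $H$ (with respect to the outward-pointing Birkhoff normal) is positive everywhere, and let $D$ be the region enclosed by $M$. Then $$\int_M\frac1H\,\omega\ \ge\ 3\,\mathrm{vol}(D),$$ where $\mathrm{vol}(D)$ denotes the usual volume of $D$. Equality holds if and only if $M$ is a Minkowski sphere.
   Context: $\|\cdot\|$ is a smooth and strictly convex norm on $\mathbb{R}^3$ with unit sphere $\partial B=\{x:\|x\|=1\}$; the usual (Euclidean) Gaussian curvature of the surface $\partial B$ is assumed to vanish nowhere. A vector $v$ is Birkhoff orthogonal to a plane $P\subseteq\mathbb{R}^3$ (through the origin) if $\|v\|\le\|v+tw\|$ for all $w\in P$, $t\in\mathbb{R}$. For a smooth orientable surface $M$ in $\mathbb{R}^3$, the Birkhoff-Gauss map $\eta:M\to\partial B$ is a smooth map such that $\eta(p)$ is Birkhoff orthogonal to $T_pM$ for each $p$; here $\eta$ is chosen outward-pointing. Since $T_{\eta(p)}\partial B=T_pM$ as linear planes, $d\eta_p$ is an endomorphism of $T_pM$; it is diagonalizable over $\mathbb{R}$. The Minkowski mean curvature is $H(p)=\tfrac12\mathrm{tr}(d\eta_p)$ (so $H>0$ for Minkowski spheres). The area element on $M$ is $\omega(X,Y)=\det(X,Y,\eta)$ ($M$ oriented so that $\omega$ is positive). A Minkowski sphere is a set $\{x:\|x-a\|=r\}$ with $a\in\mathbb{R}^3$, $r>0$. *)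

theory Defs
  imports "HOL-Analysis.Analysis"
begin

section \<open>Smooth maps on open subsets of Euclidean space\<close>

primrec Ck_on :: "nat \<Rightarrow> 'a::euclidean_space set \<Rightarrow> ('a \<Rightarrow> 'b::real_normed_vector) \<Rightarrow> bool" where
  "Ck_on 0 S f \<longleftrightarrow> continuous_on S f"
| "Ck_on (Suc k) S f \<longleftrightarrow>
     (\<forall>x\<in>S. f differentiable (at x)) \<and> (\<forall>v. Ck_on k S (\<lambda>x. frechet_derivative f (at x) v))"

text \<open>Only meaningful for open \<open>S\<close>.\<close>

definition smooth_on :: "'a::euclidean_space set \<Rightarrow> ('a \<Rightarrow> 'b::real_normed_vector) \<Rightarrow> bool" where
  "smooth_on S f \<longleftrightarrow> (\<forall>k. Ck_on k S f)"

section \<open>Traces and determinants of endomorphisms of a subspace\<close>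

text \<open>
  \<open>T\<close> is a linear subspace and \<open>L\<close> restricts to a linear map \<open>T \<rightarrow> T\<close>. The values of \<open>L\<close> outside
  \<open>T\<close> play no role, and the result does not depend on the basis that is chosen.
\<close>

definition some_basis :: "'a::euclidean_space set \<Rightarrow> 'a set" where
  "some_basis T = (SOME B. independent B \<and> span B = T)"

definition trace_on :: "'a::euclidean_space set \<Rightarrow> ('a \<Rightarrow> 'a) \<Rightarrow> real" where
  "trace_on T L = (\<Sum>b\<in>some_basis T. representation (some_basis T) (L b) b)"

definition det_on :: "'a::euclidean_space set \<Rightarrow> ('a \<Rightarrow> 'a) \<Rightarrow> real" where
  "det_on T L =
     (\<Sum>\<pi> | \<pi> permutes some_basis T.
        of_int (sign \<pi>) * (\<Prod>b\<in>some_basis T. representation (some_basis T) (L b) (\<pi> b)))"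

section \<open>Embedded surfaces\<close>

definition local_param :: "(real^3) set \<Rightarrow> (real^2) set \<Rightarrow> (real^2 \<Rightarrow> real^3) \<Rightarrow> bool" where
  "local_param M U \<phi> \<longleftrightarrow>
     open U \<and> smooth_on U \<phi> \<and>
     (\<forall>u\<in>U. inj (frechet_derivative \<phi> (at u))) \<and>
     openin (top_of_set M) (\<phi> ` U) \<and>
     (\<exists>\<psi>. homeomorphism U (\<phi> ` U) \<phi> \<psi>)"

text \<open>
  Embedded smooth surfaces without boundary. They need not be closed subsets of the space.
\<close>

definition regular_surface :: "(real^3) set \<Rightarrow> bool" where
  "regular_surface M \<longleftrightarrow> (\<forall>p\<in>M. \<exists>U \<phi>. local_param M U \<phi> \<and> p \<in> \<phi> ` U)"

text \<open>The linear plane of the velocities at \<open>p\<close> of smooth curves in \<open>M\<close>.\<close>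

definition tangent_space :: "(real^3) set \<Rightarrow> real^3 \<Rightarrow> (real^3) set" where
  "tangent_space M p =
     {v. \<exists>\<gamma> e. e > 0 \<and> smooth_on {-e<..<e} \<gamma> \<and> \<gamma> ` {-e<..<e} \<subseteq> M \<and>
            \<gamma> 0 = p \<and> (\<gamma> has_vector_derivative v) (at (0::real))}"

definition smooth_on_surface ::
    "(real^3) set \<Rightarrow> (real^3 \<Rightarrow> 'b::real_normed_vector) \<Rightarrow> bool" where
  "smooth_on_surface M f \<longleftrightarrow> (\<forall>U \<phi>. local_param M U \<phi> \<longrightarrow> smooth_on U (f \<circ> \<phi>))"

text \<open>
  The differential of a map \<open>f\<close> on \<open>M\<close>. The derivative within \<open>M\<close> involves the values of \<open>f\<close> on
  \<open>M\<close> only; it is unique on \<open>tangent_space M p\<close>, where it is the usual differential, but not off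
  the tangent space, where it must not be used.
\<close>

definition surface_differential ::
    "(real^3) set \<Rightarrow> (real^3 \<Rightarrow> 'b::real_normed_vector) \<Rightarrow> real^3 \<Rightarrow> real^3 \<Rightarrow> 'b" where
  "surface_differential M f p = frechet_derivative f (at p within M)"

definition unit_normal_field :: "(real^3) set \<Rightarrow> (real^3 \<Rightarrow> real^3) \<Rightarrow> bool" where
  "unit_normal_field M n \<longleftrightarrow>
     smooth_on_surface M n \<and>
     (\<forall>p\<in>M. norm (n p) = 1 \<and> (\<forall>v\<in>tangent_space M p. n p \<bullet> v = 0))"

text \<open>
  The Euclidean Gaussian curvature of an orientable surface, as the determinant of the differential
  of the Euclidean Gauss map. It is unaffected by changing the sign of the normal.
\<close>

definition gaussian_curvature :: "(real^3) set \<Rightarrow> real^3 \<Rightarrow> real" where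
  "gaussian_curvature M p =
     det_on (tangent_space M p) (surface_differential M (SOME n. unit_normal_field M n) p)"

section \<open>Integration of 2-forms\<close>

text \<open>
  A 2-form assigns to each \<open>p\<close> an alternating bilinear form, of which only the restriction to the
  tangent space matters. The coefficient of its pullback with respect to \<open>du \<and> dv\<close>:
\<close>

definition pullback ::
    "(real^3 \<Rightarrow> real^3 \<Rightarrow> real^3 \<Rightarrow> real) \<Rightarrow> (real^2 \<Rightarrow> real^3) \<Rightarrow> real^2 \<Rightarrow> real" where
  "pullback \<beta> \<phi> u =
     \<beta> (\<phi> u) (frechet_derivative \<phi> (at u) (axis 1 1)) (frechet_derivative \<phi> (at u) (axis 2 1))"

text \<open>\<open>M\<close> carries the orientation for which the nowhere vanishing 2-form \<open>\<omega>\<close> is positive.\<close>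

definition oriented_param ::
    "(real^3) set \<Rightarrow> (real^3 \<Rightarrow> real^3 \<Rightarrow> real^3 \<Rightarrow> real) \<Rightarrow> (real^2) set \<Rightarrow> (real^2 \<Rightarrow> real^3) \<Rightarrow> bool"
  where
  "oriented_param M \<omega> U \<phi> \<longleftrightarrow> local_param M U \<phi> \<and> (\<forall>u\<in>U. pullback \<omega> \<phi> u > 0)"

text \<open>
  The integral of \<open>\<beta>\<close> over a compact surface: cut \<open>M\<close> into finitely many disjoint Borel pieces,
  each inside the image of a positively oriented parametrization, and add up the integrals of the
  pullbacks. By the change of variables formula the value is the same for all such dissections.
\<close>

definition has_form_integral ::
    "(real^3) set \<Rightarrow> (real^3 \<Rightarrow> real^3 \<Rightarrow> real^3 \<Rightarrow> real) \<Rightarrow> (real^3 \<Rightarrow> real^3 \<Rightarrow> real^3 \<Rightarrow> real) \<Rightarrow>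
     real \<Rightarrow> bool" where
  "has_form_integral M \<omega> \<beta> I \<longleftrightarrow>
     (\<exists>(n::nat) U \<phi> A.
        (\<forall>i<n. oriented_param M \<omega> (U i) (\<phi> i) \<and> A i \<in> sets borel \<and> A i \<subseteq> U i \<and>
               pullback \<beta> (\<phi> i) absolutely_integrable_on A i) \<and>
        disjoint_family_on (\<lambda>i. \<phi> i ` A i) {..<n} \<and>
        (\<Union>i<n. \<phi> i ` A i) = M \<and>
        I = (\<Sum>i<n. integral (A i) (pullback \<beta> (\<phi> i))))"

definition form_integral ::
    "(real^3) set \<Rightarrow> (real^3 \<Rightarrow> real^3 \<Rightarrow> real^3 \<Rightarrow> real) \<Rightarrow> (real^3 \<Rightarrow> real^3 \<Rightarrow> real^3 \<Rightarrow> real) \<Rightarrow>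
     real" where
  "form_integral M \<omega> \<beta> = (SOME I. has_form_integral M \<omega> \<beta> I)"

section \<open>Normed 3-space\<close>

definition is_norm :: "('a::real_vector \<Rightarrow> real) \<Rightarrow> bool" where
  "is_norm N \<longleftrightarrow>
     (\<forall>x. N x = 0 \<longleftrightarrow> x = 0) \<and> (\<forall>c x. N (c *\<^sub>R x) = \<bar>c\<bar> * N x) \<and> (\<forall>x y. N (x + y) \<le> N x + N y)"

definition smooth_norm :: "('a::euclidean_space \<Rightarrow> real) \<Rightarrow> bool" where
  "smooth_norm N \<longleftrightarrow> is_norm N \<and> smooth_on (- {0}) N"

definition strictly_convex_norm :: "('a::real_vector \<Rightarrow> real) \<Rightarrow> bool" where
  "strictly_convex_norm N \<longleftrightarrow>
     is_norm N \<and>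
     (\<forall>x y. N x = 1 \<longrightarrow> N y = 1 \<longrightarrow> x \<noteq> y \<longrightarrow>
        (\<forall>t. 0 < t \<longrightarrow> t < 1 \<longrightarrow> N ((1 - t) *\<^sub>R x + t *\<^sub>R y) < 1))"

definition minkowski_sphere :: "('a::real_vector \<Rightarrow> real) \<Rightarrow> 'a \<Rightarrow> real \<Rightarrow> 'a set" where
  "minkowski_sphere N a r = {x. N (x - a) = r}"

definition birkhoff_orthogonal :: "('a::real_vector \<Rightarrow> real) \<Rightarrow> 'a \<Rightarrow> 'a set \<Rightarrow> bool" where
  "birkhoff_orthogonal N v P \<longleftrightarrow> (\<forall>w\<in>P. \<forall>t. N v \<le> N (v + t *\<^sub>R w))"

definition birkhoff_gauss_map ::
    "(real^3 \<Rightarrow> real) \<Rightarrow> (real^3) set \<Rightarrow> (real^3 \<Rightarrow> real^3) \<Rightarrow> bool" where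
  "birkhoff_gauss_map N M \<eta> \<longleftrightarrow>
     smooth_on_surface M \<eta> \<and>
     (\<forall>p\<in>M. \<eta> p \<in> minkowski_sphere N 0 1 \<and> birkhoff_orthogonal N (\<eta> p) (tangent_space M p))"

definition outward_pointing :: "(real^3) set \<Rightarrow> (real^3 \<Rightarrow> real^3) \<Rightarrow> bool" where
  "outward_pointing M \<eta> \<longleftrightarrow>
     (\<forall>p\<in>M. \<exists>e>0. \<forall>t. 0 < t \<longrightarrow> t < e \<longrightarrow> p + t *\<^sub>R \<eta> p \<in> outside M)"

definition minkowski_mean_curvature ::
    "(real^3) set \<Rightarrow> (real^3 \<Rightarrow> real^3) \<Rightarrow> real^3 \<Rightarrow> real" where
  "minkowski_mean_curvature M \<eta> p =
     (1/2) * trace_on (tangent_space M p) (surface_differential M \<eta> p)"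

definition area_form :: "(real^3 \<Rightarrow> real^3) \<Rightarrow> real^3 \<Rightarrow> real^3 \<Rightarrow> real^3 \<Rightarrow> real" where
  "area_form \<eta> p X Y = det (vector [X, Y, \<eta> p] :: real^3^3)"

end

theory Submission
  imports Defs
begin

text \<open>
  Every point \<open>x\<close> of the enclosed region \<open>D\<close> has a nearest point \<open>p\<close> on \<open>M\<close>, and
  \<open>x = p - t \<eta>(p)\<close> where \<open>t\<close> is the distance. Let \<open>g\<close> be the Hessian of the norm at \<open>\<eta>(p)\<close>,
  restricted to \<open>T\<^sub>pM\<close>; it is positive definite because the curvature of the unit sphere
  does not vanish, and \<open>d\<eta>\<close> is self-adjoint for it. The second order condition at the nearest
  point says that \<open>1 - t d\<eta>\<close> is positive semidefinite for \<open>g\<close>. Hence \<open>t H \<le> 1\<close>, and with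
  \<open>K = det d\<eta>\<close> the Jacobian \<open>1 - 2tH + t\<^sup>2K\<close> of the normal flow \<open>(p, t) \<mapsto> p - t \<eta>(p)\<close> lies
  between \<open>0\<close> and \<open>(1 - tH)\<^sup>2\<close>. So the volume of \<open>D\<close> is at most the integral over \<open>M\<close> of
  \<open>\<integral>\<^sub>0\<^bsup>1/H\<^esup> (1 - tH)\<^sup>2 dt = 1/(3H)\<close>.

  Equality forces \<open>K = H\<^sup>2\<close> almost everywhere, hence everywhere by continuity, so that
  \<open>d\<eta> = H id\<close>. Comparing mixed derivatives, \<open>H\<close> and \<open>\<eta> - H p\<close> are constant, and \<open>\<eta>\<close> maps \<open>M\<close>
  injectively, hence onto, the unit sphere. Conversely, for a Minkowski sphere the volume is
  computed in polar coordinates about the centre.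
\<close>

section \<open>Smooth maps\<close>

text \<open>The norm enters through its gradient \<open>\<nu>\<close>, which is homogeneous of
  degree 0. Birkhoff orthogonality of \<open>\<eta> p\<close> to the tangent plane becomes the
  linear condition that \<open>\<nu> (\<eta> p)\<close> annihilates that plane, and such a condition
  can be differentiated in charts. The Euclidean Gauss map occurs only on the unit sphere, where it
  turns the curvature hypothesis into definiteness of the Hessian.

  The volume bound is a covering argument: the region lies in the image of the flow, and overlaps
  only help. The domain of the flow has to include the condition that the Jacobian is nonnegative,
  because a very negative \<open>K\<close> would otherwise make its absolute value exceed
  \<open>(1 - tH)^2\<close>.

  The integral over \<open>M\<close> is a choice among the values that dissections into Borel pieces
  of charts produce. Both claims are proved for every dissection, and separately a dissection is
  shown to exist. In the equality case the exceptional set is known to be null in each Borel piece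
  only. These null sets are carried into an arbitrary chart, where the exceptional set is also open
  and therefore empty.\<close>

lemma Ck_on_cong:
  assumes "open S" "\<And>x. x \<in> S \<Longrightarrow> f x = g x" "Ck_on k S f"
  shows "Ck_on k S g"
  using assms(2,3)
proof (induction k arbitrary: f g)
  case 0
  then show ?case by (simp cong: continuous_on_cong)
next
  case (Suc k)
  have d: "(g has_derivative frechet_derivative f (at x)) (at x)" if "x \<in> S" for x
  proof (rule has_derivative_transform_within_open[OF _ assms(1) that])
    show "(f has_derivative frechet_derivative f (at x)) (at x)"
      using Suc.prems(2) that by (simp add: frechet_derivative_works)
  qed (use Suc.prems(1) in auto)
  have "Ck_on k S (\<lambda>x. frechet_derivative g (at x) v)" for v
  proof (rule Suc.IH[of "\<lambda>x. frechet_derivative f (at x) v"])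
    show "frechet_derivative f (at x) v = frechet_derivative g (at x) v" if "x \<in> S" for x
      using frechet_derivative_at[OF d[OF that]] by simp
  qed (use Suc.prems in simp)
  moreover have "g differentiable (at x)" if "x \<in> S" for x
    using d[OF that] by (auto simp: differentiable_def)
  ultimately show ?case by simp
qed

lemma Ck_on_SucI:
  assumes "open S" "\<And>x. x \<in> S \<Longrightarrow> (f has_derivative f' x) (at x)"
    "\<And>v. Ck_on k S (\<lambda>x. f' x v)"
  shows "Ck_on (Suc k) S f"
proof -
  have "Ck_on k S (\<lambda>x. frechet_derivative f (at x) v)" for v
    by (rule Ck_on_cong[OF assms(1) _ assms(3)]) (simp add: frechet_derivative_at[OF assms(2), symmetric])
  then show ?thesis using assms(2) by (auto simp: differentiable_def)
qed

lemma Ck_on_has_derivative: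
  assumes "Ck_on (Suc k) S f" "x \<in> S"
  shows "(f has_derivative frechet_derivative f (at x)) (at x)"
  using assms by (simp add: frechet_derivative_works)

lemma Ck_on_continuous: "Ck_on k S f \<Longrightarrow> continuous_on S f"
  by (cases k) (auto intro!: continuous_at_imp_continuous_on differentiable_imp_continuous_within)

lemma Ck_on_Suc: "Ck_on (Suc k) S f \<Longrightarrow> Ck_on k S f"
proof (induction k arbitrary: f)
  case 0
  then show ?case using Ck_on_continuous[of "Suc 0" S f] by simp
next
  case (Suc k)
  have "Ck_on k S (\<lambda>x. frechet_derivative f (at x) v)" for v
    using Suc.prems by (intro Suc.IH) simp
  then show ?case using Suc.prems by simp
qed

lemma Ck_on_subset: "Ck_on k S f \<Longrightarrow> T \<subseteq> S \<Longrightarrow> Ck_on k T f"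
  by (induction k arbitrary: f) (auto intro: continuous_on_subset)

lemma Ck_on_const: "open S \<Longrightarrow> Ck_on k S (\<lambda>x. c)"
proof (induction k arbitrary: c)
  case (Suc k)
  show ?case
    by (rule Ck_on_SucI[OF Suc.prems, where f'="\<lambda>x h. 0"]) (auto intro: Suc)
qed auto

lemma Ck_on_bounded_linear:
  assumes "open S" "bounded_linear L" "Ck_on k S f"
  shows "Ck_on k S (\<lambda>x. L (f x))"
  using assms(3)
proof (induction k arbitrary: f)
  case 0
  then show ?case using linear_continuous_on_compose bounded_linear.continuous_on[OF assms(2)] by auto
next
  case (Suc k)
  show ?case
    by (rule Ck_on_SucI[OF assms(1), where f'="\<lambda>x h. L (frechet_derivative f (at x) h)"])
      (use Suc in \<open>auto intro!: bounded_linear.has_derivative[OF assms(2)] Ck_on_has_derivative[OF Suc.prems]\<close>)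
qed

lemma Ck_on_add:
  assumes "open S" "Ck_on k S f" "Ck_on k S g"
  shows "Ck_on k S (\<lambda>x. f x + g x)"
  using assms(2,3)
proof (induction k arbitrary: f g)
  case 0
  then show ?case by (auto intro: continuous_intros)
next
  case (Suc k)
  show ?case
    by (rule Ck_on_SucI[OF assms(1) has_derivative_add[OF
        Ck_on_has_derivative[OF Suc.prems(1)] Ck_on_has_derivative[OF Suc.prems(2)]]])
      (use Suc in auto)
qed

lemma Ck_on_sum:
  assumes "open S" "\<And>i. i \<in> I \<Longrightarrow> Ck_on k S (f i)"
  shows "Ck_on k S (\<lambda>x. \<Sum>i\<in>I. f i x)"
  using assms(2)
  by (induction I rule: infinite_finite_induct) (auto intro!: Ck_on_const Ck_on_add assms(1))

lemma Ck_on_bilinear: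
  assumes "open S" "bounded_bilinear B" "Ck_on k S f" "Ck_on k S g"
  shows "Ck_on k S (\<lambda>x. B (f x) (g x))"
  using assms(3,4)
proof (induction k arbitrary: f g)
  case 0
  then show ?case by (auto intro: bounded_bilinear.continuous_on[OF assms(2)])
next
  case (Suc k)
  show ?case
  proof (rule Ck_on_SucI[OF assms(1) bounded_bilinear.FDERIV[OF assms(2)
        Ck_on_has_derivative[OF Suc.prems(1)] Ck_on_has_derivative[OF Suc.prems(2)]]])
    fix v
    have "Ck_on k S (\<lambda>x. frechet_derivative f (at x) v)" "Ck_on k S (\<lambda>x. frechet_derivative g (at x) v)"
      using Suc.prems by simp_all
    then show "Ck_on k S (\<lambda>x. B (f x) (frechet_derivative g (at x) v) + B (frechet_derivative f (at x) v) (g x))"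
      by (intro Ck_on_add[OF assms(1)] Suc.IH Ck_on_Suc[OF Suc.prems(1)] Ck_on_Suc[OF Suc.prems(2)])
  qed
qed

text \<open>In the chain rule both the base point and the direction fed to the derivative of
  \<open>g\<close> depend on \<open>x\<close>, whereas \<open>Ck_on\<close> speaks of fixed
  directions. Expanding the direction in \<open>Basis\<close> leaves a sum of products to which the
  induction hypothesis, for general \<open>g\<close>, applies.\<close>

lemma Ck_on_compose:
  fixes f :: "'a::euclidean_space \<Rightarrow> 'b::euclidean_space" and g :: "'b \<Rightarrow> 'c::real_normed_vector"
  assumes "open S" "open T" "f ` S \<subseteq> T" "Ck_on k S f" "Ck_on k T g"
  shows "Ck_on k S (\<lambda>x. g (f x))"
  using assms(4,5)
proof (induction k arbitrary: g)
  case 0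
  then show ?case using assms(3) by (auto intro: continuous_on_compose2)
next
  case (Suc k)
  have d: "((\<lambda>x. g (f x)) has_derivative
      (\<lambda>v. \<Sum>b\<in>Basis. (frechet_derivative f (at x) v \<bullet> b) *\<^sub>R frechet_derivative g (at (f x)) b)) (at x)"
    if "x \<in> S" for x
  proof -
    have "f x \<in> T" using that assms(3) by auto
    then have g: "(g has_derivative frechet_derivative g (at (f x))) (at (f x))"
      by (rule Ck_on_has_derivative[OF Suc.prems(2)])
    interpret bounded_linear "frechet_derivative g (at (f x))"
      using g by (rule has_derivative_bounded_linear)
    have eq: "frechet_derivative g (at (f x)) w = (\<Sum>b\<in>Basis. (w \<bullet> b) *\<^sub>R frechet_derivative g (at (f x)) b)" for w
      by (subst euclidean_representation[of w, symmetric]) (simp add: sum scaleR)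
    have "(\<lambda>v. frechet_derivative g (at (f x)) (frechet_derivative f (at x) v)) =
      (\<lambda>v. \<Sum>b\<in>Basis. (frechet_derivative f (at x) v \<bullet> b) *\<^sub>R frechet_derivative g (at (f x)) b)"
      using eq by blast
    with has_derivative_compose[OF Ck_on_has_derivative[OF Suc.prems(1) that] g] show ?thesis
      by (rule subst[rotated])
  qed
  show ?case
  proof (rule Ck_on_SucI[OF assms(1) d])
    fix v
    have "Ck_on k S (\<lambda>x. (frechet_derivative f (at x) v \<bullet> b) *\<^sub>R frechet_derivative g (at (f x)) b)" for b
    proof (intro Ck_on_bilinear[OF assms(1) bounded_bilinear_scaleR]
          Ck_on_bounded_linear[OF assms(1) bounded_linear_inner_left] Suc.IH)
    qed (use Suc.prems Ck_on_Suc[OF Suc.prems(1)] in simp_all)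
    then show "Ck_on k S (\<lambda>x. \<Sum>b\<in>Basis. (frechet_derivative f (at x) v \<bullet> b) *\<^sub>R frechet_derivative g (at (f x)) b)"
      by (intro Ck_on_sum[OF assms(1)]) auto
  qed
qed

text \<open>The derivative is \<open>-1/2\<close> times the cube of the function itself, so the
  induction closes without any other function. Every normalisation below is built from this
  one.\<close>

lemma Ck_on_inverse_sqrt: "Ck_on k {0<..} (\<lambda>x::real. inverse (sqrt x))"
proof (induction k)
  case 0
  have "continuous_on {0<..} (\<lambda>x::real. inverse (sqrt x))"
    by (intro continuous_on_inverse continuous_on_real_sqrt continuous_on_id) simp
  then show ?case by simp
next
  case (Suc k)
  let ?h = "\<lambda>x::real. inverse (sqrt x)"
  have o: "open {0::real<..}" by simp
  have d: "(?h has_derivative (\<lambda>v. (- (v/2)) * (?h x * (?h x * ?h x)))) (at x)" if "x \<in> {0<..}" for x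
  proof -
    have "x > 0" using that by simp
    from DERIV_inverse_fun[OF DERIV_real_sqrt[OF this]]
    have d: "(?h has_real_derivative - (inverse (sqrt x) / 2 * inverse (sqrt x ^ Suc (Suc 0)))) (at x)"
      using \<open>x > 0\<close> by simp
    have "inverse (sqrt x ^ Suc (Suc 0)) = ?h x * ?h x"
      by (simp only: power_Suc power_0 mult_1_right inverse_mult_distrib)
    moreover have "- (i / 2 * (i * i)) * v = - (v / 2) * (i * (i * i))" for i v :: real
      by simp
    ultimately have "(*) (- (inverse (sqrt x) / 2 * inverse (sqrt x ^ Suc (Suc 0)))) =
        (\<lambda>v. (- (v/2)) * (?h x * (?h x * ?h x)))"
      by (intro ext) (simp only:)
    with d show ?thesis unfolding has_field_derivative_def by (rule subst[rotated])
  qed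
  note m = Ck_on_bilinear[OF o bounded_bilinear_mult]
  show ?case
    by (rule Ck_on_SucI[OF o d], assumption, rule m[OF Ck_on_const[OF o] m[OF Suc m[OF Suc Suc]]])
qed

lemma smooth_on_frechet:
  assumes "smooth_on S f" shows "smooth_on S (\<lambda>x. frechet_derivative f (at x) v)"
  unfolding smooth_on_def
proof
  show "Ck_on k S (\<lambda>x. frechet_derivative f (at x) v)" for k
    using assms[unfolded smooth_on_def, rule_format, of "Suc k"] by simp
qed

lemma smooth_on_has_derivative:
  assumes "smooth_on S f" "x \<in> S"
  shows "(f has_derivative frechet_derivative f (at x)) (at x)"
  using Ck_on_has_derivative[OF assms(1)[unfolded smooth_on_def, rule_format, of "Suc 0"] assms(2)] .

lemma smooth_on_continuous: "smooth_on S f \<Longrightarrow> continuous_on S f"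
  by (rule Ck_on_continuous[of 0]) (simp only: smooth_on_def)

lemma smooth_on_continuous_frechet:
  "smooth_on S f \<Longrightarrow> continuous_on S (\<lambda>x. frechet_derivative f (at x) v)"
  by (intro smooth_on_continuous smooth_on_frechet)

lemma smooth_on_compose:
  fixes f :: "'a::euclidean_space \<Rightarrow> 'b::euclidean_space" and g :: "'b \<Rightarrow> 'c::real_normed_vector"
  assumes "open S" "open T" "f ` S \<subseteq> T" "smooth_on S f" "smooth_on T g"
  shows "smooth_on S (\<lambda>x. g (f x))"
  unfolding smooth_on_def
  by (rule allI, rule Ck_on_compose[OF assms(1-3)]) (use assms in \<open>simp_all only: smooth_on_def\<close>)

lemma smooth_on_bounded_linear:
  assumes "open S" "bounded_linear L"
  shows "smooth_on S L"
proof -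
  have "Ck_on k S L" for k
  proof (cases k)
    case (Suc n)
    then show ?thesis
      by (simp only: Suc) (rule Ck_on_SucI[OF assms(1) bounded_linear_imp_has_derivative[OF assms(2)] Ck_on_const[OF assms(1)]])
  qed (use linear_continuous_on[OF assms(2)] in simp)
  then show ?thesis by (simp add: smooth_on_def)
qed

lemma smooth_on_bilinear:
  assumes "open S" "bounded_bilinear B" "smooth_on S f" "smooth_on S g"
  shows "smooth_on S (\<lambda>x. B (f x) (g x))"
  unfolding smooth_on_def
  by (rule allI, rule Ck_on_bilinear[OF assms(1,2)]) (use assms in \<open>simp_all only: smooth_on_def\<close>)

lemma smooth_on_add:
  assumes "open S" "smooth_on S f" "smooth_on S g"
  shows "smooth_on S (\<lambda>x. f x + g x)"
  unfolding smooth_on_def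
  by (rule allI, rule Ck_on_add[OF assms(1)]) (use assms in \<open>simp_all only: smooth_on_def\<close>)

lemma smooth_on_const: "open S \<Longrightarrow> smooth_on S (\<lambda>x. c)"
  unfolding smooth_on_def by (intro allI Ck_on_const)

lemma smooth_on_sum:
  assumes "open S" "\<And>i. i \<in> I \<Longrightarrow> smooth_on S (f i)"
  shows "smooth_on S (\<lambda>x. \<Sum>i\<in>I. f i x)"
  unfolding smooth_on_def
  by (rule allI, rule Ck_on_sum[OF assms(1)]) (use assms in \<open>simp_all only: smooth_on_def\<close>)

lemma smooth_on_subset: "smooth_on S f \<Longrightarrow> T \<subseteq> S \<Longrightarrow> smooth_on T f"
  unfolding smooth_on_def by (rule, rule Ck_on_subset[of _ S f T]) simp_all

lemma smooth_on_cong: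
  assumes "open S" "\<And>x. x \<in> S \<Longrightarrow> f x = g x" "smooth_on S f"
  shows "smooth_on S g"
  unfolding smooth_on_def
  by (rule allI, rule Ck_on_cong[OF assms(1,2)]) (use assms in \<open>simp_all only: smooth_on_def\<close>)

lemma smooth_on_inverse_sqrt: "smooth_on {0<..} (\<lambda>x::real. inverse (sqrt x))"
  unfolding smooth_on_def by (intro allI Ck_on_inverse_sqrt)

section \<open>Symmetry of second derivatives\<close>

text \<open>The second difference is symmetric in \<open>u\<close> and \<open>v\<close>, so both mixed derivatives are its limit.\<close>

lemma second_difference:
  fixes f :: "'a::euclidean_space \<Rightarrow> real"
  assumes "open S" "Ck_on 2 S f" "\<And>s t. \<lbrakk>0 \<le> s; s \<le> h; 0 \<le> t; t \<le> h\<rbrakk> \<Longrightarrow> x + s *\<^sub>R u + t *\<^sub>R v \<in> S" "0 < h"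
  shows "\<exists>s t. 0 \<le> s \<and> s \<le> h \<and> 0 \<le> t \<and> t \<le> h \<and>
    f (x + h *\<^sub>R u + h *\<^sub>R v) - f (x + h *\<^sub>R u) - f (x + h *\<^sub>R v) + f x =
    h^2 * frechet_derivative (\<lambda>y. frechet_derivative f (at y) u) (at (x + s *\<^sub>R u + t *\<^sub>R v)) v"
proof -
  let ?p = "\<lambda>s t. x + s *\<^sub>R u + t *\<^sub>R v"
  let ?D = "\<lambda>y. frechet_derivative f (at y) u"
  have C: "Ck_on (Suc (Suc 0)) S f" using assms(2) by (simp only: numeral_2_eq_2)
  have d1: "((\<lambda>s. f (?p s t)) has_real_derivative ?D (?p s t)) (at s)" if "0 \<le> s" "s \<le> h" "0 \<le> t" "t \<le> h" for s t
  proof -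
    have "((\<lambda>s. ?p s t) has_derivative (\<lambda>r. r *\<^sub>R u)) (at s)"
      by (auto intro!: derivative_eq_intros)
    from has_derivative_compose[OF this Ck_on_has_derivative[OF C assms(3)[OF that]]]
    show ?thesis
      unfolding has_field_derivative_def
      by (rule has_derivative_eq_rhs)
        (simp add: fun_eq_iff linear_scale[OF has_derivative_linear[OF Ck_on_has_derivative[OF C assms(3)[OF that]]]])
  qed
  have C1: "Ck_on (Suc 0) S ?D" using C by simp
  have d2: "((\<lambda>t. ?D (?p s t)) has_real_derivative frechet_derivative ?D (at (?p s t)) v) (at t)"
    if "0 \<le> s" "s \<le> h" "0 \<le> t" "t \<le> h" for s t
  proof -
    have "((\<lambda>t. ?p s t) has_derivative (\<lambda>r. r *\<^sub>R v)) (at t)"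
      by (auto intro!: derivative_eq_intros)
    from has_derivative_compose[OF this Ck_on_has_derivative[OF C1 assms(3)[OF that]]]
    show ?thesis
      unfolding has_field_derivative_def
      by (rule has_derivative_eq_rhs)
        (simp add: fun_eq_iff linear_scale[OF has_derivative_linear[OF Ck_on_has_derivative[OF C1 assms(3)[OF that]]]])
  qed
  \<comment> \<open>The second difference is \<open>F h - F 0\<close>. The mean value theorem is
    applied to \<open>F\<close> in the direction \<open>u\<close>, and then in the direction
    \<open>v\<close> to the difference that its derivative is.\<close>
  define F where "F = (\<lambda>s. f (?p s h) - f (?p s 0))"
  define F' where "F' = (\<lambda>s. ?D (?p s h) - ?D (?p s 0))"
  define E where "E = (\<lambda>t s. frechet_derivative ?D (at (?p s t)) v)"
  have "(F has_real_derivative F' s) (at s)" if "0 \<le> s" "s \<le> h" for s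
    unfolding F_def F'_def using that \<open>0 < h\<close> by (intro DERIV_diff d1) auto
  from MVT2[OF \<open>0 < h\<close> this] obtain s where s: "0 < s" "s < h" "F h - F 0 = h * F' s"
    by auto
  have "((\<lambda>t. ?D (?p s t)) has_real_derivative E t s) (at t)" if "0 \<le> t" "t \<le> h" for t
    unfolding E_def using that s by (intro d2) auto
  from MVT2[OF \<open>0 < h\<close> this] obtain t where t: "0 < t" "t < h" "F' s = h * E t s"
    by (auto simp: F'_def)
  have "F h - F 0 = h\<^sup>2 * E t s"
    using s(3) t(3) by (simp add: power2_eq_square)
  then have "f (x + h *\<^sub>R u + h *\<^sub>R v) - f (x + h *\<^sub>R u) - f (x + h *\<^sub>R v) + f x = h\<^sup>2 * E t s"
    by (simp add: F_def)
  then have "0 \<le> s \<and> s \<le> h \<and> 0 \<le> t \<and> t \<le> h \<and>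
    f (x + h *\<^sub>R u + h *\<^sub>R v) - f (x + h *\<^sub>R u) - f (x + h *\<^sub>R v) + f x = h\<^sup>2 * E t s"
    using s(1,2) t(1,2) by linarith
  then show ?thesis unfolding E_def by (rule_tac exI, rule_tac exI)
qed

text \<open>Suppose that the mixed derivatives differ by \<open>2e\<close> at \<open>x\<close>. Near
  \<open>x\<close> each of them stays within \<open>e\<close> of its value at \<open>x\<close>, yet
  the common second difference makes a value of one equal to a value of the other.\<close>

lemma frechet_derivative_swap_real:
  fixes f :: "'a::euclidean_space \<Rightarrow> real"
  assumes "open S" "Ck_on 2 S f" "x \<in> S"
  shows "frechet_derivative (\<lambda>y. frechet_derivative f (at y) u) (at x) v =
         frechet_derivative (\<lambda>y. frechet_derivative f (at y) v) (at x) u" (is "?A x = ?B x")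
proof (rule ccontr)
  assume ne: "?A x \<noteq> ?B x"
  define e where "e = \<bar>?A x - ?B x\<bar> / 2"
  have e: "e > 0" using ne by (simp add: e_def)
  have C: "Ck_on (Suc (Suc 0)) S f" using assms(2) by (simp only: numeral_2_eq_2)
  have "continuous_on S ?A" "continuous_on S ?B"
    using C by auto
  then have "isCont ?A x" "isCont ?B x"
    using assms continuous_on_eq_continuous_at by blast+
  then obtain d1 d2 where d: "d1 > 0" "\<And>y. dist y x < d1 \<Longrightarrow> dist (?A y) (?A x) < e"
    "d2 > 0" "\<And>y. dist y x < d2 \<Longrightarrow> dist (?B y) (?B x) < e"
    using e unfolding continuous_at_eps_delta by metis
  obtain d3 where d3: "d3 > 0" "ball x d3 \<subseteq> S" using assms openE by blast
  \<comment> \<open>The step \<open>h\<close> is so small that the whole parallelogram spanned by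
    \<open>h u\<close> and \<open>h v\<close> stays within \<open>r\<close> of \<open>x\<close>, in
    either order of the two directions. The summand 1 in \<open>k\<close> covers
    \<open>u = v = 0\<close>.\<close>
  define r where "r = min d1 (min d2 d3)"
  define k where "k = norm u + norm v + 1"
  define h where "h = r / (2 * k)"
  have r: "r > 0" using d d3 by (simp add: r_def)
  have k: "k > 0" by (simp add: k_def add_nonneg_pos)
  have h: "h > 0" using r k by (simp add: h_def)
  have small: "dist (x + s *\<^sub>R a + t *\<^sub>R b) x < r"
    if "0 \<le> s" "s \<le> h" "0 \<le> t" "t \<le> h" "norm a + norm b \<le> norm u + norm v" for s t a b
  proof -
    have "dist (x + s *\<^sub>R a + t *\<^sub>R b) x = norm (s *\<^sub>R a + t *\<^sub>R b)"
      by (simp add: dist_norm add.assoc)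
    also have "\<dots> \<le> s * norm a + t * norm b"
      using norm_triangle_ineq[of "s *\<^sub>R a" "t *\<^sub>R b"] that by simp
    also have "\<dots> \<le> h * norm a + h * norm b"
      using that by (intro add_mono mult_right_mono) auto
    also have "\<dots> = h * (norm a + norm b)" by (simp add: algebra_simps)
    also have "\<dots> \<le> h * (norm u + norm v)" using that h by (intro mult_left_mono) auto
    also have "\<dots> < h * (2 * k)" using h k by (intro mult_strict_left_mono) (auto simp: k_def)
    also have "\<dots> = r" using k by (simp add: h_def)
    finally show ?thesis .
  qed
  have inS: "x + s *\<^sub>R a + t *\<^sub>R b \<in> S"
    if "0 \<le> s" "s \<le> h" "0 \<le> t" "t \<le> h" "norm a + norm b \<le> norm u + norm v" for s t a b
    using small[OF that] d3 by (auto simp: r_def dist_commute)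
  obtain s t where st: "0 \<le> s" "s \<le> h" "0 \<le> t" "t \<le> h"
    "f (x + h *\<^sub>R u + h *\<^sub>R v) - f (x + h *\<^sub>R u) - f (x + h *\<^sub>R v) + f x = h^2 * ?A (x + s *\<^sub>R u + t *\<^sub>R v)"
    using second_difference[OF assms(1,2) inS h, of u v] by force
  obtain s' t' where st': "0 \<le> s'" "s' \<le> h" "0 \<le> t'" "t' \<le> h"
    "f (x + h *\<^sub>R v + h *\<^sub>R u) - f (x + h *\<^sub>R v) - f (x + h *\<^sub>R u) + f x = h^2 * ?B (x + s' *\<^sub>R v + t' *\<^sub>R u)"
    using second_difference[OF assms(1,2) inS h, of v u] by force
  have "h^2 * ?A (x + s *\<^sub>R u + t *\<^sub>R v) = h^2 * ?B (x + s' *\<^sub>R v + t' *\<^sub>R u)"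
    using st(5) st'(5) by (simp add: algebra_simps)
  then have eq: "?A (x + s *\<^sub>R u + t *\<^sub>R v) = ?B (x + s' *\<^sub>R v + t' *\<^sub>R u)" using h by simp
  have "dist (?A (x + s *\<^sub>R u + t *\<^sub>R v)) (?A x) < e"
    using small[OF st(1-4)] by (intro d(2)) (auto simp: r_def)
  moreover have "dist (?B (x + s' *\<^sub>R v + t' *\<^sub>R u)) (?B x) < e"
    using small[OF st'(1-4)] by (intro d(4)) (auto simp: r_def add.commute)
  ultimately have "dist (?A x) (?B x) < e + e"
    using eq dist_triangle_less_add[of "?A x" _ e "?B x" e] by (metis dist_commute)
  then show False by (simp add: dist_real_def e_def)
qed

lemma frechet_derivative_swap:
  fixes f :: "'a::euclidean_space \<Rightarrow> 'b::euclidean_space"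
  assumes "open S" "smooth_on S f" "x \<in> S"
  shows "frechet_derivative (\<lambda>y. frechet_derivative f (at y) u) (at x) v =
         frechet_derivative (\<lambda>y. frechet_derivative f (at y) v) (at x) u"
proof (rule euclidean_eqI)
  fix b :: 'b assume "b \<in> Basis"
  let ?g = "\<lambda>x. f x \<bullet> b"
  have C: "Ck_on 2 S ?g"
    using assms(2) Ck_on_bounded_linear[OF assms(1) bounded_linear_inner_left, of 2 f b]
    by (simp add: smooth_on_def)
  have d1: "frechet_derivative ?g (at y) w = frechet_derivative f (at y) w \<bullet> b" if "y \<in> S" for y w
    using frechet_derivative_at[OF bounded_linear.has_derivative[OF bounded_linear_inner_left
          smooth_on_has_derivative[OF assms(2) that]], symmetric]
    by (simp add: fun_eq_iff)
  have d2: "frechet_derivative (\<lambda>y. frechet_derivative ?g (at y) w) (at x) w' =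
       frechet_derivative (\<lambda>y. frechet_derivative f (at y) w) (at x) w' \<bullet> b" for w w'
  proof -
    have "((\<lambda>y. frechet_derivative f (at y) w \<bullet> b) has_derivative
      (\<lambda>w'. frechet_derivative (\<lambda>y. frechet_derivative f (at y) w) (at x) w' \<bullet> b)) (at x)"
      by (rule bounded_linear.has_derivative[OF bounded_linear_inner_left
          smooth_on_has_derivative[OF smooth_on_frechet[OF assms(2)] assms(3)]])
    then have "((\<lambda>y. frechet_derivative ?g (at y) w) has_derivative
      (\<lambda>w'. frechet_derivative (\<lambda>y. frechet_derivative f (at y) w) (at x) w' \<bullet> b)) (at x)"
      by (rule has_derivative_transform_within_open[OF _ assms(1,3)]) (simp add: d1)
    from frechet_derivative_at[OF this] show ?thesis by (simp add: fun_eq_iff)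
  qed
  show "frechet_derivative (\<lambda>y. frechet_derivative f (at y) u) (at x) v \<bullet> b =
        frechet_derivative (\<lambda>y. frechet_derivative f (at y) v) (at x) u \<bullet> b"
    using frechet_derivative_swap_real[OF assms(1) C assms(3), of u v] by (simp add: d2)
qed

declare Ck_on.simps [simp del]

section \<open>Charts, tangent planes and differentials\<close>

abbreviation fder :: "('a::real_normed_vector \<Rightarrow> 'b::real_normed_vector) \<Rightarrow> 'a \<Rightarrow> 'a \<Rightarrow> 'b" where
  "fder f x \<equiv> frechet_derivative f (at x)"

section \<open>Trace and determinant of an endomorphism of a plane\<close>

lemma representation_pair:
  fixes b1 b2 :: "'a::euclidean_space"
  assumes "independent {b1, b2}" "b1 \<noteq> b2"
  shows "representation {b1, b2} (\<alpha> *\<^sub>R b1 + \<beta> *\<^sub>R b2) b1 = \<alpha>"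
    and "representation {b1, b2} (\<alpha> *\<^sub>R b1 + \<beta> *\<^sub>R b2) b2 = \<beta>"
proof -
  have s: "b1 \<in> span {b1, b2}" "b2 \<in> span {b1, b2}" by (auto intro: span_base)
  have "representation {b1, b2} (\<alpha> *\<^sub>R b1 + \<beta> *\<^sub>R b2) =
      (\<lambda>b. \<alpha> * representation {b1, b2} b1 b + \<beta> * representation {b1, b2} b2 b)"
    using assms s by (simp add: representation_add representation_scale span_scale)
  then show "representation {b1, b2} (\<alpha> *\<^sub>R b1 + \<beta> *\<^sub>R b2) b1 = \<alpha>"
      "representation {b1, b2} (\<alpha> *\<^sub>R b1 + \<beta> *\<^sub>R b2) b2 = \<beta>"
    using assms by (simp_all add: representation_basis)
qed

lemma some_basis_plane:
  fixes X Y :: "'a::euclidean_space"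
  assumes "independent {X, Y}" "X \<noteq> Y" "T = span {X, Y}"
  obtains b1 b2 where "some_basis T = {b1, b2}" "b1 \<noteq> b2" "independent {b1, b2}" "span {b1, b2} = T"
proof -
  have B: "independent (some_basis T) \<and> span (some_basis T) = T"
    unfolding some_basis_def by (rule someI[of _ "{X, Y}"]) (use assms in auto)
  have "card (some_basis T) = dim T"
    using B by (metis dim_span_eq_card_independent)
  also have "\<dots> = 2"
    using assms dim_span_eq_card_independent[of "{X, Y}"] by simp
  finally obtain b1 b2 where "some_basis T = {b1, b2}" "b1 \<noteq> b2" by (auto simp: card_2_iff)
  then show thesis using that B by metis
qed

lemma mem_span_pair: "x \<in> span {a, b} \<longleftrightarrow> (\<exists>p q. x = p *\<^sub>R a + q *\<^sub>R b)"
  by (auto simp: span_insert span_singleton diff_eq_eq add.commute)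

text \<open>\<open>some_basis\<close> is an unspecified choice, so its matrix of \<open>L\<close> is
  computed by changing basis from \<open>X\<close>, \<open>Y\<close>; the trace does not see the
  change.\<close>

lemma trace_on_plane:
  fixes X Y :: "'a::euclidean_space"
  assumes ind: "independent {X, Y}" "X \<noteq> Y" and T: "T = span {X, Y}" and L: "linear L"
    and LX: "L X = a *\<^sub>R X + c *\<^sub>R Y" and LY: "L Y = b *\<^sub>R X + d *\<^sub>R Y"
  shows "trace_on T L = a + d"
proof -
  interpret linear L by fact
  obtain b1 b2 where B: "some_basis T = {b1, b2}" "b1 \<noteq> b2" "independent {b1, b2}" "span {b1, b2} = T"
    using some_basis_plane[OF ind T] .
  have "b1 \<in> span {X, Y}" "b2 \<in> span {X, Y}" "X \<in> span {b1, b2}" "Y \<in> span {b1, b2}"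
    using B T by (auto intro: span_base)
  then obtain p q r s p' q' r' s' where
    bs: "b1 = p *\<^sub>R X + q *\<^sub>R Y" "b2 = r *\<^sub>R X + s *\<^sub>R Y" and
    XY: "X = p' *\<^sub>R b1 + q' *\<^sub>R b2" "Y = r' *\<^sub>R b1 + s' *\<^sub>R b2"
    unfolding mem_span_pair by blast
  note rep = representation_pair[OF B(3,2)]
  have b1': "1 *\<^sub>R b1 + 0 *\<^sub>R b2 = (p * p' + q * r') *\<^sub>R b1 + (p * q' + q * s') *\<^sub>R b2"
    using bs(1) unfolding XY by (simp add: algebra_simps)
  have b2': "0 *\<^sub>R b1 + 1 *\<^sub>R b2 = (r * p' + s * r') *\<^sub>R b1 + (r * q' + s * s') *\<^sub>R b2"
    using bs(2) unfolding XY by (simp add: algebra_simps)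
  have inv: "p * p' + q * r' = 1" "p * q' + q * s' = 0" "r * p' + s * r' = 0" "r * q' + s * s' = 1"
    using arg_cong[OF b1', of "\<lambda>v. representation {b1, b2} v b1"]
      arg_cong[OF b1', of "\<lambda>v. representation {b1, b2} v b2"]
      arg_cong[OF b2', of "\<lambda>v. representation {b1, b2} v b1"]
      arg_cong[OF b2', of "\<lambda>v. representation {b1, b2} v b2"]
    unfolding rep by simp_all
  have inv': "p' * p + q' * r = 1" "p' * q + q' * s = 0" "r' * p + s' * r = 0" "r' * q + s' * s = 1"
  proof -
    have x: "1 *\<^sub>R X + 0 *\<^sub>R Y = (p' * p + q' * r) *\<^sub>R X + (p' * q + q' * s) *\<^sub>R Y"
      using XY(1) unfolding bs by (simp add: algebra_simps)
    have y: "0 *\<^sub>R X + 1 *\<^sub>R Y = (r' * p + s' * r) *\<^sub>R X + (r' * q + s' * s) *\<^sub>R Y"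
      using XY(2) unfolding bs by (simp add: algebra_simps)
    note rep = representation_pair[OF ind]
    show "p' * p + q' * r = 1" "p' * q + q' * s = 0" "r' * p + s' * r = 0" "r' * q + s' * s = 1"
      using arg_cong[OF x, of "\<lambda>v. representation {X, Y} v X"]
        arg_cong[OF x, of "\<lambda>v. representation {X, Y} v Y"]
        arg_cong[OF y, of "\<lambda>v. representation {X, Y} v X"]
        arg_cong[OF y, of "\<lambda>v. representation {X, Y} v Y"]
      unfolding rep by simp_all
  qed
  have "L b1 = p *\<^sub>R L X + q *\<^sub>R L Y" using bs(1) by (simp add: add scale)
  also have "\<dots> = (p * a + q * b) *\<^sub>R X + (p * c + q * d) *\<^sub>R Y"
    by (simp add: LX LY algebra_simps)
  also have "\<dots> = ((p * a + q * b) * p' + (p * c + q * d) * r') *\<^sub>R b1 +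
      ((p * a + q * b) * q' + (p * c + q * d) * s') *\<^sub>R b2"
    unfolding XY by (simp add: algebra_simps)
  finally have 1: "representation {b1, b2} (L b1) b1 = (p * a + q * b) * p' + (p * c + q * d) * r'"
    using rep by simp
  have "L b2 = r *\<^sub>R L X + s *\<^sub>R L Y" using bs(2) by (simp add: add scale)
  also have "\<dots> = (r * a + s * b) *\<^sub>R X + (r * c + s * d) *\<^sub>R Y"
    by (simp add: LX LY algebra_simps)
  also have "\<dots> = ((r * a + s * b) * p' + (r * c + s * d) * r') *\<^sub>R b1 +
      ((r * a + s * b) * q' + (r * c + s * d) * s') *\<^sub>R b2"
    unfolding XY by (simp add: algebra_simps)
  finally have 2: "representation {b1, b2} (L b2) b2 = (r * a + s * b) * q' + (r * c + s * d) * s'"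
    using rep by simp
  have "trace_on T L = (p * a + q * b) * p' + (p * c + q * d) * r' + ((r * a + s * b) * q' + (r * c + s * d) * s')"
    unfolding trace_on_def B(1) using B(2) by (simp add: 1 2)
  \<comment> \<open>Cyclicity of the trace: the factors of \<open>a\<close>, \<open>b\<close>,
    \<open>c\<close>, \<open>d\<close> are the entries of the product of the two change of basis
    matrices, which is the identity by \<open>inv'\<close>.\<close>
  also have "\<dots> = a * (p' * p + q' * r) + b * (p' * q + q' * s) + c * (r' * p + s' * r) + d * (r' * q + s' * s)"
    by (simp add: algebra_simps)
  finally show ?thesis unfolding inv' by simp
qed

text \<open>A kernel vector makes the images of the two basis vectors proportional, whichever basis
  was chosen, so the 2x2 determinant vanishes.\<close>

lemma det_on_plane_eq_0:
  fixes X Y :: "'a::euclidean_space"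
  assumes ind: "independent {X, Y}" "X \<noteq> Y" and T: "T = span {X, Y}" and L: "linear L"
    and w: "w \<in> T" "w \<noteq> 0" "L w = 0"
  shows "det_on T L = 0"
proof -
  interpret linear L by fact
  obtain b1 b2 where B: "some_basis T = {b1, b2}" "b1 \<noteq> b2" "independent {b1, b2}" "span {b1, b2} = T"
    using some_basis_plane[OF ind T] .
  let ?R = "\<lambda>i j. representation {b1, b2} (L i) j"
  have f: "finite {b2}" "b1 \<notin> {b2}" using B(2) by auto
  have D: "det_on T L = ?R b1 b1 * ?R b2 b2 - ?R b1 b2 * ?R b2 b1"
    unfolding det_on_def B(1) sum_over_permutations_insert[OF f] permutes_sing
    using B(2) by (simp add: sign_swap_id sign_id)
  obtain x y where xy: "w = x *\<^sub>R b1 + y *\<^sub>R b2"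
    using w(1) unfolding B(4)[symmetric] mem_span_pair by blast
  have 0: "x *\<^sub>R L b1 + y *\<^sub>R L b2 = 0" using w(3) by (simp add: xy add scale)
  \<comment> \<open>The images under \<open>L\<close> may leave the plane.
    \<open>representation\<close> is 0 off the span, and this default value scales as well.\<close>
  have rs: "representation {b1, b2} (c *\<^sub>R v) = (\<lambda>b. c * representation {b1, b2} v b)" for c v
  proof (cases "v \<in> span {b1, b2} \<or> c = 0")
    case True
    then show ?thesis using representation_scale[OF B(3), of v c] representation_zero by auto
  next
    case False
    then have "c *\<^sub>R v \<notin> span {b1, b2}" by (metis span_scale scaleR_scaleR left_inverse scaleR_one)
    then show ?thesis using False by (simp add: representation_def)
  qed
  consider "x \<noteq> 0" | "y \<noteq> 0" using w(2) xy by fastforce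
  then show ?thesis
  proof cases
    case 1
    have "x *\<^sub>R L b1 = (- y) *\<^sub>R L b2" using 0 by (simp add: eq_neg_iff_add_eq_0)
    then have "L b1 = (- y / x) *\<^sub>R L b2"
      using 1 by (metis divideR_right scaleR_scaleR divide_inverse mult.commute)
    then have "?R b1 = (\<lambda>b. (- y / x) * ?R b2 b)" by (simp only: rs)
    then show ?thesis unfolding D by simp
  next
    case 2
    have "y *\<^sub>R L b2 = (- x) *\<^sub>R L b1" using 0 by (simp add: eq_neg_iff_add_eq_0 add.commute)
    then have "L b2 = (- x / y) *\<^sub>R L b1"
      using 2 by (metis divideR_right scaleR_scaleR divide_inverse mult.commute)
    then have "?R b2 = (\<lambda>b. (- x / y) * ?R b1 b)" by (simp only: rs)
    then show ?thesis unfolding D by simp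
  qed
qed

section \<open>Charts, their inverses, and derivatives within the surface\<close>

lemma vec2_eq: "(v::real^2) = (v $ 1) *\<^sub>R axis 1 1 + (v $ 2) *\<^sub>R axis 2 1"
  by (simp add: vec_eq_iff forall_2 axis_def)

lemma local_paramD:
  assumes "local_param M U \<phi>"
  shows "open U" "smooth_on U \<phi>" "\<And>u. u \<in> U \<Longrightarrow> inj (fder \<phi> u)" "openin (top_of_set M) (\<phi> ` U)"
    "homeomorphism U (\<phi> ` U) \<phi> (inv_into U \<phi>)" "inj_on \<phi> U" "\<phi> ` U \<subseteq> M"
proof -
  obtain \<psi> where h: "homeomorphism U (\<phi> ` U) \<phi> \<psi>" using assms by (auto simp: local_param_def)
  show inj: "inj_on \<phi> U" by (rule inj_on_inverseI[of U \<psi>]) (rule homeomorphism_apply1[OF h])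
  have "inv_into U \<phi> y = \<psi> y" if "y \<in> \<phi> ` U" for y
    using that inj by (auto simp: homeomorphism_apply1[OF h])
  then show "homeomorphism U (\<phi> ` U) \<phi> (inv_into U \<phi>)"
    by (intro homeomorphism_cong[OF h]) simp_all
  show "openin (top_of_set M) (\<phi> ` U)" using assms by (auto simp: local_param_def)
  then show "\<phi> ` U \<subseteq> M" by (rule openin_imp_subset)
qed (use assms in \<open>auto simp: local_param_def\<close>)

lemma local_param_deriv:
  assumes "local_param M U \<phi>" "u \<in> U"
  shows "(\<phi> has_derivative fder \<phi> u) (at u)" "linear (fder \<phi> u)"
    "independent {fder \<phi> u (axis 1 1), fder \<phi> u (axis 2 1)}"
    "fder \<phi> u (axis 1 1) \<noteq> fder \<phi> u (axis 2 1)"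
    "range (fder \<phi> u) = span {fder \<phi> u (axis 1 1), fder \<phi> u (axis 2 1)}"
proof -
  show d: "(\<phi> has_derivative fder \<phi> u) (at u)"
    using local_paramD(2)[OF assms(1)] assms(2) by (rule smooth_on_has_derivative)
  show l: "linear (fder \<phi> u)" using d by (rule has_derivative_linear)
  have i: "inj (fder \<phi> u)" using local_paramD(3)[OF assms] .
  have ne: "axis 1 1 \<noteq> (axis 2 1 :: real^2)" by (simp add: axis_eq_axis)
  have "independent {axis 1 1, axis 2 1 :: real^2}"
    by (rule independent_mono[OF independent_Basis]) (auto simp: Basis_vec_def)
  from linear_independent_injective_image[OF l this inj_on_subset[OF i subset_UNIV]]
  show "independent {fder \<phi> u (axis 1 1), fder \<phi> u (axis 2 1)}" by simp
  show "fder \<phi> u (axis 1 1) \<noteq> fder \<phi> u (axis 2 1)" using i ne by (metis injD)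
  have "span {axis 1 1, axis 2 1 :: real^2} = UNIV"
  proof -
    have "v \<in> span {axis 1 1, axis 2 1}" for v :: "real^2"
      unfolding mem_span_pair using vec2_eq[of v] by blast
    then show ?thesis by blast
  qed
  then show "range (fder \<phi> u) = span {fder \<phi> u (axis 1 1), fder \<phi> u (axis 2 1)}"
    using linear_span_image[OF l, of "{axis 1 1, axis 2 1}"] by simp
qed

text \<open>Points of \<open>M\<close> near \<open>\<phi> u\<close> differ from
  \<open>\<phi> u\<close> by a tangent vector up to a small error, and \<open>P\<close> is
  prescribed on tangent vectors. Hence any left inverse is a derivative within \<open>M\<close>,
  whatever its values off the tangent plane. The homeomorphism property brings the parameter of a
  nearby point close to \<open>u\<close>.\<close>

lemma inv_into_has_derivative:
  assumes lp: "local_param M U \<phi>" and u: "u \<in> U" and P: "bounded_linear P" "\<And>v. P (fder \<phi> u v) = v"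
  shows "(inv_into U \<phi> has_derivative P) (at (\<phi> u) within M)"
  unfolding has_derivative_within_alt
proof (intro conjI allI impI)
  let ?\<psi> = "inv_into U \<phi>" and ?p = "\<phi> u" and ?D = "fder \<phi> u"
  note hom = local_paramD(5)[OF lp]
  interpret P: bounded_linear P by fact
  obtain B where B: "B > 0" "\<And>w. norm (P w) \<le> B * norm w"
    using P.pos_bounded by (auto simp: mult.commute)
  show "bounded_linear P" by fact
  fix e :: real assume "e > 0"
  \<comment> \<open>The first bound lets half of \<open>norm (v - u)\<close> be absorbed, which
    gives \<open>norm (v - u) \<le> 2 * B * norm (y - ?p)\<close>. With this, the second bound turns
    the remaining error into \<open>e * norm (y - ?p)\<close>.\<close>
  define e1 where "e1 = min (1 / (2 * B)) (e / (2 * B * B))"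
  have e1: "e1 > 0" "B * e1 \<le> 1/2" "B * e1 * (2 * B) \<le> e"
    using B \<open>e > 0\<close> by (auto simp: e1_def min_def field_simps)
  obtain d1 where d1: "d1 > 0" "\<And>v. norm (v - u) < d1 \<Longrightarrow> norm (\<phi> v - \<phi> u - ?D (v - u)) \<le> e1 * norm (v - u)"
    using local_param_deriv(1)[OF lp u] e1(1) unfolding has_derivative_at_alt by blast
  have "continuous_on (\<phi> ` U) ?\<psi>" using hom by (simp add: homeomorphism_def)
  moreover have "open (ball u d1)" by simp
  ultimately have "openin (top_of_set (\<phi> ` U)) (\<phi> ` U \<inter> ?\<psi> -` ball u d1)"
    by (rule continuous_openin_preimage_gen)
  then have "openin (top_of_set M) (\<phi> ` U \<inter> ?\<psi> -` ball u d1)"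
    using local_paramD(4)[OF lp] openin_trans by blast
  moreover have "?p \<in> \<phi> ` U \<inter> ?\<psi> -` ball u d1"
    using u d1 local_paramD(6)[OF lp] by simp
  ultimately obtain d where d: "d > 0" "ball ?p d \<inter> M \<subseteq> \<phi> ` U \<inter> ?\<psi> -` ball u d1"
    unfolding openin_contains_ball by blast
  show "\<exists>d>0. \<forall>y\<in>M. norm (y - ?p) < d \<longrightarrow> norm (?\<psi> y - ?\<psi> ?p - P (y - ?p)) \<le> e * norm (y - ?p)"
  proof (intro exI[of _ d] conjI ballI impI d(1))
    fix y assume "y \<in> M" "norm (y - ?p) < d"
    then have "y \<in> ball ?p d \<inter> M" by (simp add: dist_norm norm_minus_commute)
    then have y: "y \<in> \<phi> ` U" "?\<psi> y \<in> ball u d1" using d(2) by auto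
    define v where "v = ?\<psi> y"
    have yv: "y = \<phi> v" using y(1) unfolding v_def by (simp add: f_inv_into_f)
    have "norm (v - u) < d1" using y(2) by (simp add: v_def dist_norm norm_minus_commute)
    from d1(2)[OF this] have r: "norm (y - ?p - ?D (v - u)) \<le> e1 * norm (v - u)" by (simp add: yv)
    have "v - u - P (y - ?p) = - P (y - ?p - ?D (v - u))"
      by (simp add: P.diff P(2))
    then have "norm (v - u - P (y - ?p)) \<le> B * norm (y - ?p - ?D (v - u))"
      using B(2) by (simp only: norm_minus_cancel)
    also have "\<dots> \<le> B * (e1 * norm (v - u))" using r B(1) by (intro mult_left_mono) auto
    finally have 1: "norm (v - u - P (y - ?p)) \<le> B * e1 * norm (v - u)" by (simp add: mult.assoc)
    also have "\<dots> \<le> 1/2 * norm (v - u)" using e1(2) by (intro mult_right_mono) auto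
    finally have "norm (v - u) \<le> norm (P (y - ?p)) + 1/2 * norm (v - u)"
      using norm_triangle_sub[of "v - u" "P (y - ?p)"] by linarith
    then have "norm (v - u) \<le> 2 * B * norm (y - ?p)" using B(2)[of "y - ?p"] by linarith
    then have "B * e1 * norm (v - u) \<le> B * e1 * (2 * B * norm (y - ?p))"
      using B(1) e1(1) by (intro mult_left_mono) auto
    also have "\<dots> = (B * e1 * (2 * B)) * norm (y - ?p)" by simp
    also have "\<dots> \<le> e * norm (y - ?p)" using e1(3) by (intro mult_right_mono) auto
    finally have "norm (v - u - P (y - ?p)) \<le> e * norm (y - ?p)" using 1 by linarith
    then show "norm (?\<psi> y - ?\<psi> ?p - P (y - ?p)) \<le> e * norm (y - ?p)"
      using u local_paramD(6)[OF lp] by (simp add: v_def)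
  qed
qed

lemma local_param_left_inverse:
  assumes "local_param M U \<phi>" "u \<in> U"
  obtains P where "bounded_linear P" "\<And>v. P (fder \<phi> u v) = v"
proof -
  obtain P where "linear P" "P \<circ> fder \<phi> u = id"
    using linear_injective_left_inverse[OF local_param_deriv(2)[OF assms] local_paramD(3)[OF assms]] by blast
  then show thesis using that[of P] linear_conv_bounded_linear by (metis comp_apply id_apply)
qed

lemma openin_contains_ball_dist:
  assumes "openin (top_of_set M) V" "p \<in> V"
  obtains d where "d > 0" "\<And>y. y \<in> M \<Longrightarrow> dist y p < d \<Longrightarrow> y \<in> V"
  using assms unfolding openin_contains_ball by (force simp: dist_commute)

text \<open>\<open>surface_differential\<close> is a choice among the derivatives within
  \<open>M\<close>. One exists because near \<open>\<phi> u\<close> the map \<open>f\<close> is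
  \<open>f \<circ> \<phi>\<close> after the inverse chart, so the chosen map is a derivative
  too.\<close>

lemma smooth_on_surface_differentiable:
  assumes lp: "local_param M U \<phi>" and f: "smooth_on_surface M f" and u: "u \<in> U"
  shows "(f has_derivative surface_differential M f (\<phi> u)) (at (\<phi> u) within M)"
proof -
  let ?\<psi> = "inv_into U \<phi>"
  obtain P where P: "bounded_linear P" "\<And>v. P (fder \<phi> u v) = v"
    using local_param_left_inverse[OF lp u] by blast
  have s: "smooth_on U (f \<circ> \<phi>)" using f lp by (simp add: smooth_on_surface_def)
  have "?\<psi> (\<phi> u) = u" using local_paramD(6)[OF lp] u by simp
  then have "((f \<circ> \<phi>) has_derivative fder (f \<circ> \<phi>) u) (at (?\<psi> (\<phi> u)))"
    using smooth_on_has_derivative[OF s u] by simp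
  from has_derivative_compose[OF inv_into_has_derivative[OF lp u P] this]
  have d: "((\<lambda>x. (f \<circ> \<phi>) (?\<psi> x)) has_derivative (\<lambda>x. fder (f \<circ> \<phi>) u (P x))) (at (\<phi> u) within M)" .
  obtain d where d': "d > 0" "\<And>y. y \<in> M \<Longrightarrow> dist y (\<phi> u) < d \<Longrightarrow> y \<in> \<phi> ` U"
    using openin_contains_ball_dist[OF local_paramD(4)[OF lp], of "\<phi> u"] u by blast
  have "\<phi> u \<in> M" using local_paramD(7)[OF lp] u by blast
  from has_derivative_transform_within[OF d d'(1) this, of f]
  have "(f has_derivative (\<lambda>x. fder (f \<circ> \<phi>) u (P x))) (at (\<phi> u) within M)"
    using d'(2) by (simp add: f_inv_into_f)
  then show ?thesis unfolding surface_differential_def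
    using frechet_derivative_works by (metis differentiable_def)
qed

lemma surface_differential_linear:
  assumes "local_param M U \<phi>" "smooth_on_surface M f" "u \<in> U"
  shows "linear (surface_differential M f (\<phi> u))"
  using smooth_on_surface_differentiable[OF assms] by (rule has_derivative_linear)

text \<open>Composed with \<open>\<phi>\<close>, any derivative within \<open>M\<close> gives a
  derivative on an open set of the plane, where it is unique. The arbitrary choice is therefore
  invisible on tangent vectors.\<close>

lemma surface_differential_chart:
  assumes lp: "local_param M U \<phi>" and f: "smooth_on_surface M f" and u: "u \<in> U"
  shows "surface_differential M f (\<phi> u) (fder \<phi> u v) = fder (f \<circ> \<phi>) u v"
proof -
  have "(\<phi> has_derivative fder \<phi> u) (at u within U)"
    using local_param_deriv(1)[OF lp u] by (rule has_derivative_at_withinI)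
  moreover have "(f has_derivative surface_differential M f (\<phi> u)) (at (\<phi> u) within \<phi> ` U)"
    using smooth_on_surface_differentiable[OF assms] local_paramD(7)[OF lp] by (rule has_derivative_subset)
  ultimately have "((f \<circ> \<phi>) has_derivative (surface_differential M f (\<phi> u) \<circ> fder \<phi> u)) (at u within U)"
    by (rule diff_chain_within)
  then have "((f \<circ> \<phi>) has_derivative (surface_differential M f (\<phi> u) \<circ> fder \<phi> u)) (at u)"
    using at_within_open[OF u local_paramD(1)[OF lp]] by simp
  from frechet_derivative_at[OF this] show ?thesis by (metis comp_apply)
qed

lemma line_in_open:
  fixes u :: "'a::real_normed_vector"
  assumes "open U" "u \<in> U"
  obtains e where "e > 0" "\<And>s. \<bar>s\<bar> < e \<Longrightarrow> u + s *\<^sub>R w \<in> U"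
proof -
  obtain d where d: "d > 0" "ball u d \<subseteq> U" using assms openE by blast
  have "u + s *\<^sub>R w \<in> U" if "\<bar>s\<bar> < d / (norm w + 1)" for s
  proof -
    have "\<bar>s\<bar> * norm w \<le> \<bar>s\<bar> * (norm w + 1)" by (intro mult_left_mono) auto
    also have "\<dots> < d" using that by (simp add: pos_less_divide_eq add_nonneg_pos)
    finally show ?thesis using d(2) by (auto simp: dist_norm)
  qed
  moreover have "d / (norm w + 1) > 0" using d by (simp add: add_nonneg_pos)
  ultimately show thesis using that by blast
qed

text \<open>A curve in \<open>M\<close> through \<open>\<phi> u\<close> is, for small times,
  \<open>\<phi>\<close> of its pullback by the inverse chart, which is differentiable at 0.
  Conversely, images of straight lines realise every vector of the range.\<close>

lemma tangent_space_chart: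
  assumes lp: "local_param M U \<phi>" and u: "u \<in> U"
  shows "tangent_space M (\<phi> u) = range (fder \<phi> u)"
proof (intro equalityI subsetI)
  fix v assume "v \<in> tangent_space M (\<phi> u)"
  then obtain \<gamma> :: "real \<Rightarrow> real^3" and e where \<gamma>: "e > 0" "\<gamma> ` {-e<..<e} \<subseteq> M" "\<gamma> 0 = \<phi> u" "(\<gamma> has_vector_derivative v) (at (0::real))"
    unfolding tangent_space_def by blast
  let ?\<psi> = "inv_into U \<phi>"
  obtain P where P: "bounded_linear P" "\<And>v. P (fder \<phi> u v) = v"
    using local_param_left_inverse[OF lp u] by blast
  have at: "at 0 within {-e<..<e} = at (0::real)" using \<gamma>(1) by (intro at_within_open) auto
  have g: "(\<gamma> has_derivative (\<lambda>s. s *\<^sub>R v)) (at 0 within {-e<..<e})"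
    using \<gamma>(4) unfolding has_vector_derivative_def by (rule has_derivative_at_withinI)
  moreover have "(?\<psi> has_derivative P) (at (\<gamma> 0) within \<gamma> ` {-e<..<e})"
    using has_derivative_subset[OF inv_into_has_derivative[OF lp u P] \<gamma>(2)] \<gamma>(3) by simp
  ultimately have "((?\<psi> \<circ> \<gamma>) has_derivative (P \<circ> (\<lambda>s. s *\<^sub>R v))) (at 0 within {-e<..<e})"
    by (rule diff_chain_within)
  then have d: "((?\<psi> \<circ> \<gamma>) has_derivative (P \<circ> (\<lambda>s. s *\<^sub>R v))) (at 0)" using at by simp
  have "(?\<psi> \<circ> \<gamma>) 0 = u" using \<gamma>(3) local_paramD(6)[OF lp] u by simp
  then have "(\<phi> has_derivative fder \<phi> u) (at ((?\<psi> \<circ> \<gamma>) 0))"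
    using local_param_deriv(1)[OF lp u] by simp
  from has_derivative_compose[OF d this]
  have d2: "((\<lambda>s. \<phi> ((?\<psi> \<circ> \<gamma>) s)) has_derivative (\<lambda>s. fder \<phi> u ((P \<circ> (\<lambda>s. s *\<^sub>R v)) s))) (at 0)" .
  obtain d where d': "d > 0" "\<And>y. y \<in> M \<Longrightarrow> dist y (\<phi> u) < d \<Longrightarrow> y \<in> \<phi> ` U"
    using openin_contains_ball_dist[OF local_paramD(4)[OF lp], of "\<phi> u"] u by blast
  have "continuous (at 0) \<gamma>"
    using \<gamma>(4) by (rule has_vector_derivative_continuous)
  then obtain d3 where d3: "d3 > 0" "\<And>s::real. dist s 0 < d3 \<Longrightarrow> dist (\<gamma> s) (\<gamma> 0) < d"
    using d'(1) unfolding continuous_at_eps_delta by metis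
  have "(\<gamma> has_derivative (\<lambda>s. fder \<phi> u ((P \<circ> (\<lambda>s. s *\<^sub>R v)) s))) (at 0)"
  proof (rule has_derivative_transform_within[OF d2, of "min d3 e"])
    fix s :: real assume "dist s 0 < min d3 e"
    then have "s \<in> {-e<..<e}" "dist s 0 < d3" by (auto simp: dist_real_def)
    then have "\<gamma> s \<in> M" "dist (\<gamma> s) (\<phi> u) < d" using \<gamma>(2,3) d3(2)[of s] by (blast, simp)
    then have "\<gamma> s \<in> \<phi> ` U" using d'(2) by blast
    then show "\<phi> ((?\<psi> \<circ> \<gamma>) s) = \<gamma> s" by (simp add: f_inv_into_f)
  qed (use d3 \<gamma>(1) in auto)
  with \<gamma>(4)[unfolded has_vector_derivative_def]
  have "(\<lambda>s. s *\<^sub>R v) = (\<lambda>s. fder \<phi> u ((P \<circ> (\<lambda>s. s *\<^sub>R v)) s))" by (rule has_derivative_unique)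
  from fun_cong[OF this, of 1] show "v \<in> range (fder \<phi> u)" by simp
next
  fix v assume "v \<in> range (fder \<phi> u)"
  then obtain w where w: "v = fder \<phi> u w" by blast
  obtain e where e: "e > 0" "\<And>s. \<bar>s\<bar> < e \<Longrightarrow> u + s *\<^sub>R w \<in> U"
    using line_in_open[OF local_paramD(1)[OF lp] u] by blast
  let ?\<gamma> = "\<lambda>s. \<phi> (u + s *\<^sub>R w)"
  have o: "open {-e<..<e}" by simp
  have in': "(\<lambda>s. u + s *\<^sub>R w) ` {-e<..<e} \<subseteq> U" using e(2) by auto
  have "smooth_on {-e<..<e} (\<lambda>s. u + s *\<^sub>R w)"
    by (intro smooth_on_add[OF o] smooth_on_const[OF o] smooth_on_bounded_linear[OF o] bounded_linear_scaleR_left)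
  from smooth_on_compose[OF o local_paramD(1)[OF lp] in' this local_paramD(2)[OF lp]]
  have "smooth_on {-e<..<e} ?\<gamma>" .
  moreover have "?\<gamma> ` {-e<..<e} \<subseteq> M" using in' local_paramD(7)[OF lp] by auto
  moreover have "(?\<gamma> has_vector_derivative v) (at 0)"
  proof -
    have 1: "((\<lambda>s. u + s *\<^sub>R w) has_derivative (\<lambda>s. s *\<^sub>R w)) (at 0)"
      by (auto intro!: derivative_eq_intros)
    have "(\<phi> has_derivative fder \<phi> u) (at (u + 0 *\<^sub>R w))"
      using local_param_deriv(1)[OF lp u] by simp
    from has_derivative_compose[OF 1 this] show ?thesis
      unfolding has_vector_derivative_def w by (simp add: linear_scale[OF local_param_deriv(2)[OF lp u]])
  qed
  ultimately show "v \<in> tangent_space M (\<phi> u)"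
    unfolding tangent_space_def using e(1) by (auto intro!: exI[of _ ?\<gamma>] exI[of _ e])
qed

lemma local_param_subset:
  assumes lp: "local_param M U \<phi>" and V: "open V" "V \<subseteq> U"
  shows "local_param M V \<phi>"
  unfolding local_param_def
proof (intro conjI ballI)
  note hom = local_paramD(5)[OF lp]
  show "smooth_on V \<phi>" using local_paramD(2)[OF lp] V(2) by (rule smooth_on_subset)
  show "inj (fder \<phi> u)" if "u \<in> V" for u using local_paramD(3)[OF lp] that V(2) by blast
  have "openin (top_of_set (\<phi> ` U)) (\<phi> ` V)"
    using homeomorphism_imp_open_map[OF hom, of V] V by (simp add: open_openin_trans open_subset)
  then show "openin (top_of_set M) (\<phi> ` V)" using local_paramD(4)[OF lp] openin_trans by blast
  show "\<exists>\<psi>. homeomorphism V (\<phi> ` V) \<phi> \<psi>"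
    using homeomorphism_of_subsets[OF hom V(2)] V(2) by blast
qed fact

text \<open>The transition between two charts is differentiable, and a differentiable map between
  spaces of equal dimension preserves null sets. This moves the exceptional sets of the equality
  case from the pieces of a dissection into a given chart.\<close>

lemma transition_negligible:
  assumes lp: "local_param M U \<phi>" "local_param M V \<theta>" and Z: "Z \<subseteq> V" "negligible Z"
  shows "negligible {u \<in> U. \<phi> u \<in> \<theta> ` Z}"
proof -
  let ?\<psi> = "inv_into U \<phi>"
  let ?Z = "{z \<in> Z. \<theta> z \<in> \<phi> ` U}"
  have "(?\<psi> \<circ> \<theta>) differentiable_on ?Z"
    unfolding differentiable_on_def
  proof
    fix z assume z: "z \<in> ?Z"
    then obtain u where u: "u \<in> U" "\<theta> z = \<phi> u" by blast
    obtain P where P: "bounded_linear P" "\<And>v. P (fder \<phi> u v) = v"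
      using local_param_left_inverse[OF lp(1) u(1)] by blast
    have zV: "z \<in> V" using z Z(1) by blast
    have "(\<theta> has_derivative fder \<theta> z) (at z within ?Z)"
      using local_param_deriv(1)[OF lp(2) zV] by (rule has_derivative_at_withinI)
    moreover have "(?\<psi> has_derivative P) (at (\<theta> z) within \<theta> ` ?Z)"
    proof -
      have "\<theta> ` ?Z \<subseteq> M" using local_paramD(7)[OF lp(2)] Z(1) by blast
      with inv_into_has_derivative[OF lp(1) u(1) P] show ?thesis
        unfolding u(2) by (rule has_derivative_subset)
    qed
    ultimately show "(?\<psi> \<circ> \<theta>) differentiable at z within ?Z"
      unfolding differentiable_def by (blast intro: diff_chain_within)
  qed
  moreover have "negligible ?Z" by (rule negligible_subset[OF Z(2)]) blast
  ultimately have "negligible ((?\<psi> \<circ> \<theta>) ` ?Z)"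
    by (intro negligible_differentiable_image_negligible) auto
  moreover have "{u \<in> U. \<phi> u \<in> \<theta> ` Z} \<subseteq> (?\<psi> \<circ> \<theta>) ` ?Z"
  proof
    fix u assume "u \<in> {u \<in> U. \<phi> u \<in> \<theta> ` Z}"
    then obtain z where "u \<in> U" "z \<in> Z" "\<phi> u = \<theta> z" by blast
    moreover from this have "?\<psi> (\<theta> z) = u" using local_paramD(6)[OF lp(1)] by (metis inv_into_f_f)
    moreover have "\<theta> z \<in> \<phi> ` U" using \<open>u \<in> U\<close> \<open>\<phi> u = \<theta> z\<close> by (rule rev_image_eqI[OF _ sym])
    ultimately show "u \<in> (?\<psi> \<circ> \<theta>) ` ?Z" by (intro image_eqI[of _ _ z]) simp_all
  qed
  ultimately show ?thesis by (rule negligible_subset)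
qed

section \<open>The gradient of a smooth strictly convex norm\<close>

lemma second_derivative_nonneg:
  fixes f :: "real \<Rightarrow> real"
  assumes e: "e > 0" and f: "\<And>s. \<bar>s\<bar> < e \<Longrightarrow> (f has_real_derivative f' s) (at s)"
    and f2: "(f' has_real_derivative f2) (at 0)" and min: "\<And>s. \<bar>s\<bar> < e \<Longrightarrow> f 0 \<le> f s" and z: "f' 0 = 0"
  shows "f2 \<ge> 0"
proof (rule ccontr)
  assume "\<not> f2 \<ge> 0"
  then obtain d where d: "d > 0" "\<And>h. h > 0 \<Longrightarrow> h < d \<Longrightarrow> f' h < 0"
    using DERIV_neg_dec_right[OF f2] z by auto
  define h where "h = min d e / 2"
  have h: "0 < h" "h < d" "h < e" using d e by (auto simp: h_def)
  have "(f has_real_derivative f' s) (at s)" if "0 \<le> s" "s \<le> h" for s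
    using that h by (intro f) auto
  from MVT2[OF h(1) this] obtain s where s: "0 < s" "s < h" "f h - f 0 = (h - 0) * f' s" by blast
  have "f h - f 0 < 0" using s d(2)[of s] h by (simp add: mult_pos_neg)
  then show False using min[of h] h by simp
qed

lemma plane_eq_orthogonal:
  fixes X Y a :: "real^3"
  assumes "independent {X, Y}" "X \<noteq> Y" "a \<noteq> 0" "a \<bullet> X = 0" "a \<bullet> Y = 0"
  shows "span {X, Y} = {w. a \<bullet> w = 0}"
proof (rule subspace_dim_equal)
  show "subspace {w. a \<bullet> w = 0}" by (rule subspace_hyperplane)
  then show "span {X, Y} \<subseteq> {w. a \<bullet> w = 0}" by (intro span_minimal) (use assms in auto)
  have "dim (span {X, Y}) = 2"
    using assms(1,2) dim_span_eq_card_independent[of "{X, Y}"] by simp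
  then show "dim {w. a \<bullet> w = 0} \<le> dim (span {X, Y})"
    using dim_hyperplane[OF assms(3)] by simp
qed auto

lemma tangent_space_orthogonal:
  assumes "local_param M U \<phi>" "u \<in> U" "a \<noteq> 0" "\<And>v. a \<bullet> fder \<phi> u v = 0"
  shows "tangent_space M (\<phi> u) = {w. a \<bullet> w = 0}"
  using plane_eq_orthogonal[OF local_param_deriv(3,4)[OF assms(1,2)] assms(3,4,4)]
    tangent_space_chart[OF assms(1,2)] local_param_deriv(5)[OF assms(1,2)] by simp

text \<open>On the unit sphere this is the Euclidean normal at \<open>y\<close>, scaled so that its
  product with \<open>y\<close> is 1. Composed with \<open>\<eta>\<close> it is a field of conormals
  of \<open>M\<close>.\<close>

definition ngrad :: "('a::euclidean_space \<Rightarrow> real) \<Rightarrow> 'a \<Rightarrow> 'a" where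
  "ngrad N y = (\<Sum>b\<in>Basis. fder N y b *\<^sub>R b)"

locale smooth_strict_norm =
  fixes N :: "'a::euclidean_space \<Rightarrow> real"
  assumes smooth: "smooth_norm N" and strict: "strictly_convex_norm N"
begin

abbreviation \<nu> where "\<nu> \<equiv> ngrad N"

lemma N_0: "N x = 0 \<longleftrightarrow> x = 0" and N_scale: "N (c *\<^sub>R x) = \<bar>c\<bar> * N x"
  and N_triangle: "N (x + y) \<le> N x + N y"
  using smooth by (auto simp: smooth_norm_def is_norm_def)

lemma N_minus: "N (- x) = N x"
  using N_scale[of "-1" x] by simp

lemma N_nonneg: "N x \<ge> 0"
  using N_triangle[of x "- x"] N_0[of 0] N_minus[of x] by simp

lemma N_pos: "x \<noteq> 0 \<Longrightarrow> N x > 0"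
  using N_nonneg[of x] N_0[of x] by simp

lemma N_1_nonzero: "N x = 1 \<Longrightarrow> x \<noteq> 0"
  using N_0[of x] by auto

lemma N_smooth: "smooth_on (- {0}) N"
  using smooth by (simp add: smooth_norm_def)

lemma open_nonzero: "open (- {0::'a})"
  by (rule open_Compl) simp

lemma fder_N: "y \<noteq> 0 \<Longrightarrow> fder N y v = \<nu> y \<bullet> v"
proof -
  assume "y \<noteq> 0"
  then have "linear (fder N y)"
    using smooth_on_has_derivative[OF N_smooth, of y] by (auto intro: has_derivative_linear)
  then have "fder N y (\<Sum>b\<in>Basis. (v \<bullet> b) *\<^sub>R b) = (\<Sum>b\<in>Basis. (v \<bullet> b) * fder N y b)"
    by (simp only: linear_sum linear_scale real_scaleR_def)
  then have "fder N y v = (\<Sum>b\<in>Basis. (v \<bullet> b) * fder N y b)"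
    by (simp only: euclidean_representation)
  then show ?thesis by (simp add: ngrad_def inner_sum_left inner_sum_right inner_commute mult.commute)
qed

lemma N_has_derivative: "y \<noteq> 0 \<Longrightarrow> (N has_derivative (\<lambda>v. \<nu> y \<bullet> v)) (at y)"
  by (rule has_derivative_eq_rhs[OF smooth_on_has_derivative[OF N_smooth, of y]]) (simp_all add: fder_N fun_eq_iff)

lemma N_curve_derivative:
  assumes "(g has_derivative g') F" "F = at x within S" "g x \<noteq> 0"
  shows "((\<lambda>s. N (g s)) has_derivative (\<lambda>s. \<nu> (g x) \<bullet> g' s)) F"
  using has_derivative_compose[OF assms(1)[unfolded assms(2)] N_has_derivative[OF assms(3)]] assms(2) by simp

lemma ngrad_smooth: "smooth_on (- {0}) \<nu>"
  unfolding ngrad_def[abs_def]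
  by (intro smooth_on_sum[OF open_nonzero] smooth_on_bilinear[OF open_nonzero bounded_bilinear_scaleR]
      smooth_on_frechet[OF N_smooth] smooth_on_const[OF open_nonzero])

lemma ngrad_derivative: "y \<noteq> 0 \<Longrightarrow> (\<nu> has_derivative fder \<nu> y) (at y)"
  using smooth_on_has_derivative[OF ngrad_smooth] by simp

lemma ngrad_linear: "y \<noteq> 0 \<Longrightarrow> linear (fder \<nu> y)"
  using ngrad_derivative has_derivative_linear by blast

lemma ngrad_symmetric:
  assumes "y \<noteq> 0" shows "fder \<nu> y v \<bullet> w = fder \<nu> y w \<bullet> v"
proof -
  have d: "fder (\<lambda>y. fder N y u) y v = fder \<nu> y v \<bullet> u" for u v
  proof -
    have "((\<lambda>y. \<nu> y \<bullet> u) has_derivative (\<lambda>v. fder \<nu> y v \<bullet> u)) (at y)"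
      by (rule bounded_linear.has_derivative[OF bounded_linear_inner_left ngrad_derivative[OF assms]])
    then have "((\<lambda>y. fder N y u) has_derivative (\<lambda>v. fder \<nu> y v \<bullet> u)) (at y)"
      by (rule has_derivative_transform_within_open[OF _ open_nonzero]) (use assms in \<open>auto simp: fder_N\<close>)
    from frechet_derivative_at[OF this, symmetric] show ?thesis by simp
  qed
  have "Ck_on 2 (- {0}) N" using N_smooth by (simp add: smooth_on_def)
  from frechet_derivative_swap_real[OF open_nonzero this, of y w v] assms
  show ?thesis by (simp add: d)
qed

text \<open>Euler's relation for the homogeneous function \<open>N\<close>. The degrees 1, 0 and -1
  of \<open>N\<close>, its gradient and its Hessian give this lemma and the next three.\<close>

lemma ngrad_self: assumes "y \<noteq> 0" shows "\<nu> y \<bullet> y = N y"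
proof -
  have g: "((\<lambda>s::real. s *\<^sub>R y) has_derivative (\<lambda>s. s *\<^sub>R y)) (at 1)" by (auto intro!: derivative_eq_intros)
  have 1: "((\<lambda>s::real. N (s *\<^sub>R y)) has_derivative (\<lambda>s. \<nu> (1 *\<^sub>R y) \<bullet> (s *\<^sub>R y))) (at 1)"
    by (rule N_curve_derivative[OF g]) (use assms in auto)
  have "((\<lambda>s::real. s * N y) has_derivative (\<lambda>s. s * N y)) (at 1)" by (auto intro!: derivative_eq_intros)
  then have 2: "((\<lambda>s::real. N (s *\<^sub>R y)) has_derivative (\<lambda>s. s * N y)) (at 1)"
    by (rule has_derivative_transform_within_open[OF _ open_greaterThan[of 0]]) (auto simp: N_scale)
  from fun_cong[OF has_derivative_unique[OF 1 2], of 1] show ?thesis by simp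
qed

lemma ngrad_scale: assumes "c > 0" "y \<noteq> 0" shows "\<nu> (c *\<^sub>R y) = \<nu> y"
proof -
  have g: "((\<lambda>y. c *\<^sub>R y) has_derivative (\<lambda>v. c *\<^sub>R v)) (at y)" by (auto intro!: derivative_eq_intros)
  have 1: "((\<lambda>y. N (c *\<^sub>R y)) has_derivative (\<lambda>v. \<nu> (c *\<^sub>R y) \<bullet> (c *\<^sub>R v))) (at y)"
    by (rule N_curve_derivative[OF g]) (use assms in auto)
  have 2: "((\<lambda>y. N (c *\<^sub>R y)) has_derivative (\<lambda>v. c * (\<nu> y \<bullet> v))) (at y)"
    using has_derivative_mult_right[OF N_has_derivative[OF assms(2)], of c] assms(1) by (simp add: N_scale)
  have "\<nu> (c *\<^sub>R y) \<bullet> v = \<nu> y \<bullet> v" for v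
    using fun_cong[OF has_derivative_unique[OF 1 2], of v] assms(1) by simp
  then show ?thesis by (metis vector_eq_rdot)
qed

lemma ngrad_deriv_scale: assumes "c > 0" "y \<noteq> 0" shows "fder \<nu> (c *\<^sub>R y) v = (1 / c) *\<^sub>R fder \<nu> y v"
proof -
  have g: "((\<lambda>y. c *\<^sub>R y) has_derivative (\<lambda>v. c *\<^sub>R v)) (at y)" by (auto intro!: derivative_eq_intros)
  have "c *\<^sub>R y \<noteq> 0" using assms by simp
  from has_derivative_compose[OF g ngrad_derivative[OF this]]
  have 1: "((\<lambda>y. \<nu> (c *\<^sub>R y)) has_derivative (\<lambda>v. fder \<nu> (c *\<^sub>R y) (c *\<^sub>R v))) (at y)" .
  have "((\<lambda>y. \<nu> (c *\<^sub>R y)) has_derivative fder \<nu> y) (at y)"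
    by (rule has_derivative_transform_within_open[OF ngrad_derivative[OF assms(2)] open_nonzero])
      (use assms in \<open>auto simp: ngrad_scale\<close>)
  from fun_cong[OF has_derivative_unique[OF 1 this], of v]
  have "c *\<^sub>R fder \<nu> (c *\<^sub>R y) v = fder \<nu> y v"
    by (simp add: linear_scale[OF ngrad_linear[OF \<open>c *\<^sub>R y \<noteq> 0\<close>]])
  then have "(1 / c) *\<^sub>R (c *\<^sub>R fder \<nu> (c *\<^sub>R y) v) = (1 / c) *\<^sub>R fder \<nu> y v" by (rule arg_cong)
  then show ?thesis using assms(1) by simp
qed

lemma ngrad_deriv_self: assumes "y \<noteq> 0" shows "fder \<nu> y y = 0"
proof -
  have g: "((\<lambda>s::real. s *\<^sub>R y) has_derivative (\<lambda>s. s *\<^sub>R y)) (at 1)" by (auto intro!: derivative_eq_intros)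
  have "(\<nu> has_derivative fder \<nu> y) (at (1 *\<^sub>R y))" using ngrad_derivative[OF assms] by simp
  from has_derivative_compose[OF g this]
  have 1: "((\<lambda>s::real. \<nu> (s *\<^sub>R y)) has_derivative (\<lambda>s. fder \<nu> y (s *\<^sub>R y))) (at 1)" .
  have "((\<lambda>s::real. \<nu> y) has_derivative (\<lambda>s. 0)) (at 1)" by auto
  then have 2: "((\<lambda>s::real. \<nu> (s *\<^sub>R y)) has_derivative (\<lambda>s. 0)) (at 1)"
    by (rule has_derivative_transform_within_open[OF _ open_greaterThan[of 0]]) (use assms in \<open>auto simp: ngrad_scale\<close>)
  from fun_cong[OF has_derivative_unique[OF 1 2], of 1] show ?thesis by simp
qed

text \<open>A convex function lies above its tangent, and by Euler's relation the tangent of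
  \<open>N\<close> at \<open>y\<close> is a linear functional. So \<open>\<nu> y\<close> supports
  the ball at \<open>y\<close>.\<close>

lemma ngrad_le: assumes "y \<noteq> 0" shows "\<nu> y \<bullet> v \<le> N v"
proof -
  let ?f = "\<lambda>s::real. N (y + s *\<^sub>R (v - y))"
  have "convex_on UNIV ?f"
  proof (rule convex_onI)
    fix t x z :: real assume t: "0 < t" "t < 1"
    have "y + ((1 - t) *\<^sub>R x + t *\<^sub>R z) *\<^sub>R (v - y) = (1 - t) *\<^sub>R (y + x *\<^sub>R (v - y)) + t *\<^sub>R (y + z *\<^sub>R (v - y))"
      by (simp add: algebra_simps)
    then have "?f ((1 - t) *\<^sub>R x + t *\<^sub>R z) \<le> N ((1 - t) *\<^sub>R (y + x *\<^sub>R (v - y))) + N (t *\<^sub>R (y + z *\<^sub>R (v - y)))"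
      using N_triangle by simp
    then show "?f ((1 - t) *\<^sub>R x + t *\<^sub>R z) \<le> (1 - t) * ?f x + t * ?f z"
      using t by (simp add: N_scale)
  qed auto
  moreover have "(?f has_real_derivative \<nu> y \<bullet> (v - y)) (at 0)"
  proof -
    have g: "((\<lambda>s::real. y + s *\<^sub>R (v - y)) has_derivative (\<lambda>s. s *\<^sub>R (v - y))) (at 0)"
      by (auto intro!: derivative_eq_intros)
    have "(?f has_derivative (\<lambda>s. \<nu> (y + 0 *\<^sub>R (v - y)) \<bullet> (s *\<^sub>R (v - y)))) (at 0)"
      by (rule N_curve_derivative[OF g]) (use assms in auto)
    then show ?thesis unfolding has_field_derivative_def
      by (rule has_derivative_eq_rhs) (simp add: fun_eq_iff)
  qed
  ultimately have "?f 1 - ?f 0 \<ge> (\<nu> y \<bullet> (v - y)) * (1 - 0)"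
    by (intro convex_on_imp_above_tangent[of UNIV ?f]) auto
  then show ?thesis using ngrad_self[OF assms] by (simp add: inner_diff_right)
qed

lemma ngrad_nonzero: "y \<noteq> 0 \<Longrightarrow> \<nu> y \<noteq> 0"
  using ngrad_self[of y] N_pos[of y] by auto

text \<open>Here strict convexity enters: the midpoint of distinct \<open>y\<close> and
  \<open>z\<close> would have norm below 1, while \<open>\<nu> y\<close> takes the value 1 on
  it.\<close>

lemma unit_eqI:
  assumes "N y = 1" "N z = 1" "\<nu> y \<bullet> z = 1"
  shows "z = y"
proof (rule ccontr)
  assume "z \<noteq> y"
  then have "N ((1 - 1/2) *\<^sub>R y + (1/2) *\<^sub>R z) < 1"
    using strict[unfolded strictly_convex_norm_def, THEN conjunct2, rule_format, OF assms(1,2) _, of "1/2"]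
    by force
  moreover have y0: "y \<noteq> 0" using assms(1) by (rule N_1_nonzero)
  then have "\<nu> y \<bullet> ((1 - 1/2) *\<^sub>R y + (1/2) *\<^sub>R z) = 1"
    using ngrad_self[OF y0] assms by (simp add: inner_add_right)
  ultimately show False using ngrad_le[OF y0, of "(1 - 1/2) *\<^sub>R y + (1/2) *\<^sub>R z"] by linarith
qed

text \<open>A unit vector is determined up to sign by its supporting plane. This identifies radial
  and shortest directions with the normal \<open>\<eta>\<close>, leaving the sign to be settled by
  outwardness.\<close>

lemma ngrad_unit_parallel:
  assumes "N y = 1" "N z = 1" "\<And>w. \<nu> y \<bullet> w = 0 \<Longrightarrow> \<nu> z \<bullet> w = 0"
  shows "z = y \<or> z = - y"
proof -
  have y0: "y \<noteq> 0" "z \<noteq> 0" using assms(1,2) N_1_nonzero by blast+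
  define c where "c = \<nu> y \<bullet> z"
  \<comment> \<open>\<open>z - c y\<close> lies in the kernel of \<open>\<nu> y\<close>. The
    resulting relation \<open>c (\<nu> z \<bullet> y) = 1\<close> has both factors at most 1 in
    absolute value, so \<open>c\<close> is 1 or -1.\<close>
  have "\<nu> z \<bullet> (z - c *\<^sub>R y) = 0"
    using ngrad_self[OF y0(1)] assms(1) by (intro assms(3)) (simp add: c_def inner_diff_right)
  then have m: "c * (\<nu> z \<bullet> y) = 1" using ngrad_self[OF y0(2)] assms(2) by (simp add: inner_diff_right)
  have a: "\<bar>\<nu> y \<bullet> z\<bar> \<le> 1" "\<bar>\<nu> z \<bullet> y\<bar> \<le> 1"
    using ngrad_le[OF y0(1), of z] ngrad_le[OF y0(1), of "- z"] ngrad_le[OF y0(2), of y] ngrad_le[OF y0(2), of "- y"]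
      assms(1,2) by (auto simp: N_minus)
  have "\<bar>c\<bar> * \<bar>\<nu> z \<bullet> y\<bar> = 1" using m by (simp flip: abs_mult)
  then have "1 \<le> \<bar>c\<bar>"
    using mult_left_mono[OF a(2), of "\<bar>c\<bar>"] by simp
  then have "c = 1 \<or> c = -1" using a(1) unfolding c_def[symmetric] by linarith
  then show ?thesis
  proof
    assume "c = 1" then show ?thesis using unit_eqI[of y z] assms by (simp add: c_def)
  next
    assume "c = -1"
    then have "- z = y" using assms by (intro unit_eqI) (auto simp: c_def N_minus)
    then show ?thesis by force
  qed
qed

text \<open>Along the line through \<open>y\<close> with direction \<open>w\<close>, the supporting
  functional makes \<open>N\<close> minimal at \<open>y\<close>.\<close>

lemma ngrad_deriv_psd:
  assumes "y \<noteq> 0" "\<nu> y \<bullet> w = 0" shows "fder \<nu> y w \<bullet> w \<ge> 0"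
proof -
  obtain e where e: "e > 0" "\<And>s. \<bar>s\<bar> < e \<Longrightarrow> y + s *\<^sub>R w \<in> - {0}"
    using line_in_open[OF open_nonzero, of y w] assms by auto
  have g: "((\<lambda>s::real. y + s *\<^sub>R w) has_derivative (\<lambda>s. s *\<^sub>R w)) (at x)" for x
    by (auto intro!: derivative_eq_intros)
  show ?thesis
  proof (rule second_derivative_nonneg[OF e(1), of "\<lambda>s. N (y + s *\<^sub>R w)" "\<lambda>s. \<nu> (y + s *\<^sub>R w) \<bullet> w"])
    fix s assume s: "\<bar>s\<bar> < e"
    have "((\<lambda>s. N (y + s *\<^sub>R w)) has_derivative (\<lambda>r. \<nu> (y + s *\<^sub>R w) \<bullet> (r *\<^sub>R w))) (at s)"
      by (rule N_curve_derivative[OF g]) (use e(2)[OF s] in auto)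
    then show "((\<lambda>s. N (y + s *\<^sub>R w)) has_real_derivative \<nu> (y + s *\<^sub>R w) \<bullet> w) (at s)"
      unfolding has_field_derivative_def by (rule has_derivative_eq_rhs) (simp add: fun_eq_iff)
    show "N (y + 0 *\<^sub>R w) \<le> N (y + s *\<^sub>R w)"
      using ngrad_le[OF assms(1), of "y + s *\<^sub>R w"] ngrad_self[OF assms(1)] assms(2) by (simp add: inner_add_right)
  next
    have "(\<nu> has_derivative fder \<nu> y) (at (y + 0 *\<^sub>R w))" using ngrad_derivative[OF assms(1)] by simp
    from bounded_linear.has_derivative[OF bounded_linear_inner_left has_derivative_compose[OF g this]]
    have "((\<lambda>s. \<nu> (y + s *\<^sub>R w) \<bullet> w) has_derivative (\<lambda>s. fder \<nu> y (s *\<^sub>R w) \<bullet> w)) (at 0)" .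
    then show "((\<lambda>s. \<nu> (y + s *\<^sub>R w) \<bullet> w) has_real_derivative fder \<nu> y w \<bullet> w) (at 0)"
      unfolding has_field_derivative_def
      by (rule has_derivative_eq_rhs) (simp add: fun_eq_iff linear_scale[OF ngrad_linear[OF assms(1)]])
  qed (use assms in auto)
qed

text \<open>Orthogonality is minimality of \<open>N\<close> along lines: it makes the first
  derivative vanish, and conversely the supporting functional gives the minimum.\<close>

lemma birkhoff_orthogonal_iff:
  assumes "y \<noteq> 0"
  shows "birkhoff_orthogonal N y P \<longleftrightarrow> (\<forall>w\<in>P. \<nu> y \<bullet> w = 0)"
proof
  assume bo: "birkhoff_orthogonal N y P"
  show "\<forall>w\<in>P. \<nu> y \<bullet> w = 0"
  proof
    fix w assume "w \<in> P"
    then have min: "N (y + 0 *\<^sub>R w) \<le> N (y + s *\<^sub>R w)" for s using bo by (auto simp: birkhoff_orthogonal_def)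
    have g: "((\<lambda>s::real. y + s *\<^sub>R w) has_derivative (\<lambda>s. s *\<^sub>R w)) (at 0)"
      by (auto intro!: derivative_eq_intros)
    have "((\<lambda>s. N (y + s *\<^sub>R w)) has_derivative (\<lambda>r. \<nu> (y + 0 *\<^sub>R w) \<bullet> (r *\<^sub>R w))) (at 0)"
      by (rule N_curve_derivative[OF g]) (use assms in auto)
    then have "((\<lambda>s. N (y + s *\<^sub>R w)) has_real_derivative \<nu> y \<bullet> w) (at 0)"
      unfolding has_field_derivative_def by (rule has_derivative_eq_rhs) (simp add: fun_eq_iff)
    then show "\<nu> y \<bullet> w = 0"
      by (rule DERIV_local_min[where d=1]) (use min in auto)
  qed
next
  assume z: "\<forall>w\<in>P. \<nu> y \<bullet> w = 0"
  show "birkhoff_orthogonal N y P"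
    unfolding birkhoff_orthogonal_def
  proof (intro ballI allI)
    fix w t assume "w \<in> P"
    then show "N y \<le> N (y + t *\<^sub>R w)"
      using ngrad_le[OF assms, of "y + t *\<^sub>R w"] ngrad_self[OF assms] z by (simp add: inner_add_right)
  qed
qed

section \<open>Smooth normalisation by the norm, and the Euclidean unit normal of its
  spheres\<close>

lemma convex_on_N: "convex_on UNIV N"
proof (rule convex_onI)
  show "N ((1 - t) *\<^sub>R x + t *\<^sub>R y) \<le> (1 - t) * N x + t * N y" if "0 < t" "t < 1" for t x y
    using N_triangle[of "(1 - t) *\<^sub>R x" "t *\<^sub>R y"] that by (simp add: N_scale)
qed auto

lemma continuous_on_N: "continuous_on S N"
  using convex_on_continuous[OF open_UNIV convex_on_N] continuous_on_subset by blast

lemma inverse_N_smooth: "smooth_on (- {0}) (\<lambda>x. inverse (N x))"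
proof -
  have o: "open {0::real<..}" by simp
  have "N ` (- {0}) \<subseteq> {0<..}" using N_pos by auto
  from smooth_on_compose[OF open_nonzero o this N_smooth smooth_on_inverse_sqrt]
  have s: "smooth_on (- {0}) (\<lambda>x. inverse (sqrt (N x)))" .
  show ?thesis
  proof (rule smooth_on_cong[OF open_nonzero _ smooth_on_bilinear[OF open_nonzero bounded_bilinear_mult s s]])
    fix x assume "x \<in> - {0::'a}"
    then show "inverse (sqrt (N x)) * inverse (sqrt (N x)) = inverse (N x)"
      using N_nonneg[of x] by (simp flip: inverse_mult_distrib)
  qed
qed

definition unormal :: "'a \<Rightarrow> 'a" where
  "unormal y = inverse (sqrt (\<nu> y \<bullet> \<nu> y)) *\<^sub>R \<nu> y"

lemma unormal_scale_smooth: "smooth_on (- {0}) (\<lambda>y. inverse (sqrt (\<nu> y \<bullet> \<nu> y)))"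
proof -
  have o: "open {0::real<..}" by simp
  have "(\<lambda>y. \<nu> y \<bullet> \<nu> y) ` (- {0}) \<subseteq> {0<..}"
    by (intro image_subsetI) (simp add: ngrad_nonzero)
  from smooth_on_compose[OF open_nonzero o this
      smooth_on_bilinear[OF open_nonzero bounded_bilinear_inner ngrad_smooth ngrad_smooth] smooth_on_inverse_sqrt]
  show ?thesis .
qed

lemma unormal_smooth: "smooth_on (- {0}) unormal"
  unfolding unormal_def[abs_def]
  by (rule smooth_on_bilinear[OF open_nonzero bounded_bilinear_scaleR unormal_scale_smooth ngrad_smooth])

lemma norm_unormal: "y \<noteq> 0 \<Longrightarrow> norm (unormal y) = 1"
  using ngrad_nonzero[of y] by (simp add: unormal_def flip: norm_eq_sqrt_inner)

text \<open>\<open>unormal\<close> depends on \<open>y\<close> through \<open>\<nu> y\<close> alone,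
  so a direction in the kernel of the Hessian is also in the kernel of the differential of the Gauss
  map.\<close>

lemma unormal_deriv_0:
  assumes "y \<noteq> 0" "fder \<nu> y w = 0"
  shows "fder unormal y w = 0"
proof -
  let ?k = "\<lambda>y. inverse (sqrt (\<nu> y \<bullet> \<nu> y))"
  have q: "((\<lambda>y. \<nu> y \<bullet> \<nu> y) has_derivative (\<lambda>h. \<nu> y \<bullet> fder \<nu> y h + fder \<nu> y h \<bullet> \<nu> y)) (at y)"
    by (rule has_derivative_inner[OF ngrad_derivative ngrad_derivative]) (use assms in auto)
  have pos: "\<nu> y \<bullet> \<nu> y \<in> {0<..}" using ngrad_nonzero[OF assms(1)] by simp
  have "(?k has_derivative (\<lambda>h. fder (\<lambda>x. inverse (sqrt x)) (\<nu> y \<bullet> \<nu> y) (\<nu> y \<bullet> fder \<nu> y h + fder \<nu> y h \<bullet> \<nu> y))) (at y)"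
    by (rule has_derivative_compose[OF q smooth_on_has_derivative[OF smooth_on_inverse_sqrt pos]])
  moreover have "linear (fder (\<lambda>x::real. inverse (sqrt x)) (\<nu> y \<bullet> \<nu> y))"
    using smooth_on_has_derivative[OF smooth_on_inverse_sqrt pos] by (rule has_derivative_linear)
  ultimately obtain k' where k': "(?k has_derivative k') (at y)" "k' w = 0"
    using assms(2) linear_0 by force
  have "(unormal has_derivative (\<lambda>h. ?k y *\<^sub>R fder \<nu> y h + k' h *\<^sub>R \<nu> y)) (at y)"
    unfolding unormal_def[abs_def] by (rule has_derivative_scaleR[OF k'(1) ngrad_derivative[OF assms(1)]])
  from fun_cong[OF frechet_derivative_at[OF this], of w] show ?thesis using assms(2) k'(2) by simp
qed

end

section \<open>Curvature of the unit sphere\<close>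

lemma has_derivative_constraint:
  fixes f :: "'a::real_normed_vector \<Rightarrow> real"
  assumes "open U" "u \<in> U" "(f has_derivative f') (at u)" "\<And>x. x \<in> U \<Longrightarrow> f x = c"
  shows "f' v = 0"
proof -
  have "((\<lambda>x. c) has_derivative (\<lambda>v. 0)) (at u)" by simp
  then have "(f has_derivative (\<lambda>v. 0)) (at u)"
    by (rule has_derivative_transform_within_open[OF _ assms(1,2)]) (simp add: assms(4))
  from fun_cong[OF has_derivative_unique[OF assms(3) this]] show ?thesis .
qed

lemma (in smooth_strict_norm) unit_derivative_orthogonal:
  assumes "open U" "u \<in> U" "(n has_derivative n') (at u)" "\<And>x. x \<in> U \<Longrightarrow> N (n x) = 1"
  shows "\<nu> (n u) \<bullet> n' v = 0"
proof -
  have "n u \<noteq> 0" using N_1_nonzero[OF assms(4)[OF assms(2)]] .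
  from N_curve_derivative[OF assms(3) refl this]
  have d: "((\<lambda>x. N (n x)) has_derivative (\<lambda>v. \<nu> (n u) \<bullet> n' v)) (at u)" .
  show ?thesis by (rule has_derivative_constraint[OF assms(1,2) d assms(4)])
qed

locale smooth_strict_norm3 = smooth_strict_norm N for N :: "real^3 \<Rightarrow> real"
begin

abbreviation S where "S \<equiv> minkowski_sphere N 0 1"

lemma mem_S: "x \<in> S \<longleftrightarrow> N x = 1"
  by (simp add: minkowski_sphere_def)

lemma ngrad_plane_basis:
  assumes "y \<noteq> 0"
  obtains X Y where "independent {X, Y}" "X \<noteq> Y" "span {X, Y} = {w. \<nu> y \<bullet> w = 0}"
proof -
  let ?V = "{w. \<nu> y \<bullet> w = 0}"
  obtain B where B: "B \<subseteq> ?V" "independent B" "?V \<subseteq> span B" "card B = dim ?V"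
    using basis_exists by blast
  have "card B = 2" using dim_hyperplane[OF ngrad_nonzero[OF assms]] B(4) by simp
  then obtain X Y where XY: "B = {X, Y}" "X \<noteq> Y" by (auto simp: card_2_iff)
  have "span B \<subseteq> ?V" by (rule span_minimal[OF B(1) subspace_hyperplane])
  then show thesis using that XY B by blast
qed

text \<open>Central projection of the plane that touches the unit sphere at \<open>y\<close>.\<close>

lemma sphere_chart:
  assumes y: "N y = 1"
  obtains \<phi> where "local_param S UNIV \<phi>" "\<phi> 0 = y" "\<phi> ` UNIV = {x \<in> S. \<nu> y \<bullet> x > 0}"
proof -
  have y0: "y \<noteq> 0" using y by (rule N_1_nonzero)
  let ?a = "\<nu> y"
  have ay: "?a \<bullet> y = 1" using ngrad_self[OF y0] y by simp
  obtain X Y where XY: "independent {X, Y}" "X \<noteq> Y" "span {X, Y} = {w. ?a \<bullet> w = 0}"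
    using ngrad_plane_basis[OF y0] .
  define Z where "Z = (\<lambda>u::real^2. (u $ 1) *\<^sub>R X + (u $ 2) *\<^sub>R Y)"
  have Zlin: "linear Z" unfolding Z_def by (rule linearI) (simp_all add: algebra_simps)
  have rZ: "w \<in> range Z \<longleftrightarrow> ?a \<bullet> w = 0" for w
  proof -
    have "w \<in> range Z \<longleftrightarrow> w \<in> span {X, Y}"
      unfolding mem_span_pair
    proof
      assume "\<exists>p q. w = p *\<^sub>R X + q *\<^sub>R Y"
      then obtain p q where "w = p *\<^sub>R X + q *\<^sub>R Y" by blast
      then have "w = Z (vector [p, q])" by (simp add: Z_def)
      then show "w \<in> range Z" by blast
    qed (auto simp: Z_def)
    then show ?thesis using XY(3) by simp
  qed
  have "inj Z"
  proof (rule linear_injective_0[OF Zlin, THEN iffD2], intro allI impI)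
    fix u assume "Z u = 0"
    then have 0: "0 *\<^sub>R X + 0 *\<^sub>R Y = (u $ 1) *\<^sub>R X + (u $ 2) *\<^sub>R Y" by (simp add: Z_def)
    have "u $ 1 = 0" "u $ 2 = 0"
      using representation_pair[OF XY(1,2), of 0 0] representation_pair[OF XY(1,2), of "u $ 1" "u $ 2"]
      unfolding 0 by simp_all
    then show "u = 0" by (simp add: vec_eq_iff forall_2)
  qed
  then obtain C where C: "linear C" "C \<circ> Z = id" using linear_injective_left_inverse[OF Zlin] by blast
  have CZ: "C (Z u) = u" for u using C(2) by (metis comp_apply id_apply)
  have Cb: "bounded_linear C" and Zb: "bounded_linear Z" using C Zlin by (simp_all add: linear_conv_bounded_linear)
  define z where "z = (\<lambda>u. y + Z u)"
  define \<phi> where "\<phi> = (\<lambda>u. inverse (N (z u)) *\<^sub>R z u)"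
  \<comment> \<open>The inverse projection: \<open>x\<close> is rescaled onto the touching plane,
    where \<open>\<nu> y\<close> takes the value 1, and \<open>C\<close> reads off the
    coordinates.\<close>
  define \<psi> where "\<psi> = (\<lambda>x. C (inverse (?a \<bullet> x) *\<^sub>R x - y))"
  have az: "?a \<bullet> z u = 1" for u using rZ[of "Z u"] ay by (simp add: z_def inner_add_right)
  have z0: "z u \<noteq> 0" for u using az[of u] by auto
  have Nz: "N (z u) > 0" for u using N_pos[OF z0] .
  have zs: "smooth_on UNIV z" unfolding z_def
    by (intro smooth_on_add smooth_on_const smooth_on_bounded_linear Zb open_UNIV)
  have "range z \<subseteq> - {0}" using z0 by auto
  from smooth_on_compose[OF open_UNIV open_nonzero this zs inverse_N_smooth]
  have \<phi>s: "smooth_on UNIV \<phi>" unfolding \<phi>_def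
    by (rule smooth_on_bilinear[OF open_UNIV bounded_bilinear_scaleR _ zs])
  have a\<phi>: "?a \<bullet> \<phi> u = inverse (N (z u))" for u by (simp add: \<phi>_def az)
  have a\<phi>pos: "?a \<bullet> \<phi> u > 0" for u using Nz[of u] by (simp add: a\<phi>)
  have N\<phi>: "N (\<phi> u) = 1" for u using Nz[of u] by (simp add: \<phi>_def N_scale)
  have \<psi>\<phi>: "\<psi> (\<phi> u) = u" for u
  proof -
    have "inverse (?a \<bullet> \<phi> u) *\<^sub>R \<phi> u - y = Z u"
      unfolding a\<phi> using Nz[of u] by (simp add: \<phi>_def z_def)
    then show ?thesis by (simp add: \<psi>_def CZ)
  qed
  \<comment> \<open>The inverse is differentiable on an open half-space of the ambient space. This
    yields both the injectivity of the derivative of \<open>\<phi>\<close> and the continuity of the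
    inverse chart.\<close>
  have \<psi>d: "\<exists>D. (\<psi> has_derivative D) (at x)" if "?a \<bullet> x > 0" for x
  proof -
    have "((\<lambda>x. ?a \<bullet> x) has_derivative (\<lambda>h. ?a \<bullet> h)) (at x)" by (auto intro!: derivative_eq_intros)
    from Deriv.has_derivative_inverse[OF _ this] that
    have "((\<lambda>x. inverse (?a \<bullet> x)) has_derivative (\<lambda>h. - (inverse (?a \<bullet> x) * (?a \<bullet> h) * inverse (?a \<bullet> x)))) (at x)"
      by simp
    from has_derivative_diff[OF has_derivative_scaleR[OF this has_derivative_ident] has_derivative_const[of y]]
    show ?thesis unfolding \<psi>_def using bounded_linear.has_derivative[OF Cb] by blast
  qed
  have img: "\<phi> ` UNIV = S \<inter> {x. ?a \<bullet> x > 0}"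
  proof (intro equalityI subsetI)
    fix x assume "x \<in> S \<inter> {x. ?a \<bullet> x > 0}"
    then have x: "N x = 1" "?a \<bullet> x > 0" by (auto simp: mem_S)
    have "inverse (?a \<bullet> x) *\<^sub>R x - y \<in> range Z" unfolding rZ using x(2) ay by (simp add: inner_diff_right)
    then obtain u where "inverse (?a \<bullet> x) *\<^sub>R x - y = Z u" by blast
    then have zu: "z u = inverse (?a \<bullet> x) *\<^sub>R x" unfolding z_def by (metis add.commute diff_add_cancel)
    then have "N (z u) = inverse (?a \<bullet> x)" using x by (simp add: N_scale)
    then have "\<phi> u = x" using x(2) by (simp add: \<phi>_def zu)
    then show "x \<in> range \<phi>" by blast
  qed (use N\<phi> a\<phi>pos in \<open>auto simp: mem_S\<close>)
  have "local_param S UNIV \<phi>"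
    unfolding local_param_def
  proof (intro conjI ballI)
    fix u
    obtain D where D: "(\<psi> has_derivative D) (at (\<phi> u))" using \<psi>d[OF a\<phi>pos] by blast
    have "((\<lambda>u. \<psi> (\<phi> u)) has_derivative (\<lambda>v. D (fder \<phi> u v))) (at u)"
      by (rule has_derivative_compose[OF smooth_on_has_derivative[OF \<phi>s UNIV_I] D])
    moreover have "((\<lambda>u. \<psi> (\<phi> u)) has_derivative (\<lambda>v. v)) (at u)" unfolding \<psi>\<phi> by simp
    ultimately have "(\<lambda>v. D (fder \<phi> u v)) = (\<lambda>v. v)" by (rule has_derivative_unique)
    then show "inj (fder \<phi> u)" by (intro inj_on_inverseI[of _ D]) (auto dest: fun_cong)
  next
    show "openin (top_of_set S) (\<phi> ` UNIV)"
      unfolding img by (intro openin_open_Int open_halfspace_gt)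
  next
    have "homeomorphism UNIV (\<phi> ` UNIV) \<phi> \<psi>"
      unfolding homeomorphism_def
    proof (intro conjI ballI)
      show "continuous_on (\<phi> ` UNIV) \<psi>"
        using \<psi>d[OF a\<phi>pos] has_derivative_continuous
        by (intro continuous_at_imp_continuous_on) blast
      show "continuous_on UNIV \<phi>" using \<phi>s by (rule smooth_on_continuous)
      show "\<psi> ` \<phi> ` UNIV = UNIV" using \<psi>\<phi> by (metis surj_def image_comp comp_apply)
    qed (auto simp: \<psi>\<phi>)
    then show "\<exists>\<psi>. homeomorphism UNIV (\<phi> ` UNIV) \<phi> \<psi>" by blast
  qed (use \<phi>s in auto)
  moreover have "\<phi> 0 = y" using y by (simp add: \<phi>_def z_def Z_def)
  ultimately show thesis using that img by auto
qed

lemma sphere_tangent_space: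
  assumes lp: "local_param S U \<phi>" and u: "u \<in> U"
  shows "N (\<phi> u) = 1" "tangent_space S (\<phi> u) = {w. \<nu> (\<phi> u) \<bullet> w = 0}"
proof -
  have 1: "N (\<phi> x) = 1" if "x \<in> U" for x using local_paramD(7)[OF lp] that mem_S by blast
  show "N (\<phi> u) = 1" using 1 u .
  show "tangent_space S (\<phi> u) = {w. \<nu> (\<phi> u) \<bullet> w = 0}"
    by (rule tangent_space_orthogonal[OF lp u ngrad_nonzero[OF N_1_nonzero[OF 1[OF u]]]])
      (rule unit_derivative_orthogonal[OF local_paramD(1)[OF lp] u local_param_deriv(1)[OF lp u] 1])
qed

lemma unormal_field: "unit_normal_field S unormal"
  unfolding unit_normal_field_def smooth_on_surface_def
proof (intro conjI allI impI ballI)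
  fix U \<phi> assume lp: "local_param S U \<phi>"
  have "\<phi> ` U \<subseteq> - {0}"
    by (intro image_subsetI) (simp add: N_1_nonzero[OF sphere_tangent_space(1)[OF lp]])
  from smooth_on_compose[OF local_paramD(1)[OF lp] open_nonzero this local_paramD(2)[OF lp] unormal_smooth]
  show "smooth_on U (unormal \<circ> \<phi>)" by (simp add: o_def)
next
  fix p assume "p \<in> S"
  then have p: "N p = 1" by (simp add: mem_S)
  show "norm (unormal p) = 1" using norm_unormal[OF N_1_nonzero[OF p]] .
  obtain \<phi> where \<phi>: "local_param S UNIV \<phi>" "\<phi> 0 = p" "\<phi> ` UNIV = {x \<in> S. \<nu> p \<bullet> x > 0}"
    using sphere_chart[OF p] .
  fix v assume "v \<in> tangent_space S p"
  then have "\<nu> p \<bullet> v = 0" using sphere_tangent_space(2)[OF \<phi>(1) UNIV_I, of 0] \<phi>(2) by simp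
  then show "unormal p \<bullet> v = 0" by (simp add: unormal_def)
qed

text \<open>The curvature refers to an arbitrary unit normal field; on a connected chart it differs from
  \<open>unormal\<close> by a constant sign.\<close>

lemma gaussian_curvature_degenerate:
  assumes y: "N y = 1" and w: "w \<noteq> 0" "\<nu> y \<bullet> w = 0" "fder \<nu> y w = 0"
  shows "gaussian_curvature S y = 0"
proof -
  define n where "n = (SOME n. unit_normal_field S n)"
  have n: "unit_normal_field S n" unfolding n_def by (rule someI[of "unit_normal_field S", OF unormal_field])
  then have ns: "smooth_on_surface S n" by (simp add: unit_normal_field_def)
  obtain \<phi> where \<phi>: "local_param S UNIV \<phi>" "\<phi> 0 = y" "\<phi> ` UNIV = {x \<in> S. \<nu> y \<bullet> x > 0}"
    using sphere_chart[OF y] .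
  define c where "c = (\<lambda>u. n (\<phi> u) \<bullet> unormal (\<phi> u))"
  have y0: "y \<noteq> 0" using y by (rule N_1_nonzero)
  have nc: "n (\<phi> u) = c u *\<^sub>R unormal (\<phi> u)" "\<bar>c u\<bar> = 1" for u
  proof -
    note N1 = sphere_tangent_space(1)[OF \<phi>(1) UNIV_I, of u]
      and T = sphere_tangent_space(2)[OF \<phi>(1) UNIV_I, of u]
    have n1: "norm (n (\<phi> u)) = 1" and nT: "\<And>v. \<nu> (\<phi> u) \<bullet> v = 0 \<Longrightarrow> n (\<phi> u) \<bullet> v = 0"
      using n N1 mem_S T unfolding unit_normal_field_def by auto
    let ?g = "unormal (\<phi> u)"
    have g1: "norm ?g = 1" by (rule norm_unormal[OF N_1_nonzero[OF N1]])
    have \<nu>0: "\<nu> (\<phi> u) \<bullet> \<nu> (\<phi> u) > 0" using ngrad_nonzero[OF N_1_nonzero[OF N1]] by simp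
    \<comment> \<open>The part of \<open>n\<close> that is perpendicular to \<open>unormal\<close>
      is tangent to the sphere, hence perpendicular to \<open>n\<close> as well, and so to
      itself.\<close>
    define d where "d = n (\<phi> u) - c u *\<^sub>R ?g"
    have gd: "?g \<bullet> d = 0"
      using g1 unfolding d_def c_def by (simp add: inner_diff_right norm_eq_1 inner_commute)
    then have "\<nu> (\<phi> u) \<bullet> d = 0" using \<nu>0 by (simp add: unormal_def)
    then have "n (\<phi> u) \<bullet> d = 0" by (rule nT)
    then have "(n (\<phi> u) - c u *\<^sub>R ?g) \<bullet> d = 0" using gd by (simp add: inner_diff_left)
    then have "d \<bullet> d = 0" by (simp only: d_def[symmetric])
    then show 1: "n (\<phi> u) = c u *\<^sub>R ?g" by (simp add: d_def)
    show "\<bar>c u\<bar> = 1" using n1 g1 unfolding 1 by simp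
  qed
  have ns': "smooth_on UNIV (\<lambda>u. n (\<phi> u))" and gs': "smooth_on UNIV (\<lambda>u. unormal (\<phi> u))"
    using ns[unfolded smooth_on_surface_def, rule_format, OF \<phi>(1)]
      unormal_field[unfolded unit_normal_field_def smooth_on_surface_def, THEN conjunct1, rule_format, OF \<phi>(1)]
    by (simp_all add: o_def)
  have "continuous_on UNIV c" unfolding c_def
    using ns' gs' by (intro continuous_on_inner smooth_on_continuous)
  moreover have "c ` UNIV \<subseteq> {-1, 1}"
  proof
    fix x assume "x \<in> c ` UNIV"
    then have "\<bar>x\<bar> = 1" using nc(2) by auto
    then show "x \<in> {-1, 1}" by auto
  qed
  ultimately have "c constant_on UNIV"
    by (intro continuous_finite_range_constant) (auto intro: finite_subset)
  then obtain k where k: "c u = k" for u by (auto simp: constant_on_def)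
  have "range (fder \<phi> 0) = {w. \<nu> y \<bullet> w = 0}"
    using sphere_tangent_space(2)[OF \<phi>(1), of 0] tangent_space_chart[OF \<phi>(1), of 0] \<phi>(2) by simp
  then obtain v where v: "w = fder \<phi> 0 v" using w(2) by blast
  let ?L = "surface_differential S n y"
  have "((\<lambda>u. unormal (\<phi> u)) has_derivative (\<lambda>v. fder unormal y (fder \<phi> 0 v))) (at 0)"
    using has_derivative_compose[OF local_param_deriv(1)[OF \<phi>(1) UNIV_I]
        smooth_on_has_derivative[OF unormal_smooth], of 0] y0 \<phi>(2) by simp
  from has_derivative_scaleR_right[OF this, of k]
  have "((n \<circ> \<phi>) has_derivative (\<lambda>v. k *\<^sub>R fder unormal y (fder \<phi> 0 v))) (at 0)"
    using nc(1) by (simp add: k o_def)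
  from fun_cong[OF frechet_derivative_at[OF this], of v] unormal_deriv_0[OF y0 w(3)]
  have "fder (n \<circ> \<phi>) 0 v = 0" by (simp add: v)
  then have Lw: "?L w = 0"
    using surface_differential_chart[OF \<phi>(1) ns UNIV_I, of 0 v] \<phi>(2) v by simp
  have lin: "linear ?L" using surface_differential_linear[OF \<phi>(1) ns UNIV_I, of 0] \<phi>(2) by simp
  have T: "tangent_space S y = span {fder \<phi> 0 (axis 1 1), fder \<phi> 0 (axis 2 1)}"
    using tangent_space_chart[OF \<phi>(1) UNIV_I, of 0] local_param_deriv(5)[OF \<phi>(1) UNIV_I, of 0] \<phi>(2) by simp
  have "w \<in> tangent_space S y"
    using sphere_tangent_space(2)[OF \<phi>(1), of 0] \<phi>(2) w(2) by simp
  from det_on_plane_eq_0[OF local_param_deriv(3,4)[OF \<phi>(1) UNIV_I, of 0] T lin this w(1) Lw]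
  show ?thesis by (simp add: gaussian_curvature_def n_def)
qed

end

locale curved_norm3 = smooth_strict_norm3 +
  assumes curv: "\<forall>x\<in>S. gaussian_curvature S x \<noteq> 0"
begin

text \<open>A null vector of a semidefinite form lies in its kernel. The Hessian is symmetric and
  annihilates \<open>y\<close>, so a null tangent vector \<open>w\<close> would satisfy
  \<open>fder \<nu> y w = 0\<close>, and the Gaussian curvature would vanish at
  \<open>y\<close>.\<close>

lemma ngrad_deriv_pd:
  assumes y: "N y = 1" and w: "\<nu> y \<bullet> w = 0" "w \<noteq> 0"
  shows "fder \<nu> y w \<bullet> w > 0"
proof (rule ccontr)
  assume "\<not> ?thesis"
  have y0: "y \<noteq> 0" using y by (rule N_1_nonzero)
  with \<open>\<not> ?thesis\<close> ngrad_deriv_psd[OF y0 w(1)] have 0: "fder \<nu> y w \<bullet> w = 0" by simp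
  interpret L: linear "fder \<nu> y" using ngrad_linear[OF y0] .
  have "fder \<nu> y w \<bullet> v = 0" if "\<nu> y \<bullet> v = 0" for v
  proof (rule ccontr)
    assume b: "fder \<nu> y w \<bullet> v \<noteq> 0"
    define b where "b = fder \<nu> y w \<bullet> v"
    define c where "c = fder \<nu> y v \<bullet> v"
    have c: "c \<ge> 0" unfolding c_def by (rule ngrad_deriv_psd[OF y0 that])
    have q: "2 * t * b + t^2 * c \<ge> 0" for t
    proof -
      have "\<nu> y \<bullet> (w + t *\<^sub>R v) = 0" using w(1) that by (simp add: inner_add_right)
      from ngrad_deriv_psd[OF y0 this]
      have "0 \<le> fder \<nu> y w \<bullet> w + t * (fder \<nu> y w \<bullet> v) + t * (fder \<nu> y v \<bullet> w) + t * (t * (fder \<nu> y v \<bullet> v))"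
        by (simp add: L.add L.scale inner_add_left inner_add_right algebra_simps)
      then show ?thesis
        using ngrad_symmetric[OF y0, of v w] by (simp add: 0 b_def c_def power2_eq_square)
    qed
    \<comment> \<open>At \<open>t = - r\<close> the quadratic of \<open>q\<close> equals
      \<open>- r^2 (c + 2)\<close>. The added 1 avoids a case distinction for
      \<open>c = 0\<close>.\<close>
    define r where "r = b / (c + 1)"
    have br: "b = r * (c + 1)" using c by (simp add: r_def)
    have "2 * (- r) * b + (- r)\<^sup>2 * c = r\<^sup>2 * (- 2 * (c + 1) + c)"
      unfolding br by (simp add: algebra_simps power2_eq_square)
    also have "\<dots> < 0" using c b by (intro mult_pos_neg) (auto simp: b_def r_def)
    finally show False using q[of "- r"] by simp
  qed note T = this
  have "fder \<nu> y w \<bullet> v = 0" for v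
  proof -
    have "\<nu> y \<bullet> (v - (\<nu> y \<bullet> v) *\<^sub>R y) = 0" using ngrad_self[OF y0] y by (simp add: inner_diff_right)
    from T[OF this] have "fder \<nu> y w \<bullet> v = (\<nu> y \<bullet> v) * (fder \<nu> y w \<bullet> y)" by (simp add: inner_diff_right)
    also have "fder \<nu> y w \<bullet> y = 0"
      using ngrad_symmetric[OF y0, of w y] ngrad_deriv_self[OF y0] by simp
    finally show ?thesis by simp
  qed
  then have "fder \<nu> y w = 0" by (metis inner_eq_zero_iff)
  from gaussian_curvature_degenerate[OF y w(2,1) this] show False using curv y by (simp add: mem_S)
qed

end

section \<open>Triple products\<close>

abbreviation tri :: "real^3 \<Rightarrow> real^3 \<Rightarrow> real^3 \<Rightarrow> real" where
  "tri X Y Z \<equiv> det (vector [X, Y, Z] :: real^3^3)"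

lemma tri_lin:
  "tri (a *\<^sub>R X + c *\<^sub>R Y) (b *\<^sub>R X + d *\<^sub>R Y) Z = (a * d - b * c) * tri X Y Z"
  by (simp add: det_3 algebra_simps)

lemma tri_neg: "tri X Y (- Z) = - tri X Y Z"
  by (simp add: det_3 algebra_simps)

lemma tri_nonzero:
  assumes "independent {X, Y}" "X \<noteq> Y" "Z \<notin> span {X, Y}"
  shows "tri X Y Z \<noteq> 0"
proof
  assume 0: "tri X Y Z = 0"
  let ?a = "cross3 X Y"
  have "?a \<bullet> Z = tri X Y Z" by (simp add: det_3 cross3_simps inner_vec_def sum_3)
  moreover have "?a \<noteq> 0"
  proof
    assume "?a = 0"
    then have "collinear {0, X, Y}" using cross_eq_0 by blast
    then consider "X = 0" | "Y = 0" | k where "Y = k *\<^sub>R X" unfolding collinear_lemma by blast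
    then show False
    proof cases
      case 3
      have "{X, Y} - {Y} = {X}" using assms(2) by auto
      then have "Y \<in> span ({X, Y} - {Y})" using 3 by (simp add: span_base span_scale)
      then show False using assms(1) unfolding dependent_def by blast
    qed (use assms(1) dependent_zero in auto)
  qed
  ultimately show False
    using plane_eq_orthogonal[OF assms(1,2), of ?a] assms(3) 0 by (simp add: dot_cross_self)
qed

section \<open>Pointwise geometry of the Birkhoff-Gauss map\<close>

lemma psd_form_coeffs:
  fixes p s r :: real
  assumes "\<And>\<alpha> \<beta>. p * \<alpha>\<^sup>2 + 2 * s * \<alpha> * \<beta> + r * \<beta>\<^sup>2 \<ge> 0"
  shows "p \<ge> 0" "r \<ge> 0" "p * r - s\<^sup>2 \<ge> 0"
proof -
  show p: "p \<ge> 0" using assms[of 1 0] by simp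
  show "r \<ge> 0" using assms[of 0 1] by simp
  show "p * r - s\<^sup>2 \<ge> 0"
  proof (cases "p = 0")
    case True
    have "s = 0"
    proof (rule ccontr)
      assume "s \<noteq> 0"
      \<comment> \<open>With \<open>p = 0\<close> the form takes the value
        \<open>- (r + 1) + r = - 1\<close> at this vector.\<close>
      then show False using assms[of "- (r + 1) / (2 * s)" 1] True by (simp add: field_simps)
    qed
    then show ?thesis using True by simp
  next
    case False
    have "0 \<le> p * (p * r - s\<^sup>2)"
      using assms[of "- s" p] by (simp add: algebra_simps power2_eq_square)
    then show ?thesis using p False by (simp add: zero_le_mult_iff)
  qed
qed

text \<open>Let \<open>L\<close> be the operator with columns \<open>(a, c)\<close> and
  \<open>(b, d)\<close>, and \<open>H\<close> half its trace. By Cayley-Hamilton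
  \<open>(L - H)^2\<close> is the scalar \<open>H^2 - det L\<close>. Pairing with the first basis
  vector \<open>X\<close> and using self-adjointness, \<open>4 E (H^2 - det L)\<close> is the square
  length of \<open>2 (L - H) X\<close>, whose coordinates are \<open>(a - d, 2c)\<close>.\<close>

lemma birkhoff_selfadjoint_discriminant:
  fixes a b c d E F G :: real
  assumes pd: "\<And>\<alpha> \<beta>. (\<alpha>, \<beta>) \<noteq> (0, 0) \<Longrightarrow> E * \<alpha>\<^sup>2 + 2 * F * \<alpha> * \<beta> + G * \<beta>\<^sup>2 > 0"
    and sym: "a * F + c * G = b * E + d * F"
  shows "a * d - b * c \<le> ((a + d) / 2)\<^sup>2"
    and "a * d - b * c = ((a + d) / 2)\<^sup>2 \<Longrightarrow> a = d \<and> b = 0 \<and> c = 0"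
proof -
  have E: "E > 0" using pd[of 1 0] by simp
  have bE: "b * E = (a - d) * F + c * G" using sym by (simp add: algebra_simps)
  have "E * (4 * (((a + d) / 2)\<^sup>2 - (a * d - b * c))) = E * (a - d)\<^sup>2 + 4 * c * (b * E)"
    by (simp add: field_simps power2_eq_square)
  also have "\<dots> = E * (a - d)\<^sup>2 + 2 * F * (a - d) * (2 * c) + G * (2 * c)\<^sup>2"
    unfolding bE by (simp add: algebra_simps power2_eq_square)
  finally have eq: "E * (4 * (((a + d) / 2)\<^sup>2 - (a * d - b * c))) =
      E * (a - d)\<^sup>2 + 2 * F * (a - d) * (2 * c) + G * (2 * c)\<^sup>2" .
  have "E * (a - d)\<^sup>2 + 2 * F * (a - d) * (2 * c) + G * (2 * c)\<^sup>2 \<ge> 0"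
    using pd[of "a - d" "2 * c"] by (cases "(a - d, 2 * c) = (0, 0)") auto
  then have "E * (4 * (((a + d) / 2)\<^sup>2 - (a * d - b * c))) \<ge> 0" using eq by linarith
  then show "a * d - b * c \<le> ((a + d) / 2)\<^sup>2" using E by (simp add: zero_le_mult_iff)
  assume "a * d - b * c = ((a + d) / 2)\<^sup>2"
  then have "E * (a - d)\<^sup>2 + 2 * F * (a - d) * (2 * c) + G * (2 * c)\<^sup>2 = 0" using eq by simp
  then have "(a - d, 2 * c) = (0, 0)" using pd[of "a - d" "2 * c"] by (metis less_irrefl)
  then have "a = d" "c = 0" by auto
  then show "a = d \<and> b = 0 \<and> c = 0" using bE E by simp
qed

text \<open>\<open>(q1, q2; q3, q4)\<close> is the matrix of an operator that is self-adjoint for the form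
  \<open>(E, F; F, G)\<close>.\<close>

lemma psd_selfadjoint_trace_det:
  fixes q1 q2 q3 q4 E F G :: real
  assumes pd: "\<And>\<alpha> \<beta>. (\<alpha>, \<beta>) \<noteq> (0, 0) \<Longrightarrow> E * \<alpha>\<^sup>2 + 2 * F * \<alpha> * \<beta> + G * \<beta>\<^sup>2 > 0"
    and sym: "q1 * F + q3 * G = q2 * E + q4 * F"
    and psd: "\<And>\<alpha> \<beta>. (q1 * E + q3 * F) * \<alpha>\<^sup>2 + 2 * (q1 * F + q3 * G) * \<alpha> * \<beta> + (q2 * F + q4 * G) * \<beta>\<^sup>2 \<ge> 0"
  shows "q1 + q4 \<ge> 0" "q1 * q4 - q2 * q3 \<ge> 0"
proof -
  let ?p = "q1 * E + q3 * F" and ?s = "q1 * F + q3 * G" and ?r = "q2 * F + q4 * G"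
  have E: "E > 0" using pd[of 1 0] by simp
  have "E * (E * G - F\<^sup>2) > 0" using pd[of "- F" E] E by (simp add: algebra_simps power2_eq_square)
  then have D: "E * G - F\<^sup>2 > 0" using E by (simp add: zero_less_mult_iff)
  note c = psd_form_coeffs[OF psd]
  \<comment> \<open>The Gram matrix of the semidefinite form is the product of the matrices of the
    operator and of the metric, and determinants multiply.\<close>
  have "(q1 * q4 - q2 * q3) * (E * G - F\<^sup>2) = ?p * ?r - ?s * (q2 * E + q4 * F)"
    by (simp add: algebra_simps power2_eq_square)
  also have "\<dots> = ?p * ?r - ?s\<^sup>2" using sym by (simp add: power2_eq_square)
  finally have "(q1 * q4 - q2 * q3) * (E * G - F\<^sup>2) \<ge> 0" using c(3) by simp
  then show "q1 * q4 - q2 * q3 \<ge> 0" using D by (simp add: zero_le_mult_iff)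
  \<comment> \<open>The trace is a positive combination of two values of the semidefinite form: at
    the first basis vector and at \<open>(F, - E)\<close>, which is orthogonal to it for the
    metric.\<close>
  have "E * ((q1 + q4) * (E * G - F\<^sup>2)) = E * (?p * G - ?s * F - (q2 * E + q4 * F) * F + ?r * E)"
    by (simp add: algebra_simps power2_eq_square)
  also have "\<dots> = E * (?p * G - 2 * ?s * F + ?r * E)" using sym by (simp add: algebra_simps)
  also have "\<dots> = ?p * (E * G - F\<^sup>2) + (?p * F\<^sup>2 + 2 * ?s * F * (- E) + ?r * (- E)\<^sup>2)"
    by (simp add: algebra_simps power2_eq_square)
  also have "\<dots> \<ge> 0" 
    by (rule add_nonneg_nonneg[OF mult_nonneg_nonneg[OF c(1) less_imp_le[OF D]] psd])
  finally show "q1 + q4 \<ge> 0" using D E by (simp add: zero_le_mult_iff)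
qed

locale minkowski_surface = curved_norm3 N for N +
  fixes M :: "(real^3) set" and \<eta> :: "real^3 \<Rightarrow> real^3"
  assumes reg: "regular_surface M" and bgm: "birkhoff_gauss_map N M \<eta>"
begin

abbreviation Hm where "Hm \<equiv> minkowski_mean_curvature M \<eta>"

definition area_dens :: "(real^2 \<Rightarrow> real^3) \<Rightarrow> real^2 \<Rightarrow> real" where
  "area_dens \<phi> u = tri (fder \<phi> u (axis 1 1)) (fder \<phi> u (axis 2 1)) (\<eta> (\<phi> u))"

text \<open>This is \<open>K = det d\<eta>\<close>, written as the ratio of the area elements
  spanned by the derivatives of \<open>\<eta> \<circ> \<phi>\<close> and of \<open>\<phi>\<close>.
  In this form its continuity in the chart is visible.\<close>

definition gauss_curv :: "(real^2 \<Rightarrow> real^3) \<Rightarrow> real^2 \<Rightarrow> real" where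
  "gauss_curv \<phi> u = tri (fder (\<eta> \<circ> \<phi>) u (axis 1 1)) (fder (\<eta> \<circ> \<phi>) u (axis 2 1)) (\<eta> (\<phi> u)) / area_dens \<phi> u"

lemma eta_smooth: "smooth_on_surface M \<eta>"
  using bgm by (simp add: birkhoff_gauss_map_def)

lemma N_eta: "p \<in> M \<Longrightarrow> N (\<eta> p) = 1"
  using bgm mem_S by (simp add: birkhoff_gauss_map_def)

context
  fixes U \<phi> assumes lp: "local_param M U \<phi>"
begin

lemma chart_mem: "u \<in> U \<Longrightarrow> \<phi> u \<in> M"
  using local_paramD(7)[OF lp] by blast

lemma chart_N_eta: "u \<in> U \<Longrightarrow> N (\<eta> (\<phi> u)) = 1"
  using N_eta chart_mem by blast

lemma chart_eta_nonzero: "u \<in> U \<Longrightarrow> \<eta> (\<phi> u) \<noteq> 0"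
  using N_1_nonzero chart_N_eta by blast

lemma normal_smooth: "smooth_on U (\<eta> \<circ> \<phi>)"
  using eta_smooth lp by (simp add: smooth_on_surface_def)

lemma normal_derivative: "u \<in> U \<Longrightarrow> ((\<eta> \<circ> \<phi>) has_derivative fder (\<eta> \<circ> \<phi>) u) (at u)"
  using normal_smooth by (rule smooth_on_has_derivative)

lemma normal_linear: "u \<in> U \<Longrightarrow> linear (fder (\<eta> \<circ> \<phi>) u)"
  by (rule has_derivative_linear[OF normal_derivative])

lemma ngrad_tangent: assumes u: "u \<in> U" shows "\<nu> (\<eta> (\<phi> u)) \<bullet> fder \<phi> u v = 0"
proof -
  have "birkhoff_orthogonal N (\<eta> (\<phi> u)) (tangent_space M (\<phi> u))"
    using bgm chart_mem[OF u] by (simp add: birkhoff_gauss_map_def)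
  then show ?thesis
    unfolding birkhoff_orthogonal_iff[OF chart_eta_nonzero[OF u]] tangent_space_chart[OF lp u] by blast
qed

lemma chart_tangent_space:
  assumes u: "u \<in> U" shows "tangent_space M (\<phi> u) = {w. \<nu> (\<eta> (\<phi> u)) \<bullet> w = 0}"
  by (rule tangent_space_orthogonal[OF lp u ngrad_nonzero[OF chart_eta_nonzero[OF u]] ngrad_tangent[OF u]])

lemma ngrad_normal_deriv: assumes u: "u \<in> U" shows "\<nu> (\<eta> (\<phi> u)) \<bullet> fder (\<eta> \<circ> \<phi>) u v = 0"
  using unit_derivative_orthogonal[OF local_paramD(1)[OF lp] u normal_derivative[OF u]] chart_N_eta by simp

lemma chart_span: assumes u: "u \<in> U"
  shows "span {fder \<phi> u (axis 1 1), fder \<phi> u (axis 2 1)} = {w. \<nu> (\<eta> (\<phi> u)) \<bullet> w = 0}"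
  using local_param_deriv(5)[OF lp u] tangent_space_chart[OF lp u] chart_tangent_space[OF u] by simp

lemma area_dens_nonzero: assumes u: "u \<in> U" shows "area_dens \<phi> u \<noteq> 0"
  unfolding area_dens_def
proof (rule tri_nonzero[OF local_param_deriv(3,4)[OF lp u]])
  show "\<eta> (\<phi> u) \<notin> span {fder \<phi> u (axis 1 1), fder \<phi> u (axis 2 1)}"
    unfolding chart_span[OF u] using ngrad_self[OF chart_eta_nonzero[OF u]] chart_N_eta[OF u] by simp
qed

text \<open>Differentiate the relation
  \<open>\<nu> (\<eta> (\<phi> u)) \<bullet> fder \<phi> u v = 0\<close> in the direction
  \<open>w\<close>. The right-hand side is symmetric in \<open>v\<close> and \<open>w\<close>, and
  this makes \<open>d\<eta>\<close> self-adjoint for the Hessian of the norm.\<close>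

lemma second_form: assumes u: "u \<in> U"
  shows "fder \<nu> (\<eta> (\<phi> u)) (fder (\<eta> \<circ> \<phi>) u w) \<bullet> fder \<phi> u v = - (\<nu> (\<eta> (\<phi> u)) \<bullet> fder (\<lambda>u. fder \<phi> u v) u w)"
proof -
  have "(\<nu> has_derivative fder \<nu> (\<eta> (\<phi> u))) (at ((\<eta> \<circ> \<phi>) u))"
    using ngrad_derivative[OF chart_eta_nonzero[OF u]] by simp
  from has_derivative_compose[OF normal_derivative[OF u] this]
  have 1: "((\<lambda>u. \<nu> ((\<eta> \<circ> \<phi>) u)) has_derivative (\<lambda>w. fder \<nu> (\<eta> (\<phi> u)) (fder (\<eta> \<circ> \<phi>) u w))) (at u)" .
  have 2: "((\<lambda>u. fder \<phi> u v) has_derivative fder (\<lambda>u. fder \<phi> u v) u) (at u)"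
    by (rule smooth_on_has_derivative[OF smooth_on_frechet[OF local_paramD(2)[OF lp]] u])
  from has_derivative_constraint[OF local_paramD(1)[OF lp] u has_derivative_inner[OF 1 2], of 0 w]
  show ?thesis using ngrad_tangent by simp
qed

lemma second_form_symmetric: assumes u: "u \<in> U"
  shows "fder \<nu> (\<eta> (\<phi> u)) (fder (\<eta> \<circ> \<phi>) u w) \<bullet> fder \<phi> u v = fder \<nu> (\<eta> (\<phi> u)) (fder (\<eta> \<circ> \<phi>) u v) \<bullet> fder \<phi> u w"
  unfolding second_form[OF u] frechet_derivative_swap[OF local_paramD(1,2)[OF lp] u, of v w] ..

text \<open>Everything about \<open>d\<eta>\<close> at one point in terms of real numbers: its
  matrix in the coordinate basis, trace, determinant, and self-adjointness for the positive definite
  form \<open>g\<close>. The pointwise statements then reduce to 2x2 algebra.\<close>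

lemma chart_matrix:
  assumes u: "u \<in> U"
  defines "X \<equiv> fder \<phi> u (axis 1 1)" and "Y \<equiv> fder \<phi> u (axis 2 1)"
  defines "g \<equiv> \<lambda>v w. fder \<nu> (\<eta> (\<phi> u)) v \<bullet> w"
  obtains a b c d where
    "fder (\<eta> \<circ> \<phi>) u (axis 1 1) = a *\<^sub>R X + c *\<^sub>R Y" "fder (\<eta> \<circ> \<phi>) u (axis 2 1) = b *\<^sub>R X + d *\<^sub>R Y"
    "Hm (\<phi> u) = (a + d) / 2" "a * g X Y + c * g Y Y = b * g X X + d * g X Y"
    "gauss_curv \<phi> u = a * d - b * c"
    "\<And>\<alpha> \<beta>. (\<alpha>, \<beta>) \<noteq> (0, 0) \<Longrightarrow> g X X * \<alpha>\<^sup>2 + 2 * g X Y * \<alpha> * \<beta> + g Y Y * \<beta>\<^sup>2 > 0"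
proof -
  let ?n = "\<eta> \<circ> \<phi>"
  have y0: "\<eta> (\<phi> u) \<noteq> 0" by (rule chart_eta_nonzero[OF u])
  interpret G: linear "fder \<nu> (\<eta> (\<phi> u))" by (rule ngrad_linear[OF y0])
  have "fder ?n u v \<in> span {X, Y}" for v
    unfolding X_def Y_def chart_span[OF u] using ngrad_normal_deriv[OF u] by simp
  then obtain a b c d where n: "fder ?n u (axis 1 1) = a *\<^sub>R X + c *\<^sub>R Y" "fder ?n u (axis 2 1) = b *\<^sub>R X + d *\<^sub>R Y"
    unfolding mem_span_pair by meson
  have sym: "g Y X = g X Y" unfolding g_def by (rule ngrad_symmetric[OF y0])
  have L: "linear (surface_differential M \<eta> (\<phi> u))"
    "surface_differential M \<eta> (\<phi> u) X = a *\<^sub>R X + c *\<^sub>R Y"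
    "surface_differential M \<eta> (\<phi> u) Y = b *\<^sub>R X + d *\<^sub>R Y"
    unfolding X_def Y_def surface_differential_chart[OF lp eta_smooth u] n[unfolded X_def Y_def]
    by (rule surface_differential_linear[OF lp eta_smooth u]) (rule refl)+
  have T: "tangent_space M (\<phi> u) = span {X, Y}"
    unfolding X_def Y_def using local_param_deriv(5)[OF lp u] tangent_space_chart[OF lp u] by simp
  have 3: "Hm (\<phi> u) = (a + d) / 2"
    unfolding minkowski_mean_curvature_def
    using trace_on_plane[OF local_param_deriv(3,4)[OF lp u, folded X_def Y_def] T L] by simp
  have "g (a *\<^sub>R X + c *\<^sub>R Y) Y = g (b *\<^sub>R X + d *\<^sub>R Y) X"
    using second_form_symmetric[OF u, of "axis 1 1" "axis 2 1"] unfolding n g_def X_def Y_def .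
  then have 4: "a * g X Y + c * g Y Y = b * g X X + d * g X Y"
    using sym by (simp add: g_def G.add G.scale inner_add_left)
  have 5: "gauss_curv \<phi> u = a * d - b * c"
    using area_dens_nonzero[OF u]
    unfolding gauss_curv_def n tri_lin by (simp add: area_dens_def X_def Y_def)
  have 6: "g X X * \<alpha>\<^sup>2 + 2 * g X Y * \<alpha> * \<beta> + g Y Y * \<beta>\<^sup>2 > 0" if "(\<alpha>, \<beta>) \<noteq> (0, 0)" for \<alpha> \<beta>
  proof -
    let ?w = "\<alpha> *\<^sub>R X + \<beta> *\<^sub>R Y"
    have "?w \<noteq> 0"
    proof
      assume "?w = 0"
      then have z: "0 *\<^sub>R X + 0 *\<^sub>R Y = ?w" by simp
      note rep = representation_pair[OF local_param_deriv(3,4)[OF lp u, folded X_def Y_def]]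
      have "\<alpha> = 0" "\<beta> = 0" using rep[of 0 0] rep[of \<alpha> \<beta>] unfolding z by simp_all
      then show False using that by simp
    qed
    moreover have "\<nu> (\<eta> (\<phi> u)) \<bullet> ?w = 0"
      using ngrad_tangent[OF u] by (simp add: X_def Y_def inner_add_right)
    ultimately have "g ?w ?w > 0" unfolding g_def by (intro ngrad_deriv_pd[OF chart_N_eta[OF u]])
    also have "g ?w ?w = g X X * \<alpha>\<^sup>2 + g X Y * \<alpha> * \<beta> + g Y X * \<alpha> * \<beta> + g Y Y * \<beta>\<^sup>2"
      by (simp add: g_def G.add G.scale inner_add_left inner_add_right power2_eq_square algebra_simps)
    finally show ?thesis by (simp add: sym algebra_simps)
  qed
  show thesis using that[OF n 3 4 5 6] .
qed

text \<open>The trace is the rate at which \<open>d\<eta>\<close>, acting on one argument at a time,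
  changes the area form. \<open>Hm\<close> is defined through choices of a basis and a derivative;
  this formula exhibits it as a quotient of continuous functions.\<close>

lemma mean_curvature_formula: assumes u: "u \<in> U"
  shows "2 * Hm (\<phi> u) * area_dens \<phi> u =
    tri (fder (\<eta> \<circ> \<phi>) u (axis 1 1)) (fder \<phi> u (axis 2 1)) (\<eta> (\<phi> u)) +
    tri (fder \<phi> u (axis 1 1)) (fder (\<eta> \<circ> \<phi>) u (axis 2 1)) (\<eta> (\<phi> u))"
proof -
  let ?X = "fder \<phi> u (axis 1 1)" and ?Y = "fder \<phi> u (axis 2 1)"
  obtain a b c d where m: "fder (\<eta> \<circ> \<phi>) u (axis 1 1) = a *\<^sub>R ?X + c *\<^sub>R ?Y"
    "fder (\<eta> \<circ> \<phi>) u (axis 2 1) = b *\<^sub>R ?X + d *\<^sub>R ?Y" "Hm (\<phi> u) = (a + d) / 2"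
    by (rule chart_matrix[OF u]) (rule that; assumption)
  have "tri (a *\<^sub>R ?X + c *\<^sub>R ?Y) ?Y Z = a * tri ?X ?Y Z" for Z
    using tri_lin[of a ?X c ?Y 0 1 Z] by simp
  moreover have "tri ?X (b *\<^sub>R ?X + d *\<^sub>R ?Y) Z = d * tri ?X ?Y Z" for Z
    using tri_lin[of 1 ?X 0 ?Y b d Z] by simp
  ultimately show ?thesis unfolding m by (simp add: area_dens_def algebra_simps)
qed

text \<open>\<open>det (1 - t d\<eta>) = 1 - 2 t H + t^2 K\<close>, times the area density. The
  third vector \<open>- \<eta>\<close> is the derivative of the flow in \<open>t\<close>, which
  accounts for the sign.\<close>

lemma normal_flow_det: assumes u: "u \<in> U"
  shows "tri (fder \<phi> u (axis 1 1) - t *\<^sub>R fder (\<eta> \<circ> \<phi>) u (axis 1 1))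
      (fder \<phi> u (axis 2 1) - t *\<^sub>R fder (\<eta> \<circ> \<phi>) u (axis 2 1)) (- \<eta> (\<phi> u)) =
    - (area_dens \<phi> u * (1 - 2 * t * Hm (\<phi> u) + t\<^sup>2 * gauss_curv \<phi> u))"
proof -
  let ?X = "fder \<phi> u (axis 1 1)" and ?Y = "fder \<phi> u (axis 2 1)"
  obtain a b c d where m: "fder (\<eta> \<circ> \<phi>) u (axis 1 1) = a *\<^sub>R ?X + c *\<^sub>R ?Y"
    "fder (\<eta> \<circ> \<phi>) u (axis 2 1) = b *\<^sub>R ?X + d *\<^sub>R ?Y" "Hm (\<phi> u) = (a + d) / 2" "gauss_curv \<phi> u = a * d - b * c"
    by (rule chart_matrix[OF u]) (rule that; assumption)
  have 1: "?X - t *\<^sub>R (a *\<^sub>R ?X + c *\<^sub>R ?Y) = (1 - t * a) *\<^sub>R ?X + (- (t * c)) *\<^sub>R ?Y"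
    "?Y - t *\<^sub>R (b *\<^sub>R ?X + d *\<^sub>R ?Y) = (- (t * b)) *\<^sub>R ?X + (1 - t * d) *\<^sub>R ?Y"
    by (simp_all add: algebra_simps)
  show ?thesis
    unfolding m(1,2) 1 tri_neg tri_lin
    by (simp add: m(3,4) area_dens_def algebra_simps power2_eq_square)
qed

lemma gauss_curv_le: assumes u: "u \<in> U" shows "gauss_curv \<phi> u \<le> (Hm (\<phi> u))\<^sup>2"
proof -
  obtain a b c d where m: "Hm (\<phi> u) = (a + d) / 2" "gauss_curv \<phi> u = a * d - b * c"
    and "a * d - b * c \<le> ((a + d) / 2)\<^sup>2"
    by (rule chart_matrix[OF u], rule that, assumption+, rule birkhoff_selfadjoint_discriminant(1))
  then show ?thesis by (simp only:)
qed

lemma umbilic: assumes u: "u \<in> U" "gauss_curv \<phi> u = (Hm (\<phi> u))\<^sup>2"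
  shows "fder (\<eta> \<circ> \<phi>) u v = Hm (\<phi> u) *\<^sub>R fder \<phi> u v"
proof -
  let ?X = "fder \<phi> u (axis 1 1)" and ?Y = "fder \<phi> u (axis 2 1)"
  let ?g = "\<lambda>v w. fder \<nu> (\<eta> (\<phi> u)) v \<bullet> w"
  obtain a b c d where m: "fder (\<eta> \<circ> \<phi>) u (axis 1 1) = a *\<^sub>R ?X + c *\<^sub>R ?Y"
    "fder (\<eta> \<circ> \<phi>) u (axis 2 1) = b *\<^sub>R ?X + d *\<^sub>R ?Y" "Hm (\<phi> u) = (a + d) / 2"
    "a * ?g ?X ?Y + c * ?g ?Y ?Y = b * ?g ?X ?X + d * ?g ?X ?Y" "gauss_curv \<phi> u = a * d - b * c"
    "\<And>\<alpha> \<beta>. (\<alpha>, \<beta>) \<noteq> (0, 0) \<Longrightarrow> ?g ?X ?X * \<alpha>\<^sup>2 + 2 * ?g ?X ?Y * \<alpha> * \<beta> + ?g ?Y ?Y * \<beta>\<^sup>2 > 0"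
    by (rule chart_matrix[OF u(1)]) (rule that; assumption)
  have e: "a = d \<and> b = 0 \<and> c = 0"
    by (rule birkhoff_selfadjoint_discriminant(2)[OF m(6,4)]) (use u(2) m(3,5) in simp_all)
  have "fder (\<eta> \<circ> \<phi>) u v = (v $ 1) *\<^sub>R fder (\<eta> \<circ> \<phi>) u (axis 1 1) + (v $ 2) *\<^sub>R fder (\<eta> \<circ> \<phi>) u (axis 2 1)"
    by (subst vec2_eq[of v]) (simp only: linear_add[OF normal_linear[OF u(1)]] linear_scale[OF normal_linear[OF u(1)]])
  also have "\<dots> = Hm (\<phi> u) *\<^sub>R ((v $ 1) *\<^sub>R ?X + (v $ 2) *\<^sub>R ?Y)"
    using e unfolding m(1-3) by (simp add: algebra_simps)
  also have "(v $ 1) *\<^sub>R ?X + (v $ 2) *\<^sub>R ?Y = fder \<phi> u v"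
    by (subst (3) vec2_eq[of v])
      (simp only: linear_add[OF local_param_deriv(2)[OF lp u(1)]] linear_scale[OF local_param_deriv(2)[OF lp u(1)]])
  finally show ?thesis .
qed

section \<open>First and second variation of the distance to a point\<close>

lemma chart_curve_derivative:
  assumes "u + s *\<^sub>R v \<in> U"
  shows "((\<lambda>s. \<phi> (u + s *\<^sub>R v)) has_derivative (\<lambda>r. r *\<^sub>R fder \<phi> (u + s *\<^sub>R v) v)) (at s)"
proof -
  have g: "((\<lambda>s. u + s *\<^sub>R v) has_derivative (\<lambda>r. r *\<^sub>R v)) (at s)"
    by (auto intro!: derivative_eq_intros)
  from has_derivative_compose[OF g local_param_deriv(1)[OF lp assms]] show ?thesis
    by (rule has_derivative_eq_rhs) (simp add: fun_eq_iff linear_scale[OF local_param_deriv(2)[OF lp assms]])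
qed

lemma distance_curve_derivative:
  assumes "u + s *\<^sub>R v \<in> U" "\<phi> (u + s *\<^sub>R v) \<noteq> x"
  shows "((\<lambda>s. N (\<phi> (u + s *\<^sub>R v) - x)) has_real_derivative \<nu> (\<phi> (u + s *\<^sub>R v) - x) \<bullet> fder \<phi> (u + s *\<^sub>R v) v) (at s)"
proof -
  have "((\<lambda>s. \<phi> (u + s *\<^sub>R v) - x) has_derivative (\<lambda>r. r *\<^sub>R fder \<phi> (u + s *\<^sub>R v) v)) (at s)"
    using has_derivative_diff[OF chart_curve_derivative[OF assms(1)] has_derivative_const[of x]] by simp
  from N_curve_derivative[OF this refl] assms(2)
  have "((\<lambda>s. N (\<phi> (u + s *\<^sub>R v) - x)) has_derivative (\<lambda>r. \<nu> (\<phi> (u + s *\<^sub>R v) - x) \<bullet> (r *\<^sub>R fder \<phi> (u + s *\<^sub>R v) v))) (at s)"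
    by simp
  then show ?thesis
    unfolding has_field_derivative_def by (rule has_derivative_eq_rhs) (simp add: fun_eq_iff)
qed

lemma nearest_point_second_order:
  assumes u: "u \<in> U" and t: "t > 0" and x: "x = \<phi> u - t *\<^sub>R \<eta> (\<phi> u)" and min: "\<And>v. v \<in> U \<Longrightarrow> t \<le> N (\<phi> v - x)"
  shows "t * Hm (\<phi> u) \<le> 1" "1 - 2 * t * Hm (\<phi> u) + t\<^sup>2 * gauss_curv \<phi> u \<ge> 0"
proof -
  let ?X = "fder \<phi> u (axis 1 1)" and ?Y = "fder \<phi> u (axis 2 1)" and ?y = "\<eta> (\<phi> u)"
  let ?g = "\<lambda>v w. fder \<nu> ?y v \<bullet> w"
  have y0: "?y \<noteq> 0" by (rule chart_eta_nonzero[OF u])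
  interpret G: linear "fder \<nu> ?y" by (rule ngrad_linear[OF y0])
  interpret D: linear "fder \<phi> u" by (rule local_param_deriv(2)[OF lp u])
  interpret n: linear "fder (\<eta> \<circ> \<phi>) u" by (rule normal_linear[OF u])
  have ux: "\<phi> u - x = t *\<^sub>R ?y" by (simp add: x)
  have ne: "\<phi> v \<noteq> x" if "v \<in> U" for v using min[OF that] t N_0[of "\<phi> v - x"] by auto
  \<comment> \<open>The second derivative of the distance along the image of a line has two parts.
    The Hessian of \<open>N\<close> at \<open>t \<eta>\<close> contributes \<open>g / t\<close>,
    being homogeneous of degree -1; the acceleration of the curve contributes, by
    \<open>second_form\<close>, the term with \<open>d\<eta>\<close>. Multiplication by
    \<open>t\<close> gives the claim.\<close>
  have key: "?g (fder \<phi> u v) (fder \<phi> u v) - t * ?g (fder (\<eta> \<circ> \<phi>) u v) (fder \<phi> u v) \<ge> 0" for v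
  proof -
    obtain e where e: "e > 0" "\<And>s. \<bar>s\<bar> < e \<Longrightarrow> u + s *\<^sub>R v \<in> U"
      using line_in_open[OF local_paramD(1)[OF lp] u, of v] by blast
    let ?f' = "\<lambda>s. \<nu> (\<phi> (u + s *\<^sub>R v) - x) \<bullet> fder \<phi> (u + s *\<^sub>R v) v"
    have "0 \<le> (1 / t) * ?g (fder \<phi> u v) (fder \<phi> u v) - ?g (fder (\<eta> \<circ> \<phi>) u v) (fder \<phi> u v)"
    proof (rule second_derivative_nonneg[OF e(1), of "\<lambda>s. N (\<phi> (u + s *\<^sub>R v) - x)" ?f'])
      show "((\<lambda>s. N (\<phi> (u + s *\<^sub>R v) - x)) has_real_derivative ?f' s) (at s)" if "\<bar>s\<bar> < e" for s
        using e(2)[OF that] ne[OF e(2)[OF that]] by (rule distance_curve_derivative)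
      show "N (\<phi> (u + 0 *\<^sub>R v) - x) \<le> N (\<phi> (u + s *\<^sub>R v) - x)" if "\<bar>s\<bar> < e" for s
        using min[OF e(2)[OF that]] t chart_N_eta[OF u] by (simp add: ux N_scale)
      show "?f' 0 = 0" using ngrad_tangent[OF u] t y0 by (simp add: ux ngrad_scale)
      have u0: "u + 0 *\<^sub>R v \<in> U" using u by simp
      have "((\<lambda>s. \<phi> (u + s *\<^sub>R v) - x) has_derivative (\<lambda>r. r *\<^sub>R fder \<phi> u v)) (at 0)"
        using has_derivative_diff[OF chart_curve_derivative[OF u0] has_derivative_const[of x]] by simp
      moreover have "(\<nu> has_derivative fder \<nu> (t *\<^sub>R ?y)) (at (\<phi> (u + 0 *\<^sub>R v) - x))"
        using ngrad_derivative[of "t *\<^sub>R ?y"] t y0 ux by simp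
      ultimately have 1: "((\<lambda>s. \<nu> (\<phi> (u + s *\<^sub>R v) - x)) has_derivative (\<lambda>r. fder \<nu> (t *\<^sub>R ?y) (r *\<^sub>R fder \<phi> u v))) (at 0)"
        by (rule has_derivative_compose)
      have g: "((\<lambda>s. u + s *\<^sub>R v) has_derivative (\<lambda>r. r *\<^sub>R v)) (at 0)"
        by (auto intro!: derivative_eq_intros)
      have 2: "((\<lambda>s. fder \<phi> (u + s *\<^sub>R v) v) has_derivative (\<lambda>r. fder (\<lambda>u. fder \<phi> u v) u (r *\<^sub>R v))) (at 0)"
        using has_derivative_compose[OF g smooth_on_has_derivative[OF smooth_on_frechet[OF local_paramD(2)[OF lp]] u0]] by simp
      have lin: "linear (fder (\<lambda>u. fder \<phi> u v) u)"
        by (rule has_derivative_linear[OF smooth_on_has_derivative[OF smooth_on_frechet[OF local_paramD(2)[OF lp]] u]])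
      have "\<nu> ?y \<bullet> fder (\<lambda>u. fder \<phi> u v) u v = - ?g (fder (\<eta> \<circ> \<phi>) u v) (fder \<phi> u v)"
        using second_form[OF u, of v v] by simp
      then show "(?f' has_real_derivative (1 / t) * ?g (fder \<phi> u v) (fder \<phi> u v) - ?g (fder (\<eta> \<circ> \<phi>) u v) (fder \<phi> u v)) (at 0)"
        unfolding has_field_derivative_def
        by (intro has_derivative_eq_rhs[OF has_derivative_inner[OF 1 2]])
          (use t y0 in \<open>simp add: fun_eq_iff ux ngrad_scale ngrad_deriv_scale linear_scale[OF lin] G.scale algebra_simps\<close>)
    qed
    then have "0 \<le> t * ((1 / t) * ?g (fder \<phi> u v) (fder \<phi> u v) - ?g (fder (\<eta> \<circ> \<phi>) u v) (fder \<phi> u v))"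
      using t by (intro mult_nonneg_nonneg) auto
    then show ?thesis using t by (simp add: right_diff_distrib)
  qed
  obtain a b c d where m: "fder (\<eta> \<circ> \<phi>) u (axis 1 1) = a *\<^sub>R ?X + c *\<^sub>R ?Y"
    "fder (\<eta> \<circ> \<phi>) u (axis 2 1) = b *\<^sub>R ?X + d *\<^sub>R ?Y" "Hm (\<phi> u) = (a + d) / 2"
    "a * ?g ?X ?Y + c * ?g ?Y ?Y = b * ?g ?X ?X + d * ?g ?X ?Y" "gauss_curv \<phi> u = a * d - b * c"
    "\<And>\<alpha> \<beta>. (\<alpha>, \<beta>) \<noteq> (0, 0) \<Longrightarrow> ?g ?X ?X * \<alpha>\<^sup>2 + 2 * ?g ?X ?Y * \<alpha> * \<beta> + ?g ?Y ?Y * \<beta>\<^sup>2 > 0"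
    by (rule chart_matrix[OF u]) (rule that; assumption)
  have sym: "?g ?Y ?X = ?g ?X ?Y" by (rule ngrad_symmetric[OF y0])
  define E F G where EFG: "E = ?g ?X ?X" "F = ?g ?X ?Y" "G = ?g ?Y ?Y"
  have teq: "t * (a * F + c * G) = t * (b * E + d * F)" using m(4)[folded EFG] by simp
  \<comment> \<open>This is \<open>key\<close> in the coordinates of \<open>X\<close> and
    \<open>Y\<close>, with the matrix of \<open>1 - t d\<eta>\<close>. Self-adjointness, in the form
    \<open>teq\<close>, merges the two mixed terms.\<close>
  have psd: "((1 - t * a) * E + (- (t * c)) * F) * \<alpha>\<^sup>2 + 2 * ((1 - t * a) * F + (- (t * c)) * G) * \<alpha> * \<beta> +
     ((- (t * b)) * F + (1 - t * d) * G) * \<beta>\<^sup>2 \<ge> 0" for \<alpha> \<beta>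
  proof -
    let ?v = "\<alpha> *\<^sub>R axis 1 1 + \<beta> *\<^sub>R axis 2 1"
    have dv: "fder \<phi> u ?v = \<alpha> *\<^sub>R ?X + \<beta> *\<^sub>R ?Y" by (simp only: D.add D.scale)
    have nv: "fder (\<eta> \<circ> \<phi>) u ?v = (\<alpha> * a + \<beta> * b) *\<^sub>R ?X + (\<alpha> * c + \<beta> * d) *\<^sub>R ?Y"
      by (simp only: n.add n.scale m(1,2)) (simp add: algebra_simps)
    have "0 \<le> \<alpha> * \<alpha> * E + 2 * \<alpha> * \<beta> * F + \<beta> * \<beta> * G - t * ((\<alpha> * a + \<beta> * b) * \<alpha> * E + (\<alpha> * a + \<beta> * b) * \<beta> * F
       + (\<alpha> * c + \<beta> * d) * \<alpha> * F + (\<alpha> * c + \<beta> * d) * \<beta> * G)"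
      using key[of ?v] unfolding dv nv EFG
      by (simp add: G.add G.scale inner_add_left inner_add_right sym algebra_simps)
    also have "\<dots> = ((1 - t * a) * E + (- (t * c)) * F) * \<alpha>\<^sup>2 + (2 * F - t * (a * F + c * G) - t * (b * E + d * F)) * \<alpha> * \<beta> +
     ((- (t * b)) * F + (1 - t * d) * G) * \<beta>\<^sup>2"
      by (simp add: algebra_simps power2_eq_square)
    also have "2 * F - t * (a * F + c * G) - t * (b * E + d * F) = 2 * ((1 - t * a) * F + (- (t * c)) * G)"
      unfolding teq[symmetric] by (simp add: algebra_simps)
    finally show ?thesis .
  qed
  from teq have s: "(1 - t * a) * F + (- (t * c)) * G = (- (t * b)) * E + (1 - t * d) * F"
    by (simp add: algebra_simps)
  have q: "(1 - t * a) + (1 - t * d) \<ge> 0"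
    by (rule psd_selfadjoint_trace_det(1)[OF _ s psd], rule m(6)[folded EFG])
  have q': "(1 - t * a) * (1 - t * d) - (- (t * b)) * (- (t * c)) \<ge> 0"
    by (rule psd_selfadjoint_trace_det(2)[OF _ s psd], rule m(6)[folded EFG])
  have "t * Hm (\<phi> u) = 1 - ((1 - t * a) + (1 - t * d)) / 2"
    unfolding m(3) by (simp add: field_simps)
  also have "\<dots> \<le> 1" using q by simp
  finally show "t * Hm (\<phi> u) \<le> 1" .
  have "1 - 2 * t * Hm (\<phi> u) + t\<^sup>2 * gauss_curv \<phi> u = (1 - t * a) * (1 - t * d) - (- (t * b)) * (- (t * c))"
    unfolding m(3,5) by (simp add: field_simps power2_eq_square)
  then show "1 - 2 * t * Hm (\<phi> u) + t\<^sup>2 * gauss_curv \<phi> u \<ge> 0" using q' by simp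
qed

text \<open>The first variation vanishes, so \<open>\<phi> u - x\<close> and
  \<open>\<eta> (\<phi> u)\<close> have the same supporting plane. The sign cannot be read off from
  one chart.\<close>

lemma nearest_point_first_order:
  assumes u: "u \<in> U" and x: "x \<noteq> \<phi> u" and min: "\<And>v. v \<in> U \<Longrightarrow> N (\<phi> u - x) \<le> N (\<phi> v - x)"
  shows "\<phi> u - x = N (\<phi> u - x) *\<^sub>R \<eta> (\<phi> u) \<or> \<phi> u - x = - (N (\<phi> u - x) *\<^sub>R \<eta> (\<phi> u))"
proof -
  let ?t = "N (\<phi> u - x)"
  let ?y = "(1 / ?t) *\<^sub>R (\<phi> u - x)"
  have t: "?t > 0" using x by (intro N_pos) auto
  have 0: "\<nu> (\<phi> u - x) \<bullet> fder \<phi> u v = 0" for v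
  proof -
    obtain e where e: "e > 0" "\<And>s. \<bar>s\<bar> < e \<Longrightarrow> u + s *\<^sub>R v \<in> U"
      using line_in_open[OF local_paramD(1)[OF lp] u, of v] by blast
    have "u + 0 *\<^sub>R v \<in> U" "\<phi> (u + 0 *\<^sub>R v) \<noteq> x" using u x by auto
    from distance_curve_derivative[OF this]
    have "\<nu> (\<phi> (u + 0 *\<^sub>R v) - x) \<bullet> fder \<phi> (u + 0 *\<^sub>R v) v = 0"
      by (rule DERIV_local_min[OF _ e(1)]) (use e min in auto)
    then show ?thesis by simp
  qed
  have "\<nu> ?y = \<nu> (\<phi> u - x)" using t x by (intro ngrad_scale) auto
  moreover have "\<nu> (\<phi> u - x) \<bullet> w = 0" if "\<nu> (\<eta> (\<phi> u)) \<bullet> w = 0" for w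
  proof -
    have "w \<in> range (fder \<phi> u)"
      using that chart_tangent_space[OF u] tangent_space_chart[OF lp u] by simp
    then show ?thesis using 0 by auto
  qed
  ultimately have "\<nu> ?y \<bullet> w = 0" if "\<nu> (\<eta> (\<phi> u)) \<bullet> w = 0" for w
    using that by simp
  then have "?y = \<eta> (\<phi> u) \<or> ?y = - \<eta> (\<phi> u)"
    using t by (intro ngrad_unit_parallel chart_N_eta[OF u]) (auto simp: N_scale)
  moreover have "\<phi> u - x = ?t *\<^sub>R ?y" using t by simp
  ultimately show ?thesis by (metis scaleR_minus_right)
qed

end

lemma nearest_point:
  assumes "compact M" and out: "outward_pointing M \<eta>" and x: "x \<in> inside M"
  obtains p t where "p \<in> M" "t > 0" "x = p - t *\<^sub>R \<eta> p" "\<And>q. q \<in> M \<Longrightarrow> t \<le> N (q - x)"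
proof -
  have xM: "x \<notin> M" using x inside_no_overlap by blast
  have "M \<noteq> {}" using x by auto
  moreover have "continuous_on M (\<lambda>q. N (q - x))"
    by (rule continuous_on_compose2[OF continuous_on_N[of UNIV]]) (auto intro!: continuous_intros)
  ultimately obtain p where p: "p \<in> M" "\<And>q. q \<in> M \<Longrightarrow> N (p - x) \<le> N (q - x)"
    using continuous_attains_inf[OF assms(1)] by blast
  define t where "t = N (p - x)"
  have t: "t > 0" unfolding t_def using p(1) xM by (intro N_pos) auto
  obtain U \<phi> u where lp: "local_param M U \<phi>" and u: "u \<in> U" "p = \<phi> u"
    using reg p(1) unfolding regular_surface_def by blast
  have "p - x = t *\<^sub>R \<eta> p \<or> p - x = - (t *\<^sub>R \<eta> p)"
    using nearest_point_first_order[OF lp u(1), of x] p xM chart_mem[OF lp] unfolding u(2) t_def by blast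
  moreover have "p - x \<noteq> - (t *\<^sub>R \<eta> p)"
  proof
    \<comment> \<open>With the wrong sign, moving outward from \<open>p\<close> leads towards
      \<open>x\<close>. The segment from \<open>x\<close> to a point \<open>z\<close> just outside
      \<open>p\<close> stays at distance less than \<open>t\<close> from \<open>x\<close> and misses
      \<open>M\<close>, so \<open>z\<close> would be both inside and outside.\<close>
    assume px: "p - x = - (t *\<^sub>R \<eta> p)"
    obtain e where e: "e > 0" "\<And>s. 0 < s \<Longrightarrow> s < e \<Longrightarrow> p + s *\<^sub>R \<eta> p \<in> outside M"
      using out p(1) unfolding outward_pointing_def by blast
    define s where "s = min e t / 2"
    have s: "0 < s" "s < e" "s < t" using e t by (auto simp: s_def)
    define z where "z = p + s *\<^sub>R \<eta> p"
    have "z - x = - ((t - s) *\<^sub>R \<eta> p)" using px by (simp add: z_def algebra_simps)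
    then have Nz: "N (z - x) < t" using s N_eta[OF p(1)] by (simp add: N_minus N_scale)
    have "closed_segment x z \<subseteq> - M"
    proof
      fix q assume "q \<in> closed_segment x z"
      then obtain r where r: "0 \<le> r" "r \<le> 1" "q = (1 - r) *\<^sub>R x + r *\<^sub>R z" by (auto simp: in_segment)
      then have "q - x = r *\<^sub>R (z - x)" by (simp add: algebra_simps)
      then have "N (q - x) = r * N (z - x)" using r(1) by (simp add: N_scale)
      also have "\<dots> \<le> 1 * N (z - x)" using r(2) N_nonneg by (intro mult_right_mono) auto
      finally have "N (q - x) < t" using Nz by simp
      then show "q \<in> - M" using p(2)[of q] unfolding t_def by force
    qed
    then have "connected_component (- M) x z"
      by (intro connected_component_of_subset[OF _ \<open>closed_segment x z \<subseteq> - M\<close>] connected_componentI[OF connected_segment])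
        auto
    then have "z \<in> inside M" using x by (rule inside_same_component)
    moreover have "z \<in> outside M" using e(2)[OF s(1,2)] by (simp add: z_def)
    ultimately show False using inside_Int_outside by blast
  qed
  ultimately have "x = p - t *\<^sub>R \<eta> p" by (metis add_diff_cancel_left' diff_add_cancel diff_diff_eq2 add.commute)
  then show thesis using that[OF p(1) t] p(2) by (simp add: t_def)
qed

end

section \<open>Volume swept out by the normal flow\<close>

text \<open>The parameters \<open>(u, t)\<close> of the normal flow, placed in the space that
  contains the image, so that the Jacobian is the determinant of a square matrix.\<close>

definition emb3 :: "real^2 \<Rightarrow> real \<Rightarrow> real^3" where
  "emb3 u t = (u $ 1) *\<^sub>R axis 1 1 + (u $ 2) *\<^sub>R axis 2 1 + t *\<^sub>R axis 3 1"

definition proj2 :: "real^3 \<Rightarrow> real^2" where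
  "proj2 z = (z $ 1) *\<^sub>R axis 1 1 + (z $ 2) *\<^sub>R axis 2 1"

lemma emb3_nth [simp]: "emb3 u t $ 1 = u $ 1" "emb3 u t $ 2 = u $ 2" "emb3 u t $ 3 = t"
  by (simp_all add: emb3_def axis_def)

lemma proj2_nth [simp]: "proj2 z $ 1 = z $ 1" "proj2 z $ 2 = z $ 2"
  by (simp_all add: proj2_def axis_def)

lemma proj2_emb3 [simp]: "proj2 (emb3 u t) = u"
  by (simp add: vec_eq_iff forall_2)

lemma bounded_linear_proj2: "bounded_linear proj2"
  by (rule linear_conv_bounded_linear[THEN iffD1], rule linearI)
    (simp_all add: vec_eq_iff forall_2)

lemma proj2_axis [simp]: "proj2 (axis 1 1) = axis 1 1" "proj2 (axis 2 1) = axis 2 1" "proj2 (axis 3 1) = 0"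
  by (simp_all add: vec_eq_iff forall_2 axis_def)

lemma prod_Basis_cart: "(\<Prod>b\<in>Basis. (v::real^'n) \<bullet> b) = (\<Prod>i\<in>UNIV. v $ i)"
proof -
  have B: "(Basis :: (real^'n) set) = (\<lambda>i. axis i 1) ` UNIV" by (auto simp: Basis_vec_def)
  have "inj (\<lambda>i. axis i 1 :: real^'n)" by (simp add: inj_on_def axis_eq_axis)
  then show ?thesis unfolding B by (subst prod.reindex) (simp_all add: inner_axis)
qed

lemma prod_UNIV_3: "(\<Prod>i\<in>UNIV. f (i::3)) = f 1 * f 2 * (f 3 :: real)"
proof -
  have "(\<Prod>i\<in>UNIV. f i) = f 1 * (f 2 * f 3)" unfolding UNIV_3 by simp
  then show ?thesis by (simp only: mult.assoc)
qed

lemma measurable_emb3 [measurable]: "(\<lambda>(u, t). emb3 u t) \<in> borel \<Otimes>\<^sub>M borel \<rightarrow>\<^sub>M borel"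
  unfolding borel_prod emb3_def case_prod_beta
  by (intro borel_measurable_continuous_onI continuous_intros)

text \<open>Lebesgue measure is characterised by its values on boxes, and the preimage of a box is
  the product of a box and an interval. Fubini for \<open>u\<close> and \<open>t\<close>
  follows.\<close>

lemma lborel_emb3: "(lborel :: (real^3) measure) = distr (lborel \<Otimes>\<^sub>M lborel) borel (\<lambda>(u, t). emb3 u t)"
proof (rule lborel_eqI)
  fix l u :: "real^3" assume le: "\<And>b. b \<in> Basis \<Longrightarrow> l \<bullet> b \<le> u \<bullet> b"
  then have le': "l $ i \<le> u $ i" for i
    by (metis inner_axis inner_real_def mult.right_neutral axis_in_Basis_iff Basis_real_def insertI1)
  have "emeasure (distr (lborel \<Otimes>\<^sub>M lborel) borel (\<lambda>(u, t). emb3 u t)) (box l u) =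
      emeasure (lborel \<Otimes>\<^sub>M lborel) ((\<lambda>(u, t). emb3 u t) -` box l u \<inter> space (lborel \<Otimes>\<^sub>M lborel))"
    by (rule emeasure_distr) (simp_all add: measurable_emb3 cong: measurable_cong_sets)
  also have "(\<lambda>(u, t). emb3 u t) -` box l u \<inter> space (lborel \<Otimes>\<^sub>M lborel) = box (proj2 l) (proj2 u) \<times> box (l $ 3) (u $ 3)"
    by (auto simp: mem_box_cart forall_2 forall_3 space_pair_measure)
  also have "emeasure (lborel \<Otimes>\<^sub>M lborel) (box (proj2 l) (proj2 u) \<times> box (l $ 3) (u $ 3)) =
      emeasure lborel (box (proj2 l) (proj2 u)) * emeasure lborel (box (l $ 3) (u $ 3))"
    by (rule lborel.emeasure_pair_measure_Times) auto
  also have "emeasure lborel (box (proj2 l) (proj2 u)) = ennreal (\<Prod>b\<in>Basis. (proj2 u - proj2 l) \<bullet> b)"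
  proof (rule emeasure_lborel_box)
    fix b :: "real^2" assume "b \<in> Basis"
    then obtain i where "b = axis i 1" by (auto simp: Basis_vec_def)
    moreover have "proj2 l $ i \<le> proj2 u $ i" using exhaust_2[of i] le' by auto
    ultimately show "proj2 l \<bullet> b \<le> proj2 u \<bullet> b" by (simp add: inner_axis)
  qed
  also have "\<dots> = ennreal ((u $ 1 - l $ 1) * (u $ 2 - l $ 2))"
    unfolding prod_Basis_cart by (simp add: UNIV_2)
  also have "emeasure lborel (box (l $ 3) (u $ 3)) = ennreal (u $ 3 - l $ 3)"
    using le'[of 3] by (simp add: box_real)
  also have "ennreal ((u $ 1 - l $ 1) * (u $ 2 - l $ 2)) * ennreal (u $ 3 - l $ 3) =
      ennreal ((u $ 1 - l $ 1) * (u $ 2 - l $ 2) * (u $ 3 - l $ 3))"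
    by (rule ennreal_mult[symmetric]) (use le' in simp_all)
  also have "(u $ 1 - l $ 1) * (u $ 2 - l $ 2) * (u $ 3 - l $ 3) = (\<Prod>b\<in>Basis. (u - l) \<bullet> b)"
    by (simp only: prod_Basis_cart prod_UNIV_3 vector_minus_component)
  finally show "emeasure (distr (lborel \<Otimes>\<^sub>M lborel) borel (\<lambda>(u, t). emb3 u t)) (box l u) = ennreal (\<Prod>b\<in>Basis. (u - l) \<bullet> b)" .
qed simp

lemma nn_integral_emb3:
  assumes [measurable]: "f \<in> borel_measurable borel"
  shows "(\<integral>\<^sup>+z. f z \<partial>lborel) = (\<integral>\<^sup>+u. \<integral>\<^sup>+t. f (emb3 u t) \<partial>lborel \<partial>lborel)"
proof -
  have m: "(\<lambda>(u, t). emb3 u t) \<in> lborel \<Otimes>\<^sub>M lborel \<rightarrow>\<^sub>M borel"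
    using measurable_emb3 by (simp cong: measurable_cong_sets)
  have "(\<integral>\<^sup>+z. f z \<partial>lborel) = (\<integral>\<^sup>+z. f ((\<lambda>(u, t). emb3 u t) z) \<partial>(lborel \<Otimes>\<^sub>M lborel))"
    by (subst lborel_emb3, rule nn_integral_distr[OF m]) simp
  also have "\<dots> = (\<integral>\<^sup>+u. \<integral>\<^sup>+t. f (emb3 u t) \<partial>lborel \<partial>lborel)"
    using lborel.nn_integral_fst[OF measurable_compose[OF m assms], symmetric] by simp
  finally show ?thesis .
qed

lemma matrix_det_columns: "det (matrix f :: real^3^3) = tri (f (axis 1 1)) (f (axis 2 1)) (f (axis 3 1))"
proof -
  have "transpose (matrix f :: real^3^3) = vector [f (axis 1 1), f (axis 2 1), f (axis 3 1)]"
    by (simp add: vec_eq_iff forall_3 transpose_def matrix_def)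
  then show ?thesis by (metis det_transpose)
qed

text \<open>The integral of a form is a gauge integral over a Borel piece, whereas Fubini is applied
  to nonnegative Lebesgue integrals over the whole plane.\<close>

lemma abs_integrable_restrict:
  fixes f :: "'a::euclidean_space \<Rightarrow> real"
  assumes A: "A \<in> sets borel" and f: "continuous_on A f" "\<And>x. x \<in> A \<Longrightarrow> f x \<ge> 0" and int: "f absolutely_integrable_on A"
  shows "(\<integral>\<^sup>+x. ennreal (indicator A x * f x) \<partial>lborel) = ennreal (integral A f)"
proof -
  have m: "(\<lambda>x. indicator A x * f x) \<in> borel_measurable borel"
    using borel_measurable_continuous_on_indicator[OF A f(1)] by simp
  have "integrable lebesgue (\<lambda>x. indicator A x * f x)" using int by (simp add: set_integrable_def)
  then have "(\<integral>\<^sup>+x. ennreal (indicator A x * f x) \<partial>lebesgue) = ennreal (\<integral>x. indicator A x * f x \<partial>lebesgue)"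
    by (intro nn_integral_eq_integral) (use f(2) in \<open>auto simp: indicator_def\<close>)
  also have "(\<integral>x. indicator A x * f x \<partial>lebesgue) = integral A f"
    using set_lebesgue_integral_eq_integral(2)[OF int] by (simp add: set_lebesgue_integral_def)
  finally show ?thesis by (simp add: nn_integral_completion)
qed

lemma nn_integral_segment:
  assumes "h > 0" "w \<ge> 0"
  shows "(\<integral>\<^sup>+t. ennreal (w * (1 - t * h)\<^sup>2) * indicator {0..1 / h} t \<partial>lborel) = ennreal (w / h / 3)"
proof -
  let ?F = "\<lambda>t. - (w / h / 3) * (1 - t * h) ^ 3"
  have "(\<integral>\<^sup>+t. ennreal (w * (1 - t * h)\<^sup>2) * indicator {0..1 / h} t \<partial>lborel) = ennreal (?F (1 / h) - ?F 0)"
  proof (rule nn_integral_FTC_Icc)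
    show "(?F has_real_derivative w * (1 - t * h)\<^sup>2) (at t)" for t
      using assms(1) by (auto intro!: derivative_eq_intros simp: field_simps power2_eq_square)
  qed (use assms in auto)
  then show ?thesis using assms(1) by simp
qed

lemma nn_integral_cone:
  assumes "w \<ge> 0"
  shows "(\<integral>\<^sup>+t. ennreal (w * t\<^sup>2) * indicator {0<..<1} t \<partial>lborel) = ennreal (w / 3)"
proof -
  let ?F = "\<lambda>t. w / 3 * t ^ 3"
  have "(\<integral>\<^sup>+t. ennreal (w * t\<^sup>2) * indicator {0<..<1} t \<partial>lborel) = (\<integral>\<^sup>+t. ennreal (w * t\<^sup>2) * indicator {0..1} t \<partial>lborel)"
  proof (rule nn_integral_cong_AE)
    have "AE t in lborel. t \<noteq> (1::real)" "AE t in lborel. t \<noteq> (0::real)" by (simp_all add: AE_lborel_singleton)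
    then show "AE t in lborel. ennreal (w * t\<^sup>2) * indicator {0<..<1} t = ennreal (w * t\<^sup>2) * indicator {0..1} t"
      by eventually_elim (auto simp: indicator_def)
  qed
  also have "\<dots> = ennreal (?F 1 - ?F 0)"
  proof (rule nn_integral_FTC_Icc)
    show "(?F has_real_derivative w * t\<^sup>2) (at t)" for t
      by (auto intro!: derivative_eq_intros simp: field_simps power2_eq_square)
  qed (use assms in auto)
  finally show ?thesis by simp
qed


text \<open>The two volume computations share this shape: over each \<open>u\<close> the integrand
  along a segment integrates to one third of the density of the form. It serves the normal flow with
  \<open>(1 - tH)^2\<close> and the cones over a sphere with \<open>t^2\<close>.\<close>

lemma integral_segments:
  fixes f :: "real^2 \<Rightarrow> real" and g :: "real^3 \<Rightarrow> real"
  assumes A: "A \<in> sets borel" and f: "continuous_on A f" "\<And>x. x \<in> A \<Longrightarrow> f x \<ge> 0" "f absolutely_integrable_on A"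
    and g: "g \<in> borel_measurable borel" "\<And>z. g z \<ge> 0"
    and inner: "\<And>u. (\<integral>\<^sup>+t. ennreal (g (emb3 u t)) \<partial>lborel) = ennreal (1/3) * ennreal (indicator A u * f u)"
  shows "integrable lborel g" "(\<integral>z. g z \<partial>lborel) = integral A f / 3"
proof -
  have m: "(\<lambda>u. indicator A u * f u) \<in> borel_measurable borel"
    using borel_measurable_continuous_on_indicator[OF A f(1)] by simp
  have I0: "0 \<le> integral A f"
    by (rule Henstock_Kurzweil_Integration.integral_nonneg[OF set_lebesgue_integral_eq_integral(1)[OF f(3)] f(2)])
  have "(\<integral>\<^sup>+z. ennreal (g z) \<partial>lborel) = (\<integral>\<^sup>+u. ennreal (1/3) * ennreal (indicator A u * f u) \<partial>lborel)"
    using g(1) by (subst nn_integral_emb3) (simp_all add: inner)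
  also have "\<dots> = ennreal (1/3) * (\<integral>\<^sup>+u. ennreal (indicator A u * f u) \<partial>lborel)"
    using m by (intro nn_integral_cmult) simp
  finally have nn: "(\<integral>\<^sup>+z. ennreal (g z) \<partial>lborel) = ennreal (integral A f / 3)"
    using I0 by (simp add: abs_integrable_restrict[OF A f] ennreal_mult[symmetric])
  show i: "integrable lborel g"
    by (rule integrableI_nn_integral_finite[OF _ _ nn]) (use g in simp_all)
  show "(\<integral>z. g z \<partial>lborel) = integral A f / 3"
    using nn_integral_eq_integral[OF i] g(2) nn I0 by (simp add: integral_nonneg_AE)
qed

lemma continuous_on_tri:
  assumes "continuous_on S f" "continuous_on S g" "continuous_on S h"
  shows "continuous_on S (\<lambda>x. tri (f x) (g x) (h x))"
  unfolding det_3 vector_3 using assms by (intro continuous_intros)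

lemma measurable_proj2 [measurable]: "proj2 \<in> borel_measurable borel"
  by (rule borel_measurable_continuous_onI[OF linear_continuous_on[OF bounded_linear_proj2]])

lemma measurable_nth3 [measurable]: "(\<lambda>z::real^3. z $ i) \<in> borel_measurable borel"
  by (rule borel_measurable_continuous_onI) (intro continuous_intros)

definition flow :: "(real^3 \<Rightarrow> real^3) \<Rightarrow> (real^2 \<Rightarrow> real^3) \<Rightarrow> real^3 \<Rightarrow> real^3" where
  "flow \<eta> \<phi> z = \<phi> (proj2 z) - z $ 3 *\<^sub>R \<eta> (\<phi> (proj2 z))"

context minkowski_surface
begin

text \<open>The two inequalities say that \<open>1 - t k \<ge> 0\<close> for both principal curvatures \<open>k\<close>, that is, the
  normal segment has not passed its first focal point.\<close>

definition focal_region :: "(real^2) set \<Rightarrow> (real^2 \<Rightarrow> real^3) \<Rightarrow> (real^3) set" where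
  "focal_region A \<phi> = {z. proj2 z \<in> A \<and> 0 \<le> z $ 3 \<and> z $ 3 * Hm (\<phi> (proj2 z)) \<le> 1 \<and>
     0 \<le> 1 - 2 * z $ 3 * Hm (\<phi> (proj2 z)) + (z $ 3)\<^sup>2 * gauss_curv \<phi> (proj2 z)}"

context
  fixes U \<phi> assumes lp: "local_param M U \<phi>"
begin

lemma continuous_chart: "continuous_on U \<phi>" "continuous_on U (\<lambda>u. \<eta> (\<phi> u))"
  "continuous_on U (\<lambda>u. fder \<phi> u v)" "continuous_on U (\<lambda>u. fder (\<eta> \<circ> \<phi>) u v)"
  using smooth_on_continuous[OF local_paramD(2)[OF lp]] smooth_on_continuous[OF normal_smooth[OF lp]]
    smooth_on_continuous_frechet[OF local_paramD(2)[OF lp]] smooth_on_continuous_frechet[OF normal_smooth[OF lp]]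
  by (simp_all add: o_def)

lemma continuous_area_dens: "continuous_on U (area_dens \<phi>)"
  unfolding area_dens_def[abs_def] by (intro continuous_on_tri continuous_chart)

lemma continuous_gauss_curv: "continuous_on U (gauss_curv \<phi>)"
  unfolding gauss_curv_def[abs_def]
  by (intro continuous_on_divide continuous_on_tri continuous_chart continuous_area_dens)
    (use area_dens_nonzero[OF lp] in blast)

lemma continuous_mean_curvature: "continuous_on U (\<lambda>u. Hm (\<phi> u))"
proof -
  have "continuous_on U (\<lambda>u. (tri (fder (\<eta> \<circ> \<phi>) u (axis 1 1)) (fder \<phi> u (axis 2 1)) (\<eta> (\<phi> u)) +
    tri (fder \<phi> u (axis 1 1)) (fder (\<eta> \<circ> \<phi>) u (axis 2 1)) (\<eta> (\<phi> u))) / (2 * area_dens \<phi> u))"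
    by (intro continuous_on_divide continuous_on_add continuous_on_tri continuous_chart continuous_on_mult
        continuous_area_dens continuous_on_const) (use area_dens_nonzero[OF lp] in auto)
  then show ?thesis
    by (rule continuous_on_eq) (simp add: mean_curvature_formula[OF lp, symmetric] area_dens_nonzero[OF lp])
qed

lemma flow_derivative:
  assumes u: "proj2 z \<in> U"
  defines "f' \<equiv> \<lambda>h. fder \<phi> (proj2 z) (proj2 h) -
    (z $ 3 *\<^sub>R fder (\<eta> \<circ> \<phi>) (proj2 z) (proj2 h) + h $ 3 *\<^sub>R (\<eta> \<circ> \<phi>) (proj2 z))"
  shows "(flow \<eta> \<phi> has_derivative f') (at z)"
    and "det (matrix f' :: real^3^3) = - (area_dens \<phi> (proj2 z) *
      (1 - 2 * z $ 3 * Hm (\<phi> (proj2 z)) + (z $ 3)\<^sup>2 * gauss_curv \<phi> (proj2 z)))"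
proof -
  have p: "(proj2 has_derivative proj2) (at z)"
    by (rule bounded_linear_imp_has_derivative[OF bounded_linear_proj2])
  have 3: "((\<lambda>z::real^3. z $ 3) has_derivative (\<lambda>h. h $ 3)) (at z)"
    by (rule bounded_linear_imp_has_derivative[OF bounded_linear_vec_nth])
  have "((\<lambda>z. \<phi> (proj2 z) - z $ 3 *\<^sub>R (\<eta> \<circ> \<phi>) (proj2 z)) has_derivative f') (at z)"
    unfolding f'_def
    by (rule has_derivative_diff[OF has_derivative_compose[OF p local_param_deriv(1)[OF lp u]]
          has_derivative_scaleR[OF 3 has_derivative_compose[OF p normal_derivative[OF lp u]]]])
  then show "(flow \<eta> \<phi> has_derivative f') (at z)"
    by (simp add: flow_def[abs_def])
  have ax: "axis 1 1 $ (3::3) = (0::real)" "axis 2 1 $ (3::3) = (0::real)" "axis 3 1 $ (3::3) = (1::real)"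
    by (simp_all add: axis_def)
  have "fder \<phi> (proj2 z) 0 = 0" "fder (\<eta> \<circ> \<phi>) (proj2 z) 0 = 0"
    by (rule linear_0[OF local_param_deriv(2)[OF lp u]], rule linear_0[OF normal_linear[OF lp u]])
  then show "det (matrix f' :: real^3^3) = - (area_dens \<phi> (proj2 z) *
      (1 - 2 * z $ 3 * Hm (\<phi> (proj2 z)) + (z $ 3)\<^sup>2 * gauss_curv \<phi> (proj2 z)))"
    unfolding matrix_det_columns f'_def normal_flow_det[OF lp u, symmetric] by (simp add: ax)
qed

context
  fixes A assumes A: "A \<in> sets borel" "A \<subseteq> U" and W: "\<And>u. u \<in> U \<Longrightarrow> area_dens \<phi> u > 0"
    and H: "\<And>p. p \<in> M \<Longrightarrow> Hm p > 0"
    and int: "(\<lambda>u. area_dens \<phi> u / Hm (\<phi> u)) absolutely_integrable_on A"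
begin

text \<open>The volume of the image is at most the integral of the Jacobian \<open>G\<close>, and
  \<open>G\<close> is at most \<open>q\<close>, which lives on the full segments up to
  \<open>1/H\<close> and integrates to \<open>I / 3\<close>. Equality forces \<open>G = q\<close>
  almost everywhere; over a point with \<open>K \<noteq> H^2\<close> this fails on a whole open
  segment, so by Fubini such points form a null set.\<close>

lemma flow_volume:
  defines "I \<equiv> integral A (\<lambda>u. area_dens \<phi> u / Hm (\<phi> u))"
  shows "flow \<eta> \<phi> ` focal_region A \<phi> \<in> lmeasurable"
    and "measure lebesgue (flow \<eta> \<phi> ` focal_region A \<phi>) \<le> I / 3"
    and "measure lebesgue (flow \<eta> \<phi> ` focal_region A \<phi>) = I / 3 \<Longrightarrow>
      negligible {u \<in> A. gauss_curv \<phi> u \<noteq> (Hm (\<phi> u))\<^sup>2}"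
proof -
  note [measurable] = A(1)
  \<comment> \<open>The densities are continuous on \<open>U\<close> only. Cut off to
    \<open>A\<close> they are Borel on the whole plane, and the sets and integrands below become
    measurable.\<close>
  define WA HA KA where "WA = (\<lambda>u. indicator A u * area_dens \<phi> u)"
    and "HA = (\<lambda>u. indicator A u * Hm (\<phi> u))" and "KA = (\<lambda>u. indicator A u * gauss_curv \<phi> u)"
  have ind: "(\<lambda>u. indicator A u * f u) \<in> borel_measurable borel" if "continuous_on U f" for f :: "real^2 \<Rightarrow> real"
    using borel_measurable_continuous_on_indicator[OF A(1) continuous_on_subset[OF that A(2)]] by simp
  have mW [measurable]: "WA \<in> borel_measurable borel" unfolding WA_def by (rule ind[OF continuous_area_dens])
  have mH [measurable]: "HA \<in> borel_measurable borel" unfolding HA_def by (rule ind[OF continuous_mean_curvature])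
  have mK [measurable]: "KA \<in> borel_measurable borel" unfolding KA_def by (rule ind[OF continuous_gauss_curv])
  have onA: "WA u = area_dens \<phi> u" "HA u = Hm (\<phi> u)" "KA u = gauss_curv \<phi> u"
    "WA u > 0" "HA u > 0" "KA u \<le> (HA u)\<^sup>2" if "u \<in> A" for u
    using that A(2) W H[OF chart_mem[OF lp]] gauss_curv_le[OF lp] by (auto simp: WA_def HA_def KA_def)
  define E where "E = focal_region A \<phi>"
  have Eeq: "E = {z. proj2 z \<in> A \<and> 0 \<le> z $ 3 \<and> z $ 3 * HA (proj2 z) \<le> 1 \<and>
      0 \<le> 1 - 2 * z $ 3 * HA (proj2 z) + (z $ 3)\<^sup>2 * KA (proj2 z)}"
    unfolding E_def focal_region_def using onA by auto
  have "{z \<in> space borel. proj2 z \<in> A \<and> 0 \<le> z $ 3 \<and> z $ 3 * HA (proj2 z) \<le> 1 \<and>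
      0 \<le> 1 - 2 * z $ 3 * HA (proj2 z) + (z $ 3)\<^sup>2 * KA (proj2 z)} \<in> sets borel" by measurable
  then have E [measurable]: "E \<in> sets borel" by (simp add: Eeq)
  define R where "R = {z. proj2 z \<in> A \<and> 0 \<le> z $ 3 \<and> z $ 3 * HA (proj2 z) \<le> 1}"
  have "{z \<in> space borel. proj2 z \<in> A \<and> 0 \<le> z $ 3 \<and> z $ 3 * HA (proj2 z) \<le> 1} \<in> sets borel" by measurable
  then have R [measurable]: "R \<in> sets borel" by (simp add: R_def)
  define q where "q = (\<lambda>z. indicator R z * (WA (proj2 z) * (1 - z $ 3 * HA (proj2 z))\<^sup>2))"
  define G where "G = (\<lambda>z. indicator E z * (WA (proj2 z) * (1 - 2 * z $ 3 * HA (proj2 z) + (z $ 3)\<^sup>2 * KA (proj2 z))))"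
  have [measurable]: "q \<in> borel_measurable borel" unfolding q_def by measurable
  have [measurable]: "G \<in> borel_measurable borel" unfolding G_def by measurable
  have ER: "E \<subseteq> R" unfolding Eeq R_def by auto
  have RA: "proj2 z \<in> A" if "z \<in> R" for z using that by (simp add: R_def)
  have q0: "0 \<le> q z" for z
    using onA(4)[OF RA, of z] by (auto simp: q_def indicator_def)
  have G0: "0 \<le> G z" for z
    using onA(4)[OF RA, of z] ER by (auto simp: G_def indicator_def Eeq)
  have sq: "(1 - z $ 3 * HA (proj2 z))\<^sup>2 - (1 - 2 * z $ 3 * HA (proj2 z) + (z $ 3)\<^sup>2 * KA (proj2 z)) =
      (z $ 3)\<^sup>2 * ((HA (proj2 z))\<^sup>2 - KA (proj2 z))" for z
    by (simp add: algebra_simps power2_eq_square)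
  have Gq: "G z \<le> q z" for z
  proof (cases "z \<in> E")
    case True
    then have a: "proj2 z \<in> A" and zR: "z \<in> R" using ER RA by auto
    have "0 \<le> (z $ 3)\<^sup>2 * ((HA (proj2 z))\<^sup>2 - KA (proj2 z))"
      using onA(6)[OF a] by (intro mult_nonneg_nonneg) auto
    then have "1 - 2 * z $ 3 * HA (proj2 z) + (z $ 3)\<^sup>2 * KA (proj2 z) \<le> (1 - z $ 3 * HA (proj2 z))\<^sup>2"
      unfolding sq[symmetric] by simp
    then show ?thesis using True zR onA(4)[OF a] by (simp add: G_def q_def)
  qed (use q0 in \<open>simp add: G_def\<close>)
  have cf: "continuous_on A (\<lambda>u. area_dens \<phi> u / Hm (\<phi> u))"
    by (rule continuous_on_subset[OF _ A(2)], intro continuous_on_divide continuous_area_dens continuous_mean_curvature)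
      (use H[OF chart_mem[OF lp]] in force)
  have f0: "0 \<le> area_dens \<phi> u / Hm (\<phi> u)" if "u \<in> A" for u
    using onA(4,5)[OF that] unfolding onA(1,2)[OF that] by simp
  have inner: "(\<integral>\<^sup>+t. ennreal (q (emb3 u t)) \<partial>lborel) =
      ennreal (1/3) * ennreal (indicator A u * (area_dens \<phi> u / Hm (\<phi> u)))" for u
  proof (cases "u \<in> A")
    case True
    note a = onA[OF True]
    have "(\<integral>\<^sup>+t. ennreal (q (emb3 u t)) \<partial>lborel) =
        (\<integral>\<^sup>+t. ennreal (WA u * (1 - t * HA u)\<^sup>2) * indicator {0..1 / HA u} t \<partial>lborel)"
      using True a(5) by (intro nn_integral_cong) (auto simp: q_def R_def indicator_def pos_le_divide_eq)
    also have "\<dots> = ennreal (WA u / HA u / 3)" using a by (intro nn_integral_segment) auto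
    finally show ?thesis using True a by (simp add: ennreal_mult[symmetric])
  next
    case False
    then show ?thesis by (simp add: q_def R_def indicator_def)
  qed
  have qm: "q \<in> borel_measurable borel" by measurable
  note seg = integral_segments[OF A(1) cf f0 int qm q0 inner]
  have iq: "integrable lborel q" by (rule seg(1))
  have Iq: "(\<integral>z. q z \<partial>lborel) = I / 3" unfolding I_def by (rule seg(2))
  have iG: "integrable lborel G"
    by (rule Bochner_Integration.integrable_bound[OF iq]) (use q0 G0 Gq in auto)
  define f' where "f' = (\<lambda>z h. fder \<phi> (proj2 z) (proj2 h) -
    (z $ 3 *\<^sub>R fder (\<eta> \<circ> \<phi>) (proj2 z) (proj2 h) + h $ 3 *\<^sub>R (\<eta> \<circ> \<phi>) (proj2 z)))"
  have EU: "proj2 z \<in> U" "proj2 z \<in> A" if "z \<in> E" for z using that A(2) by (auto simp: Eeq)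
  have detE: "\<bar>det (matrix (f' z) :: real^3^3)\<bar> = G z" if "z \<in> E" for z
    using flow_derivative(2)[OF EU(1)[OF that]] onA[OF EU(2)[OF that]] that
    by (simp add: G_def f'_def abs_mult) (simp add: Eeq)
  have dE: "(flow \<eta> \<phi> has_derivative f' z) (at z within E)" if "z \<in> E" for z
    unfolding f'_def by (rule has_derivative_at_withinI[OF flow_derivative(1)[OF EU(1)[OF that]]])
  have "(G has_integral (\<integral>z. G z \<partial>lborel)) UNIV" by (rule has_integral_integral_lborel[OF iG])
  moreover have "G = (\<lambda>z. if z \<in> E then \<bar>det (matrix (f' z) :: real^3^3)\<bar> else 0)"
    by (auto simp: detE fun_eq_iff) (simp add: G_def)
  ultimately have hi: "((\<lambda>z. \<bar>det (matrix (f' z) :: real^3^3)\<bar>) has_integral (\<integral>z. G z \<partial>lborel)) E"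
    using has_integral_restrict_UNIV[of E "\<lambda>z. \<bar>det (matrix (f' z) :: real^3^3)\<bar>"] by simp
  have Es: "E \<in> sets lebesgue" using E by simp
  show "flow \<eta> \<phi> ` focal_region A \<phi> \<in> lmeasurable"
    unfolding E_def[symmetric] by (rule measurable_differentiable_image[OF Es dE]) (use hi in blast)+
  have mE: "measure lebesgue (flow \<eta> \<phi> ` E) \<le> (\<integral>z. G z \<partial>lborel)"
    using measure_differentiable_image[OF Es dE has_integral_integrable[OF hi]] hi by (simp add: integral_unique)
  have GI: "(\<integral>z. G z \<partial>lborel) \<le> I / 3"
    unfolding Iq[symmetric] by (rule integral_mono[OF iG iq Gq])
  then show "measure lebesgue (flow \<eta> \<phi> ` focal_region A \<phi>) \<le> I / 3"
    using mE unfolding E_def by simp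
  assume "measure lebesgue (flow \<eta> \<phi> ` focal_region A \<phi>) = I / 3"
  then have "(\<integral>z. G z \<partial>lborel) = (\<integral>z. q z \<partial>lborel)" using mE GI unfolding E_def Iq by simp
  then have "(\<integral>z. q z - G z \<partial>lborel) = 0" using iq iG by simp
  then have ae: "AE z in lborel. q z - G z = 0"
    using integral_nonneg_eq_0_iff_AE[of lborel "\<lambda>z. q z - G z"] iq iG Gq by simp
  define Z where "Z = {u \<in> A. KA u \<noteq> (HA u)\<^sup>2}"
  have "{u \<in> space borel. u \<in> A \<and> KA u \<noteq> (HA u)\<^sup>2} \<in> sets borel" by measurable
  then have Z [measurable]: "Z \<in> sets borel" by (simp add: Z_def)
  \<comment> \<open>Both ends of the segment are excluded: at height 0 the two integrands agree, and
    at height \<open>1/H\<close> the larger one vanishes. In between they differ, also beyond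
    \<open>E\<close>, where \<open>G\<close> is 0 and \<open>q\<close> is positive.\<close>
  define B where "B = {z. proj2 z \<in> Z \<and> 0 < z $ 3 \<and> z $ 3 * HA (proj2 z) < 1}"
  have "{z \<in> space borel. proj2 z \<in> Z \<and> 0 < z $ 3 \<and> z $ 3 * HA (proj2 z) < 1} \<in> sets borel" by measurable
  then have B [measurable]: "B \<in> sets borel" by (simp add: B_def)
  have "q z - G z \<noteq> 0" if "z \<in> B" for z
  proof -
    have a: "proj2 z \<in> A" "KA (proj2 z) \<noteq> (HA (proj2 z))\<^sup>2" "0 < z $ 3" "z $ 3 * HA (proj2 z) < 1"
      using that by (auto simp: B_def Z_def)
    then have "z \<in> R" by (auto simp: R_def)
    then have qz: "q z = WA (proj2 z) * (1 - z $ 3 * HA (proj2 z))\<^sup>2" by (simp add: q_def)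
    show ?thesis
    proof (cases "z \<in> E")
      case True
      then have "q z - G z = WA (proj2 z) * ((z $ 3)\<^sup>2 * ((HA (proj2 z))\<^sup>2 - KA (proj2 z)))"
        unfolding sq[symmetric] by (simp add: qz G_def right_diff_distrib)
      then show ?thesis using a onA(4)[OF a(1)] by auto
    next
      case False
      then show ?thesis using a onA(4)[OF a(1)] by (simp add: qz G_def)
    qed
  qed
  with ae have "AE z in lborel. z \<notin> B" by (auto elim: eventually_mono)
  then have "(\<integral>\<^sup>+z. indicator B z \<partial>lborel) = (0::ennreal)"
    by (subst nn_integral_0_iff_AE) (auto elim!: eventually_mono)
  moreover have "(\<integral>\<^sup>+z. indicator B z \<partial>lborel) = (\<integral>\<^sup>+u. \<integral>\<^sup>+t. indicator B (emb3 u t) \<partial>lborel \<partial>lborel)"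
    by (rule nn_integral_emb3) simp
  moreover have "(\<integral>\<^sup>+t. indicator B (emb3 u t) \<partial>lborel) = indicator Z u * ennreal (1 / HA u)" for u
  proof (cases "u \<in> Z")
    case True
    then have h: "HA u > 0" using onA(5) by (auto simp: Z_def)
    have "(\<integral>\<^sup>+t. indicator B (emb3 u t) \<partial>lborel) = (\<integral>\<^sup>+t. indicator {0<..<1 / HA u} t \<partial>lborel)"
      using True h by (intro nn_integral_cong) (auto simp: B_def indicator_def pos_less_divide_eq)
    also have "\<dots> = ennreal (1 / HA u)" using h by simp
    finally show ?thesis using True by simp
  qed (simp add: B_def indicator_def)
  ultimately have "(\<integral>\<^sup>+u. indicator Z u * ennreal (1 / HA u) \<partial>lborel) = 0" by simp
  then have "AE u in lborel. indicator Z u * ennreal (1 / HA u) = 0"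
    by (subst (asm) nn_integral_0_iff_AE) simp_all
  then have "AE u in lborel. u \<notin> Z"
  proof eventually_elim
    case (elim u)
    then show ?case using onA(5)[of u] by (auto simp: Z_def indicator_def)
  qed
  then have "Z \<in> null_sets lborel" using AE_iff_null_sets[of Z lborel] by simp
  then have "negligible Z" by (simp add: negligible_iff_null_sets null_sets_completionI)
  moreover have "Z = {u \<in> A. gauss_curv \<phi> u \<noteq> (Hm (\<phi> u))\<^sup>2}" unfolding Z_def using onA by auto
  ultimately show "negligible {u \<in> A. gauss_curv \<phi> u \<noteq> (Hm (\<phi> u))\<^sup>2}" by simp
qed

end

end

end

section \<open>The inequality\<close>

locale closed_minkowski_surface = minkowski_surface N M \<eta> for N M \<eta> +
  assumes compact: "compact M" and connected: "connected M" and nonempty: "M \<noteq> {}"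
    and outward: "outward_pointing M \<eta>" and Hpos: "\<And>p. p \<in> M \<Longrightarrow> Hm p > 0"
begin

definition \<beta> :: "real^3 \<Rightarrow> real^3 \<Rightarrow> real^3 \<Rightarrow> real" where
  "\<beta> p X Y = 1 / Hm p * area_form \<eta> p X Y"

lemma pullback_\<beta>: "pullback \<beta> \<phi> = (\<lambda>u. area_dens \<phi> u / Hm (\<phi> u))"
  by (simp add: fun_eq_iff pullback_def \<beta>_def area_form_def area_dens_def)

lemma pullback_area_form: "pullback (area_form \<eta>) \<phi> = area_dens \<phi>"
  by (simp add: fun_eq_iff pullback_def area_form_def area_dens_def)

lemma oriented_paramD:
  assumes "oriented_param M (area_form \<eta>) U \<phi>"
  shows "local_param M U \<phi>" "\<And>u. u \<in> U \<Longrightarrow> area_dens \<phi> u > 0"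
  using assms by (auto simp: oriented_param_def pullback_area_form)

lemma continuous_pullback_\<beta>:
  assumes "local_param M U \<phi>" shows "continuous_on U (pullback \<beta> \<phi>)"
  unfolding pullback_\<beta>
proof (intro continuous_on_divide continuous_area_dens[OF assms] continuous_mean_curvature[OF assms] ballI)
  show "Hm (\<phi> u) \<noteq> 0" if "u \<in> U" for u using Hpos[OF chart_mem[OF assms that]] by simp
qed

text \<open>The chart-free form of \<open>K = H^2\<close>. \<open>gauss_curv\<close> belongs to a
  chart, and the exceptional sets of different charts have to be compared.\<close>

definition umbilic_at :: "real^3 \<Rightarrow> bool" where
  "umbilic_at p \<longleftrightarrow> (\<forall>v\<in>tangent_space M p. surface_differential M \<eta> p v = Hm p *\<^sub>R v)"

lemma umbilic_at_iff:
  assumes lp: "local_param M U \<phi>" and u: "u \<in> U"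
  shows "umbilic_at (\<phi> u) \<longleftrightarrow> gauss_curv \<phi> u = (Hm (\<phi> u))\<^sup>2"
proof
  assume "umbilic_at (\<phi> u)"
  then have e: "fder (\<eta> \<circ> \<phi>) u v = Hm (\<phi> u) *\<^sub>R fder \<phi> u v" for v
    using surface_differential_chart[OF lp eta_smooth u, of v] tangent_space_chart[OF lp u]
    by (auto simp: umbilic_at_def)
  show "gauss_curv \<phi> u = (Hm (\<phi> u))\<^sup>2"
    using tri_lin[of "Hm (\<phi> u)" "fder \<phi> u (axis 1 1)" 0 "fder \<phi> u (axis 2 1)" 0 "Hm (\<phi> u)" "\<eta> (\<phi> u)"]
      area_dens_nonzero[OF lp u]
    by (simp add: gauss_curv_def e area_dens_def[symmetric] power2_eq_square)
next
  assume "gauss_curv \<phi> u = (Hm (\<phi> u))\<^sup>2"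
  from umbilic[OF lp u this] show "umbilic_at (\<phi> u)"
    using surface_differential_chart[OF lp eta_smooth u] tangent_space_chart[OF lp u]
    by (auto simp: umbilic_at_def)
qed

context
  fixes n :: nat and U \<phi> A
  assumes par: "\<And>i. i < n \<Longrightarrow> oriented_param M (area_form \<eta>) (U i) (\<phi> i)"
    and A: "\<And>i. i < n \<Longrightarrow> A i \<in> sets borel" "\<And>i. i < n \<Longrightarrow> A i \<subseteq> U i"
    and int: "\<And>i. i < n \<Longrightarrow> pullback \<beta> (\<phi> i) absolutely_integrable_on A i"
    and cover: "(\<Union>i<n. \<phi> i ` A i) = M"
begin

lemma piece_param: "i < n \<Longrightarrow> local_param M (U i) (\<phi> i)" and piece_positive: "i < n \<Longrightarrow> u \<in> U i \<Longrightarrow> area_dens (\<phi> i) u > 0"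
  using oriented_paramD[OF par] by blast+

lemma piece_volume:
  assumes i: "i < n"
  shows "flow \<eta> (\<phi> i) ` focal_region (A i) (\<phi> i) \<in> lmeasurable"
    and "measure lebesgue (flow \<eta> (\<phi> i) ` focal_region (A i) (\<phi> i)) \<le> integral (A i) (pullback \<beta> (\<phi> i)) / 3"
    and "measure lebesgue (flow \<eta> (\<phi> i) ` focal_region (A i) (\<phi> i)) = integral (A i) (pullback \<beta> (\<phi> i)) / 3 \<Longrightarrow>
      negligible {u \<in> A i. gauss_curv (\<phi> i) u \<noteq> (Hm (\<phi> i u))\<^sup>2}"
  using flow_volume[OF piece_param[OF i] A[OF i] piece_positive[OF i] Hpos int[OF i, unfolded pullback_\<beta>]] unfolding pullback_\<beta>
  by blast+

lemma inside_covered: "inside M \<subseteq> (\<Union>i<n. flow \<eta> (\<phi> i) ` focal_region (A i) (\<phi> i))"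
proof
  fix x assume "x \<in> inside M"
  then obtain p t where p: "p \<in> M" "t > 0" "x = p - t *\<^sub>R \<eta> p" "\<And>q. q \<in> M \<Longrightarrow> t \<le> N (q - x)"
    using nearest_point[OF compact outward] by blast
  then obtain i u where i: "i < n" "u \<in> A i" "p = \<phi> i u" using cover by blast
  \<comment> \<open>The variation of the distance takes place in the open domain \<open>U i\<close>;
    the Borel piece \<open>A i\<close> only records which part of the flow contains
    \<open>x\<close>.\<close>
  have u: "u \<in> U i" using i A(2) by blast
  have x: "x = \<phi> i u - t *\<^sub>R \<eta> (\<phi> i u)" using p(3) i(3) by simp
  have min: "\<And>v. v \<in> U i \<Longrightarrow> t \<le> N (\<phi> i v - x)" using p(4) chart_mem[OF piece_param[OF i(1)]] by blast
  note nearest_point_second_order[OF piece_param[OF i(1)] u p(2) x min]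
  then have "emb3 u t \<in> focal_region (A i) (\<phi> i)"
    using i(2) p(2) by (simp add: focal_region_def)
  moreover have "flow \<eta> (\<phi> i) (emb3 u t) = x" by (simp add: flow_def x)
  ultimately show "x \<in> (\<Union>i<n. flow \<eta> (\<phi> i) ` focal_region (A i) (\<phi> i))"
    using i(1) by blast
qed

text \<open>The volume of the region is at most the sum of the volumes of the images, each bounded
  by its share of \<open>J / 3\<close>. If the totals agree, every single bound is attained, and so
  each piece is umbilic up to a null set.\<close>

lemma heintze_karcher:
  defines "J \<equiv> \<Sum>i<n. integral (A i) (pullback \<beta> (\<phi> i))"
  shows "3 * measure lebesgue (inside M) \<le> J"
    and "J = 3 * measure lebesgue (inside M) \<Longrightarrow> p \<in> M \<Longrightarrow> umbilic_at p"
proof -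
  define R where "R = (\<lambda>i. flow \<eta> (\<phi> i) ` focal_region (A i) (\<phi> i))"
  have R: "R i \<in> lmeasurable" "measure lebesgue (R i) \<le> integral (A i) (pullback \<beta> (\<phi> i)) / 3" if "i < n" for i
    using piece_volume[OF that] by (simp_all add: R_def)
  have "inside M \<in> sets lebesgue"
    using open_inside[OF compact_imp_closed[OF compact]] by (simp add: borel_open)
  moreover have "(\<Union>i<n. R i) \<in> lmeasurable" by (rule fmeasurable.finite_UN) (use R in auto)
  ultimately have "measure lebesgue (inside M) \<le> measure lebesgue (\<Union>i<n. R i)"
    using inside_covered by (intro measure_mono_fmeasurable) (simp_all add: R_def)
  also have "\<dots> \<le> (\<Sum>i<n. measure lebesgue (R i))"
    by (rule measure_UNION_le) (use R in \<open>auto simp: fmeasurableD\<close>)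
  finally have 1: "measure lebesgue (inside M) \<le> (\<Sum>i<n. measure lebesgue (R i))" .
  have 2: "(\<Sum>i<n. measure lebesgue (R i)) \<le> (\<Sum>i<n. integral (A i) (pullback \<beta> (\<phi> i)) / 3)"
    by (rule sum_mono) (use R in auto)
  have 3: "(\<Sum>i<n. integral (A i) (pullback \<beta> (\<phi> i)) / 3) = J / 3"
    by (simp add: J_def sum_divide_distrib)
  show "3 * measure lebesgue (inside M) \<le> J" using 1 2 3 by simp
  assume eq: "J = 3 * measure lebesgue (inside M)" and p: "p \<in> M"
  have le: "(\<Sum>i<n. integral (A i) (pullback \<beta> (\<phi> i)) / 3 - measure lebesgue (R i)) \<le> 0"
    unfolding sum_subtractf using 1 3 eq by simp
  have nn: "0 \<le> integral (A i) (pullback \<beta> (\<phi> i)) / 3 - measure lebesgue (R i)" if "i \<in> {..<n}" for i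
    using R(2)[of i] that by simp
  have "0 \<le> (\<Sum>i<n. integral (A i) (pullback \<beta> (\<phi> i)) / 3 - measure lebesgue (R i))"
    by (rule sum_nonneg[OF nn])
  with le have "(\<Sum>i<n. integral (A i) (pullback \<beta> (\<phi> i)) / 3 - measure lebesgue (R i)) = 0"
    by (rule antisym)
  then have "\<forall>i\<in>{..<n}. integral (A i) (pullback \<beta> (\<phi> i)) / 3 - measure lebesgue (R i) = 0"
    using sum_nonneg_eq_0_iff[of "{..<n}" "\<lambda>i. integral (A i) (pullback \<beta> (\<phi> i)) / 3 - measure lebesgue (R i)"] nn
    by blast
  then have neg: "negligible {u \<in> A i. gauss_curv (\<phi> i) u \<noteq> (Hm (\<phi> i u))\<^sup>2}" if "i < n" for i
    using that by (intro piece_volume(3)) (auto simp: R_def)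
  obtain V \<theta> v where \<theta>: "local_param M V \<theta>" "v \<in> V" "p = \<theta> v"
    using reg p unfolding regular_surface_def by blast
  let ?Z = "\<lambda>i. {u \<in> A i. gauss_curv (\<phi> i) u \<noteq> (Hm (\<phi> i u))\<^sup>2}"
  \<comment> \<open>In a chart around \<open>p\<close> the exceptional set is open by continuity,
    and it is null because it is covered by the transported null sets of the finitely many
    pieces.\<close>
  define Q where "Q = {u \<in> V. gauss_curv \<theta> u - (Hm (\<theta> u))\<^sup>2 \<in> - {0}}"
  have "continuous_on V (\<lambda>u. gauss_curv \<theta> u - (Hm (\<theta> u))\<^sup>2)"
    by (intro continuous_on_diff continuous_on_power continuous_gauss_curv[OF \<theta>(1)] continuous_mean_curvature[OF \<theta>(1)])
  from continuous_open_preimage[OF this local_paramD(1)[OF \<theta>(1)] open_Compl[OF closed_singleton[of 0]]]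
  have "open Q" by (simp add: Q_def vimage_def Int_def)
  moreover have "negligible Q"
  proof (rule negligible_subset)
    show "negligible (\<Union>i\<in>{..<n}. {u \<in> V. \<theta> u \<in> \<phi> i ` ?Z i})"
    proof (rule negligible_Union)
      fix T assume "T \<in> (\<lambda>i. {u \<in> V. \<theta> u \<in> \<phi> i ` ?Z i}) ` {..<n}"
      then obtain i where i: "i < n" "T = {u \<in> V. \<theta> u \<in> \<phi> i ` ?Z i}" by blast
      have "?Z i \<subseteq> U i" using A(2)[OF i(1)] by blast
      from transition_negligible[OF \<theta>(1) piece_param[OF i(1)] this neg[OF i(1)]] show "negligible T" unfolding i(2) .
    qed simp
    show "Q \<subseteq> (\<Union>i\<in>{..<n}. {u \<in> V. \<theta> u \<in> \<phi> i ` ?Z i})"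
    proof
      fix u assume u: "u \<in> Q"
      then have uV: "u \<in> V" by (simp add: Q_def)
      have nu: "\<not> umbilic_at (\<theta> u)" using u umbilic_at_iff[OF \<theta>(1) uV] by (simp add: Q_def)
      obtain i w where i: "i < n" "w \<in> A i" "\<theta> u = \<phi> i w" using cover chart_mem[OF \<theta>(1) uV] by blast
      have wU: "w \<in> U i" using i A(2) by blast
      have "w \<in> ?Z i" using nu i umbilic_at_iff[OF piece_param[OF i(1)] wU] by simp
      then show "u \<in> (\<Union>i\<in>{..<n}. {u \<in> V. \<theta> u \<in> \<phi> i ` ?Z i})" using i uV by blast
    qed
  qed
  ultimately have "Q = {}" using open_not_negligible by blast
  then show "umbilic_at p" using umbilic_at_iff[OF \<theta>(1,2)] \<theta>(2,3) by (auto simp: Q_def)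
qed

end

section \<open>Existence of the integral over the surface\<close>

text \<open>A chart is made positively oriented by exchanging its two parameters.\<close>

definition swap2 :: "real^2 \<Rightarrow> real^2" where
  "swap2 u = (u $ 2) *\<^sub>R axis 1 1 + (u $ 1) *\<^sub>R axis 2 1"

lemma swap2: "linear swap2" "swap2 (swap2 u) = u" "swap2 (axis 1 1) = axis 2 1" "swap2 (axis 2 1) = axis 1 1"
  "bounded_linear swap2"
proof -
  show l: "linear swap2" by (rule linearI) (simp_all add: swap2_def algebra_simps)
  then show "bounded_linear swap2" by (simp add: linear_conv_bounded_linear)
qed (simp_all add: swap2_def vec_eq_iff forall_2 axis_def)

lemma local_param_swap:
  assumes lp: "local_param M U \<phi>"
  shows "local_param M (swap2 ` U) (\<lambda>u. \<phi> (swap2 u))"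
    and "\<And>u v. u \<in> swap2 ` U \<Longrightarrow> fder (\<lambda>u. \<phi> (swap2 u)) u v = fder \<phi> (swap2 u) (swap2 v)"
proof -
  have inj: "inj swap2" by (rule inj_on_inverseI[of _ swap2]) (rule swap2)
  have sU: "swap2 u \<in> U" if "u \<in> swap2 ` U" for u using that by (auto simp: swap2(2))
  have "swap2 ` U = swap2 -` U" by (auto simp: swap2(2)) (metis swap2(2) image_eqI)
  then have o: "open (swap2 ` U)"
    using open_vimage[OF local_paramD(1)[OF lp] linear_continuous_on[OF swap2(5)]] by simp
  have d: "((\<lambda>u. \<phi> (swap2 u)) has_derivative (\<lambda>v. fder \<phi> (swap2 u) (swap2 v))) (at u)" if "u \<in> swap2 ` U" for u
    by (rule has_derivative_compose[OF bounded_linear_imp_has_derivative[OF swap2(5)]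
          local_param_deriv(1)[OF lp sU[OF that]]])
  show f: "fder (\<lambda>u. \<phi> (swap2 u)) u v = fder \<phi> (swap2 u) (swap2 v)" if "u \<in> swap2 ` U" for u v
    using frechet_derivative_at[OF d[OF that], symmetric] by simp
  have im: "(\<lambda>u. \<phi> (swap2 u)) ` swap2 ` U = \<phi> ` U" by (force simp: swap2(2) image_image)
  show "local_param M (swap2 ` U) (\<lambda>u. \<phi> (swap2 u))"
    unfolding local_param_def im
  proof (intro conjI ballI)
    show "smooth_on (swap2 ` U) (\<lambda>u. \<phi> (swap2 u))"
      by (rule smooth_on_compose[OF o local_paramD(1)[OF lp] _ smooth_on_bounded_linear[OF o swap2(5)] local_paramD(2)[OF lp]])
        (use sU in blast)
    show "inj (fder (\<lambda>u. \<phi> (swap2 u)) u)" if "u \<in> swap2 ` U" for u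
    proof -
      have "fder (\<lambda>u. \<phi> (swap2 u)) u = fder \<phi> (swap2 u) \<circ> swap2" using f[OF that] by (simp add: fun_eq_iff)
      then show ?thesis using inj_compose[OF local_paramD(3)[OF lp sU[OF that]] inj] by simp
    qed
    have "homeomorphism (swap2 ` U) U swap2 swap2"
      unfolding homeomorphism_def
      by (auto simp: swap2(2) image_image linear_continuous_on[OF swap2(5)])
    from homeomorphism_compose[OF this local_paramD(5)[OF lp]]
    show "\<exists>\<psi>. homeomorphism (swap2 ` U) (\<phi> ` U) (\<lambda>u. \<phi> (swap2 u)) \<psi>" unfolding o_def by blast
  qed (use o local_paramD(4)[OF lp] in auto)
qed

lemma oriented_chart:
  assumes p: "p \<in> M"
  obtains U \<phi> u where "oriented_param M (area_form \<eta>) U \<phi>" "u \<in> U" "p = \<phi> u"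
proof -
  obtain U \<phi> u where lp: "local_param M U \<phi>" and u: "u \<in> U" "p = \<phi> u"
    using reg p unfolding regular_surface_def by blast
  \<comment> \<open>\<open>U\<close> may be disconnected and the sign of the density may differ
    between its components, so the chart is first restricted to the parameters with the same sign as
    at \<open>u\<close>.\<close>
  have sub: "local_param M {v \<in> U. area_dens \<phi> v \<in> T} \<phi>" if "open T" for T
  proof (rule local_param_subset[OF lp])
    show "open {v \<in> U. area_dens \<phi> v \<in> T}"
      using continuous_open_preimage[OF continuous_area_dens[OF lp] local_paramD(1)[OF lp] that]
      by (simp add: vimage_def Int_def)
  qed blast
  consider "area_dens \<phi> u > 0" | "area_dens \<phi> u < 0" using area_dens_nonzero[OF lp u(1)] by linarith
  then show thesis
  proof cases
    case 1
    have "oriented_param M (area_form \<eta>) {v \<in> U. area_dens \<phi> v \<in> {0<..}} \<phi>"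
      unfolding oriented_param_def pullback_area_form using sub[of "{0<..}"] by auto
    then show ?thesis using that 1 u by auto
  next
    case 2
    define V where "V = {v \<in> U. area_dens \<phi> v \<in> {..<0}}"
    have lpV: "local_param M V \<phi>" unfolding V_def by (rule sub) simp
    have "area_dens (\<lambda>u. \<phi> (swap2 u)) v > 0" if "v \<in> swap2 ` V" for v
    proof -
      have "swap2 v \<in> V" using that by (auto simp: swap2(2))
      moreover have "area_dens (\<lambda>u. \<phi> (swap2 u)) v = - area_dens \<phi> (swap2 v)"
        using tri_lin[of 0 "fder \<phi> (swap2 v) (axis 1 1)" 1 "fder \<phi> (swap2 v) (axis 2 1)" 1 0 "\<eta> (\<phi> (swap2 v))"]
        by (simp add: area_dens_def local_param_swap(2)[OF lpV that] swap2(3,4))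
      ultimately show ?thesis by (simp add: V_def)
    qed
    then have "oriented_param M (area_form \<eta>) (swap2 ` V) (\<lambda>u. \<phi> (swap2 u))"
      unfolding oriented_param_def pullback_area_form using local_param_swap(1)[OF lpV] by blast
    moreover have "swap2 u \<in> swap2 ` V" using 2 u by (simp add: V_def)
    moreover have "p = \<phi> (swap2 (swap2 u))" by (simp add: swap2(2) u)
    ultimately show ?thesis by (rule that)
  qed
qed

text \<open>\<open>form_integral\<close> selects a value, which means something once a dissection
  exists. Compactness provides finitely many balls in oriented charts, and each piece keeps what the
  earlier ones have not covered.\<close>

lemma form_integral_exists: "\<exists>I. has_form_integral M (area_form \<eta>) \<beta> I"
proof -
  have "\<forall>p\<in>M. \<exists>U \<phi> u e. oriented_param M (area_form \<eta>) U \<phi> \<and> u \<in> U \<and> p = \<phi> u \<and> e > 0 \<and> cball u e \<subseteq> U"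
  proof
    fix p assume "p \<in> M"
    then obtain U \<phi> u where c: "oriented_param M (area_form \<eta>) U \<phi>" "u \<in> U" "p = \<phi> u" by (rule oriented_chart)
    have "open U" using local_paramD(1)[OF oriented_paramD(1)[OF c(1)]] .
    then obtain e where "e > 0" "cball u e \<subseteq> U" using c(2) open_contains_cball by blast
    then show "\<exists>U \<phi> u e. oriented_param M (area_form \<eta>) U \<phi> \<and> u \<in> U \<and> p = \<phi> u \<and> e > 0 \<and> cball u e \<subseteq> U"
      using c by blast
  qed
  then obtain U \<phi> c e where ch: "\<And>p. p \<in> M \<Longrightarrow> oriented_param M (area_form \<eta>) (U p) (\<phi> p)"
      "\<And>p. p \<in> M \<Longrightarrow> c p \<in> U p" "\<And>p. p \<in> M \<Longrightarrow> p = \<phi> p (c p)" "\<And>p. p \<in> M \<Longrightarrow> e p > 0"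
      "\<And>p. p \<in> M \<Longrightarrow> cball (c p) (e p) \<subseteq> U p"
    unfolding bchoice_iff by (metis (no_types))
  note lp = oriented_paramD(1)[OF ch(1)]
  let ?O = "\<lambda>p. \<phi> p ` ball (c p) (e p)"
  have "openin (top_of_set M) (?O p)" if "p \<in> M" for p
  proof -
    have "ball (c p) (e p) \<subseteq> U p" using ch(5)[OF that] ball_subset_cball by blast
    then show ?thesis using local_paramD(4)[OF local_param_subset[OF lp[OF that] open_ball]] by blast
  qed
  moreover have "p \<in> ?O p" if "p \<in> M" for p
    using ch(3,4)[OF that] by (intro image_eqI[of _ _ "c p"]) auto
  ultimately have "(\<forall>t\<in>?O ` M. openin (top_of_set M) t) \<and> M \<subseteq> \<Union> (?O ` M)" by blast
  then obtain D where D: "D \<subseteq> ?O ` M" "finite D" "M \<subseteq> \<Union> D"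
    using compact[unfolded compact_eq_openin_cover, rule_format, of "?O ` M"] by blast
  then obtain P where P: "P \<subseteq> M" "finite P" "D = ?O ` P" 
    using finite_subset_image[OF D(2,1)] by blast
  obtain s where s: "bij_betw s {0..<card P} P" using ex_bij_betw_nat_finite[OF P(2)] by blast
  define n where "n = card P"
  have sP: "s i \<in> M" if "i < n" for i using bij_betwE[OF s] P(1) that by (auto simp: n_def)
  \<comment> \<open>Open balls are used for the covering, closed balls for the pieces: their images
    are compact, so the pieces are Borel, and the continuous integrand is integrable on
    them.\<close>
  define K where "K = (\<lambda>i. cball (c (s i)) (e (s i)))"
  define F where "F = (\<lambda>i. \<phi> (s i) ` K i)"
  define A where "A = (\<lambda>i. {v \<in> K i. \<phi> (s i) v \<notin> (\<Union>j<i. F j)})"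
  have KU: "K i \<subseteq> U (s i)" if "i < n" for i unfolding K_def by (rule ch(5)[OF sP[OF that]])
  have cK: "continuous_on (K i) (\<phi> (s i))" if "i < n" for i
    by (rule continuous_on_subset[OF continuous_chart(1)[OF lp[OF sP[OF that]]] KU[OF that]])
  have F: "compact (F i)" if "i < n" for i
    unfolding F_def by (rule compact_continuous_image[OF cK[OF that]]) (simp add: K_def)
  have Ab: "A i \<in> sets borel" if "i < n" for i
  proof -
    have "closed (\<Union>j<i. F j)" using F that by (intro closed_UN) (auto intro: compact_imp_closed)
    then have "closed (K i \<inter> \<phi> (s i) -` (\<Union>j<i. F j))"
      by (intro continuous_closed_preimage[OF cK[OF that]]) (simp_all add: K_def)
    moreover have "A i = K i - (K i \<inter> \<phi> (s i) -` (\<Union>j<i. F j))" by (auto simp: A_def)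
    moreover have "closed (K i)" by (simp add: K_def)
    ultimately show ?thesis by (simp add: borel_closed sets.Diff)
  qed
  have AK: "A i \<subseteq> K i" for i by (auto simp: A_def)
  have int: "pullback \<beta> (\<phi> (s i)) absolutely_integrable_on A i" if "i < n" for i
  proof -
    have "continuous_on (K i) (pullback \<beta> (\<phi> (s i)))"
      by (rule continuous_on_subset[OF continuous_pullback_\<beta>[OF lp[OF sP[OF that]]] KU[OF that]])
    then have "integrable lborel (\<lambda>x. indicator (K i) x *\<^sub>R pullback \<beta> (\<phi> (s i)) x)"
      by (intro borel_integrable_compact) (simp_all add: K_def)
    then have "set_integrable lebesgue (K i) (pullback \<beta> (\<phi> (s i)))"
      unfolding set_integrable_def using integrable_completion borel_measurable_integrable by blast
    then show ?thesis by (rule set_integrable_subset) (use Ab[OF that] AK in auto)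
  qed
  have "disjoint_family_on (\<lambda>i. \<phi> (s i) ` A i) {..<n}"
    unfolding disjoint_family_on_def
  proof (intro ballI impI)
    have 1: "\<phi> (s i) ` A i \<inter> \<phi> (s j) ` A j = {}" if "j < i" for i j
      using that AK[of j] by (fastforce simp: A_def F_def)
    fix i j :: nat assume "i \<noteq> j"
    then show "\<phi> (s i) ` A i \<inter> \<phi> (s j) ` A j = {}" using 1[of i j] 1[of j i] by (cases "i < j") auto
  qed
  moreover have "(\<Union>i<n. \<phi> (s i) ` A i) = M"
  proof (intro equalityI subsetI)
    fix p assume "p \<in> (\<Union>i<n. \<phi> (s i) ` A i)"
    then obtain i where i: "i < n" "p \<in> \<phi> (s i) ` A i" by blast
    then have "p \<in> \<phi> (s i) ` U (s i)" using AK[of i] KU[OF i(1)] by blast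
    then show "p \<in> M" using local_paramD(7)[OF lp[OF sP[OF i(1)]]] by blast
  next
    fix p assume "p \<in> M"
    then obtain q where q: "q \<in> P" "p \<in> ?O q" using D(3) P(3) by blast
    then obtain j where j: "j < n" "s j = q" using s unfolding bij_betw_def n_def by (metis imageE atLeastLessThan_iff)
    have "p \<in> F j" using q(2) ball_subset_cball unfolding F_def K_def j(2) by blast
    define i where "i = (LEAST i. p \<in> F i)"
    have i: "p \<in> F i" "\<And>k. k < i \<Longrightarrow> p \<notin> F k" "i \<le> j"
      unfolding i_def using \<open>p \<in> F j\<close> LeastI not_less_Least Least_le by metis+
    then have "p \<in> \<phi> (s i) ` A i" by (auto simp: A_def F_def)
    then show "p \<in> (\<Union>i<n. \<phi> (s i) ` A i)" using i(3) j(1) by (intro UN_I[of i]) auto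
  qed
  moreover have "oriented_param M (area_form \<eta>) (U (s i)) (\<phi> (s i)) \<and> A i \<in> sets borel \<and> A i \<subseteq> U (s i) \<and>
      pullback \<beta> (\<phi> (s i)) absolutely_integrable_on A i" if "i < n" for i
    using ch(1)[OF sP[OF that]] Ab[OF that] int[OF that] order_trans[OF AK KU[OF that]] by simp
  ultimately have "has_form_integral M (area_form \<eta>) \<beta> (\<Sum>i<n. integral (A i) (pullback \<beta> (\<phi> (s i))))"
    unfolding has_form_integral_def
    by (intro exI[where x=n] exI[where x="\<lambda>i. U (s i)"] exI[where x="\<lambda>i. \<phi> (s i)"] exI[where x=A])
      simp
  then show ?thesis by blast
qed

end

section \<open>The equality case\<close>

context smooth_strict_norm
begin

section \<open>Balls of the norm\<close>

lemma N_lower_bound: obtains k where "k > 0" "\<And>x. k * norm x \<le> N x"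
proof (cases "\<exists>b::'a. norm b = 1")
  case True
  have "compact (sphere (0::'a) 1)" by simp
  moreover have "sphere (0::'a) 1 \<noteq> {}" using True by (auto simp: dist_norm)
  ultimately obtain y :: 'a where y: "y \<in> sphere 0 1" "\<And>x. x \<in> sphere 0 1 \<Longrightarrow> N y \<le> N x"
    using continuous_attains_inf[OF _ _ continuous_on_N] by metis
  have "N y * norm x \<le> N x" for x
  proof (cases "x = 0")
    case False
    have "N y \<le> N ((1 / norm x) *\<^sub>R x)" using False by (intro y(2)) (simp add: dist_norm)
    then show ?thesis using False by (simp add: N_scale field_simps)
  qed (simp add: N_nonneg)
  moreover have "N y > 0" using y(1) by (intro N_pos) auto
  ultimately show thesis by (rule that[rotated])
next
  case False
  then have "x = 0" for x :: 'a by (metis norm_sgn)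
  then show thesis using that[of 1] N_0 by (metis mult_zero_right norm_zero order_refl zero_less_one)
qed

lemma bounded_N_ball: "bounded {z. N (z - a) < r}"
proof -
  obtain k where k: "k > 0" "\<And>x. k * norm x \<le> N x" using N_lower_bound by blast
  show ?thesis unfolding bounded_any_center[of _ a]
  proof (intro exI ballI)
    fix z assume "z \<in> {z. N (z - a) < r}"
    then have "k * norm (z - a) \<le> r" using k(2)[of "z - a"] by simp
    then show "dist a z \<le> r / k" using k(1) by (simp add: dist_norm norm_minus_commute field_simps)
  qed
qed

text \<open>The component of \<open>z\<close> in the complement of the sphere is connected, so it
  cannot pass from smaller to larger distances, and it remains in the bounded ball.\<close>

lemma N_ball_inside: "{z. N (z - a) < r} \<subseteq> inside (minkowski_sphere N a r)"
proof
  fix z assume z: "z \<in> {z. N (z - a) < r}"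
  let ?M = "minkowski_sphere N a r"
  let ?C = "connected_component_set (- ?M) z"
  have c: "continuous_on S (\<lambda>z. N (z - a))" for S
    by (rule continuous_on_compose2[OF continuous_on_N[of UNIV]]) (auto intro!: continuous_intros)
  have o1: "open {z. N (z - a) < r}" and o2: "open {z. N (z - a) > r}"
    by (intro open_Collect_less c continuous_on_const)+
  have zM: "z \<notin> ?M" using z by (simp add: minkowski_sphere_def)
  have "?C \<subseteq> - ?M" by (rule connected_component_subset)
  then have sub: "?C \<subseteq> {z. N (z - a) < r} \<union> {z. N (z - a) > r}" by (auto simp: minkowski_sphere_def)
  have zC: "z \<in> ?C" using zM by simp
  have "connected ?C" by simp
  moreover have "{z. N (z - a) < r} \<inter> {z. N (z - a) > r} \<inter> ?C = {}" by auto
  ultimately have "{z. N (z - a) < r} \<inter> ?C = {} \<or> {z. N (z - a) > r} \<inter> ?C = {}"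
    by (rule connectedD[OF _ o1 o2 _ sub])
  then have "{z. N (z - a) > r} \<inter> ?C = {}" using zC z by blast
  then have "?C \<subseteq> {z. N (z - a) < r}" using sub by blast
  then have "bounded ?C" by (rule bounded_subset[OF bounded_N_ball])
  then show "z \<in> inside ?M" using zM by (simp add: inside_def)
qed

end

lemma tri_scale3: "tri X Y (c *\<^sub>R Z) = c * tri X Y Z"
  by (simp add: det_3 algebra_simps)

text \<open>Polar coordinates about \<open>a\<close>: the third coordinate is the fraction of the
  way from \<open>a\<close> to the surface.\<close>

definition cone_map :: "real^3 \<Rightarrow> (real^2 \<Rightarrow> real^3) \<Rightarrow> real^3 \<Rightarrow> real^3" where
  "cone_map a \<phi> z = a + z $ 3 *\<^sub>R (\<phi> (proj2 z) - a)"

text \<open>Excluding height 0 keeps the cone map injective, excluding height 1 keeps its image in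
  the open ball; both ends are null for the volume.\<close>

definition cylinder :: "(real^2) set \<Rightarrow> (real^3) set" where
  "cylinder A = {z. proj2 z \<in> A \<and> 0 < z $ 3 \<and> z $ 3 < 1}"

context closed_minkowski_surface
begin

lemma constant_on_surface:
  fixes f :: "real^3 \<Rightarrow> 'b::real_normed_vector"
  assumes d: "\<And>U \<phi> u. local_param M U \<phi> \<Longrightarrow> u \<in> U \<Longrightarrow> ((\<lambda>u. f (\<phi> u)) has_derivative (\<lambda>h. 0)) (at u)"
  obtains c where "\<And>p. p \<in> M \<Longrightarrow> f p = c"
proof -
  have "f constant_on M"
  proof (rule locally_constant_imp_constant[OF connected])
    fix p assume "p \<in> M"
    then obtain U \<phi> u where lp: "local_param M U \<phi>" and u: "u \<in> U" "p = \<phi> u"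
      using reg unfolding regular_surface_def by blast
    obtain e where e: "e > 0" "ball u e \<subseteq> U" using local_paramD(1)[OF lp] u(1) openE by blast
    have "((\<lambda>u. f (\<phi> u)) has_derivative (\<lambda>h. 0)) (at x within ball u e)" if "x \<in> ball u e" for x
      by (rule has_derivative_at_withinI[OF d[OF lp]]) (use that e(2) in blast)
    from has_derivative_zero_constant[OF convex_ball this]
    obtain c where c: "\<forall>x\<in>ball u e. f (\<phi> x) = c" by blast
    have "u \<in> ball u e" using e(1) by simp
    then have "p \<in> \<phi> ` ball u e" "\<forall>x\<in>\<phi> ` ball u e. f x = f p" using c u(2) by auto
    moreover have "openin (top_of_set M) (\<phi> ` ball u e)"
      using local_paramD(4)[OF local_param_subset[OF lp open_ball e(2)]] .
    ultimately show "\<exists>T. openin (top_of_set M) T \<and> p \<in> T \<and> (\<forall>x\<in>T. f x = f p)" by blast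
  qed
  then show thesis using that by (auto simp: constant_on_def)
qed

lemma umbilic_mean_curvature_constant:
  assumes umb: "\<And>p. p \<in> M \<Longrightarrow> umbilic_at p" and lp: "local_param M U \<phi>" and u: "u \<in> U"
  shows "((\<lambda>u. Hm (\<phi> u)) has_derivative (\<lambda>h. 0)) (at u)"
proof -
  let ?h = "\<lambda>u. Hm (\<phi> u)" and ?n = "\<eta> \<circ> \<phi>"
  have e: "fder ?n x v = ?h x *\<^sub>R fder \<phi> x v" if "x \<in> U" for x v
    using umbilic[OF lp that] umbilic_at_iff[OF lp that] umb[OF chart_mem[OF lp that]] by blast
  note o = local_paramD(1)[OF lp]
  note d\<phi> = smooth_on_has_derivative[OF smooth_on_frechet[OF local_paramD(2)[OF lp]] u]
  note dn = smooth_on_has_derivative[OF smooth_on_frechet[OF normal_smooth[OF lp]] u]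
  let ?X = "\<lambda>x. fder \<phi> x (axis 1 1)" and ?Y = "\<lambda>x. fder \<phi> x (axis 2 1)"
  have X0: "?X x \<noteq> 0" if "x \<in> U" for x
    using local_param_deriv(3)[OF lp that] dependent_zero by (metis insertI1)
  \<comment> \<open>Umbilicity expresses \<open>H\<close> as a quotient of inner products of first
    derivatives of \<open>\<eta> \<circ> \<phi>\<close> and \<open>\<phi>\<close>, and so provides
    its differentiability.\<close>
  have "\<exists>q'. ((\<lambda>x. (fder ?n x (axis 1 1) \<bullet> ?X x) / (?X x \<bullet> ?X x)) has_derivative q') (at u)"
    by (rule exI, rule has_derivative_divide'[OF has_derivative_inner[OF dn d\<phi>] has_derivative_inner[OF d\<phi> d\<phi>]])
      (use X0[OF u] in simp)
  then obtain h' where q: "((\<lambda>x. (fder ?n x (axis 1 1) \<bullet> ?X x) / (?X x \<bullet> ?X x)) has_derivative h') (at u)" by blast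
  have h': "(?h has_derivative h') (at u)"
    by (rule has_derivative_transform_within_open[OF q o u]) (simp add: e X0)
  have D: "fder (\<lambda>x. fder ?n x v) u w = ?h u *\<^sub>R fder (\<lambda>x. fder \<phi> x v) u w + h' w *\<^sub>R fder \<phi> u v" for v w
  proof -
    have "((\<lambda>x. fder ?n x v) has_derivative
        (\<lambda>w. ?h u *\<^sub>R fder (\<lambda>x. fder \<phi> x v) u w + h' w *\<^sub>R fder \<phi> u v)) (at u)"
      by (rule has_derivative_transform_within_open[OF has_derivative_scaleR[OF h' d\<phi>] o u]) (simp add: e)
    from frechet_derivative_at[OF this, symmetric] show ?thesis by simp
  qed
  have "fder (\<lambda>x. fder ?n x (axis 1 1)) u (axis 2 1) = fder (\<lambda>x. fder ?n x (axis 2 1)) u (axis 1 1)"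
    by (rule frechet_derivative_swap[OF o normal_smooth[OF lp] u])
  moreover have "fder (\<lambda>x. fder \<phi> x (axis 1 1)) u (axis 2 1) = fder (\<lambda>x. fder \<phi> x (axis 2 1)) u (axis 1 1)"
    by (rule frechet_derivative_swap[OF o local_paramD(2)[OF lp] u])
  \<comment> \<open>In the two mixed derivatives of \<open>\<eta> \<circ> \<phi>\<close> the terms
    with second derivatives of \<open>\<phi>\<close> agree. What is left is a linear relation
    between independent vectors.\<close>
  ultimately have eq: "h' (axis 2 1) *\<^sub>R ?X u + 0 *\<^sub>R ?Y u = 0 *\<^sub>R ?X u + h' (axis 1 1) *\<^sub>R ?Y u"
    unfolding D by simp
  note rep = representation_pair[OF local_param_deriv(3,4)[OF lp u]]
  have z: "h' (axis 2 1) = 0" "h' (axis 1 1) = 0"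
    using rep[of "h' (axis 2 1)" 0] rep[of 0 "h' (axis 1 1)"] unfolding eq by simp_all
  have lin: "linear h'" using h' by (rule has_derivative_linear)
  have "h' v = 0" for v
    by (subst vec2_eq[of v]) (simp add: linear_add[OF lin] linear_scale[OF lin] z)
  then have "h' = (\<lambda>v. 0)" by blast
  then show ?thesis using h' by simp
qed

lemma umbilic_in_sphere:
  assumes umb: "\<And>p. p \<in> M \<Longrightarrow> umbilic_at p"
  obtains a c where "c > 0" "\<And>p. p \<in> M \<Longrightarrow> \<eta> p = c *\<^sub>R (p - a)"
proof -
  obtain c where c: "\<And>p. p \<in> M \<Longrightarrow> Hm p = c"
    using constant_on_surface[of Hm] umbilic_mean_curvature_constant[OF umb] by blast
  have c0: "c > 0" using nonempty Hpos c by force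
  have "((\<lambda>u. \<eta> (\<phi> u) - c *\<^sub>R \<phi> u) has_derivative (\<lambda>h. 0)) (at u)" if lp: "local_param M U \<phi>" and u: "u \<in> U" for U \<phi> u
  proof -
    have m: "\<phi> u \<in> M" by (rule chart_mem[OF lp u])
    have e: "fder (\<eta> \<circ> \<phi>) u v = c *\<^sub>R fder \<phi> u v" for v
      using umbilic[OF lp u] umbilic_at_iff[OF lp u] umb[OF m] c[OF m] by simp
    have "((\<lambda>u. (\<eta> \<circ> \<phi>) u - c *\<^sub>R \<phi> u) has_derivative (\<lambda>h. fder (\<eta> \<circ> \<phi>) u h - c *\<^sub>R fder \<phi> u h)) (at u)"
      by (rule has_derivative_diff[OF normal_derivative[OF lp u] has_derivative_scaleR_right[OF local_param_deriv(1)[OF lp u]]])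
    then show ?thesis by (simp add: e)
  qed
  then obtain b where b: "\<And>p. p \<in> M \<Longrightarrow> \<eta> p - c *\<^sub>R p = b"
    using constant_on_surface[of "\<lambda>p. \<eta> p - c *\<^sub>R p"] by blast
  have "\<eta> p = c *\<^sub>R (p - (- (1 / c) *\<^sub>R b))" if "p \<in> M" for p
    using b[OF that] c0 by (simp add: algebra_simps flip: b[OF that])
  then show thesis using that c0 by blast
qed

section \<open>From a radial normal field to the whole sphere\<close>

lemma connected_unit_sphere: "connected S"
proof -
  have "connected (- {0::real^3})" by (rule connected_punctured_universe) simp
  moreover have "continuous_on (- {0}) (\<lambda>x. inverse (N x) *\<^sub>R x)"
    by (intro continuous_intros continuous_on_N) (simp add: N_0)
  ultimately have "connected ((\<lambda>x. inverse (N x) *\<^sub>R x) ` (- {0}))" by (rule connected_continuous_image[rotated])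
  moreover have "(\<lambda>x. inverse (N x) *\<^sub>R x) ` (- {0}) = S"
  proof (intro equalityI subsetI)
    fix x assume "x \<in> (\<lambda>x. inverse (N x) *\<^sub>R x) ` (- {0})"
    then obtain y where "y \<noteq> 0" "x = inverse (N y) *\<^sub>R y" by blast
    then show "x \<in> S" using N_pos[of y] by (simp add: mem_S N_scale)
  next
    fix x assume "x \<in> S"
    then have "N x = 1" by (simp add: mem_S)
    then show "x \<in> (\<lambda>x. inverse (N x) *\<^sub>R x) ` (- {0})"
      using N_1_nonzero by (intro image_eqI[of _ _ x]) auto
  qed
  ultimately show ?thesis by simp
qed

text \<open>The image is closed by compactness and open by invariance of domain.\<close>

lemma injective_gauss_map_onto:
  assumes inj: "inj_on \<eta> M"
  shows "\<eta> ` M = S"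
proof -
  have cont: "continuous_on M \<eta>"
    unfolding continuous_on_eq_continuous_within
  proof
    fix p assume "p \<in> M"
    then obtain U \<phi> u where lp: "local_param M U \<phi>" and u: "u \<in> U" "p = \<phi> u"
      using reg unfolding regular_surface_def by blast
    show "continuous (at p within M) \<eta>"
      using has_derivative_continuous[OF smooth_on_surface_differentiable[OF lp eta_smooth u(1)]] u(2) by simp
  qed
  have sub: "\<eta> ` M \<subseteq> S" using N_eta by (auto simp: mem_S)
  have "closedin (top_of_set S) (\<eta> ` M)"
    using compact_imp_closed[OF compact_continuous_image[OF cont compact]] sub by (rule closed_subset[rotated])
  moreover have "openin (top_of_set S) (\<eta> ` M)"
  proof (subst openin_subopen, intro ballI)
    fix y assume "y \<in> \<eta> ` M"
    then obtain p where p: "p \<in> M" "y = \<eta> p" by blast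
    obtain U \<phi> u where lp: "local_param M U \<phi>" and u: "u \<in> U" "p = \<phi> u"
      using reg p(1) unfolding regular_surface_def by blast
    have y: "N y = 1" using N_eta p by simp
    obtain \<theta> where \<theta>: "local_param S UNIV \<theta>" "\<theta> 0 = y" "\<theta> ` UNIV = {x \<in> S. \<nu> y \<bullet> x > 0}"
      using sphere_chart[OF y] .
    \<comment> \<open>On these parameters the normal stays in the range of the sphere chart
      \<open>\<theta>\<close>. Read in the two charts, \<open>\<eta>\<close> is then an injective
      continuous map between subsets of the plane.\<close>
    define V where "V = {v \<in> U. \<nu> y \<bullet> \<eta> (\<phi> v) > 0}"
    have VU: "V \<subseteq> U" by (auto simp: V_def)
    have "continuous_on U (\<lambda>v. \<nu> y \<bullet> \<eta> (\<phi> v))" by (intro continuous_on_inner continuous_on_const continuous_chart[OF lp])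
    from continuous_open_preimage[OF this local_paramD(1)[OF lp] open_greaterThan[of 0]]
    have oV: "open V" by (simp add: V_def vimage_def Int_def)
    have uV: "u \<in> V" using u p ngrad_self[OF N_1_nonzero[OF y]] y by (simp add: V_def)
    let ?f = "\<lambda>v. inv_into UNIV \<theta> (\<eta> (\<phi> v))"
    have in_range: "\<eta> (\<phi> v) \<in> range \<theta>" if "v \<in> V" for v
      using that sub chart_mem[OF lp] unfolding \<theta>(3) by (auto simp: V_def)
    have \<theta>f: "\<theta> (?f v) = \<eta> (\<phi> v)" if "v \<in> V" for v by (rule f_inv_into_f[OF in_range[OF that]])
    have "continuous_on (range \<theta>) (inv_into UNIV \<theta>)"
      using local_paramD(5)[OF \<theta>(1)] by (simp add: homeomorphism_def)
    then have cf: "continuous_on V ?f"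
      by (rule continuous_on_compose2[OF _ continuous_on_subset[OF continuous_chart(2)[OF lp] VU]])
        (use in_range in blast)
    have "inj_on ?f V"
    proof (rule inj_onI)
      fix v w assume vw: "v \<in> V" "w \<in> V" "?f v = ?f w"
      then have "\<eta> (\<phi> v) = \<eta> (\<phi> w)" using \<theta>f by metis
      then have "\<phi> v = \<phi> w" using inj_onD[OF inj] vw VU chart_mem[OF lp] by blast
      then show "v = w" using inj_onD[OF local_paramD(6)[OF lp]] vw VU by blast
    qed
    from invariance_of_domain[OF cf oV this] have "open (?f ` V)" .
    from local_paramD(4)[OF local_param_subset[OF \<theta>(1) this]]
    have "openin (top_of_set S) (\<theta> ` ?f ` V)" by simp
    moreover have "\<theta> ` ?f ` V = (\<lambda>v. \<eta> (\<phi> v)) ` V" unfolding image_image using \<theta>f by simp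
    moreover have "(\<lambda>v. \<eta> (\<phi> v)) ` V \<subseteq> \<eta> ` M" using VU chart_mem[OF lp] by blast
    moreover have "y \<in> (\<lambda>v. \<eta> (\<phi> v)) ` V" using uV u p by blast
    ultimately show "\<exists>T. openin (top_of_set S) T \<and> y \<in> T \<and> T \<subseteq> \<eta> ` M" by auto
  qed
  ultimately show ?thesis using connected_unit_sphere nonempty unfolding connected_clopen by blast
qed

lemma umbilic_sphere:
  assumes umb: "\<And>p. p \<in> M \<Longrightarrow> umbilic_at p"
  shows "\<exists>a r. r > 0 \<and> M = minkowski_sphere N a r"
proof -
  obtain a c where c: "c > 0" "\<And>p. p \<in> M \<Longrightarrow> \<eta> p = c *\<^sub>R (p - a)" using umbilic_in_sphere[OF umb] by blast
  have "inj_on \<eta> M" using c by (intro inj_onI) simp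
  then have onto: "\<eta> ` M = S" by (rule injective_gauss_map_onto)
  have "M = minkowski_sphere N a (1 / c)"
  proof (intro equalityI subsetI)
    fix p assume p: "p \<in> M"
    have "c * N (p - a) = 1" using N_eta[OF p] c(1) unfolding c(2)[OF p] N_scale by simp
    then show "p \<in> minkowski_sphere N a (1 / c)" using c(1) by (simp add: minkowski_sphere_def field_simps)
  next
    fix x assume "x \<in> minkowski_sphere N a (1 / c)"
    then have "c *\<^sub>R (x - a) \<in> S" using c(1) by (simp add: minkowski_sphere_def N_scale)
    then obtain p where "p \<in> M" "c *\<^sub>R (x - a) = \<eta> p" using onto by blast
    then show "x \<in> M" using c by simp
  qed
  then show ?thesis using c(1) by (intro exI[of _ a] exI[of _ "1 / c"]) simp
qed

section \<open>Minkowski spheres: radial normals, and volume by cones\<close>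

lemma sphere_normal:
  assumes M: "M = minkowski_sphere N a r" and r: "r > 0" and p: "p \<in> M"
  shows "p - a = r *\<^sub>R \<eta> p"
proof -
  obtain U \<phi> u where lp: "local_param M U \<phi>" and u: "u \<in> U" "p = \<phi> u"
    using reg p unfolding regular_surface_def by blast
  define y where "y = (1 / r) *\<^sub>R (p - a)"
  have Nr: "N (\<phi> x - a) = r" if "x \<in> U" for x
    using chart_mem[OF lp that] M by (simp add: minkowski_sphere_def)
  have Ny: "N y = 1" using Nr[OF u(1)] r u(2) by (simp add: y_def N_scale)
  have "((\<lambda>x. (1 / r) *\<^sub>R (\<phi> x - a)) has_derivative (\<lambda>h. (1 / r) *\<^sub>R (fder \<phi> u h - 0))) (at u)"
    by (rule has_derivative_scaleR_right[OF has_derivative_diff[OF local_param_deriv(1)[OF lp u(1)] has_derivative_const]])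
  from unit_derivative_orthogonal[OF local_paramD(1)[OF lp] u(1) this]
  have 0: "\<nu> y \<bullet> fder \<phi> u v = 0" for v
    using Nr r by (simp add: N_scale y_def u(2))
  have "\<nu> y \<bullet> w = 0" if "\<nu> (\<eta> p) \<bullet> w = 0" for w
  proof -
    have "w \<in> range (fder \<phi> u)"
      using that chart_tangent_space[OF lp u(1)] tangent_space_chart[OF lp u(1)] u(2) by simp
    then show ?thesis using 0 by auto
  qed
  from ngrad_unit_parallel[OF N_eta[OF p] Ny this] have "y = \<eta> p \<or> y = - \<eta> p" .
  moreover have "y \<noteq> - \<eta> p"
  proof
    \<comment> \<open>A step of length \<open>t < r\<close> along \<open>\<eta>\<close> would then
      reduce the distance to the centre to \<open>r - t\<close> and end inside
      \<open>M\<close>.\<close>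
    assume neg: "y = - \<eta> p"
    obtain e where e: "e > 0" "\<And>t. 0 < t \<Longrightarrow> t < e \<Longrightarrow> p + t *\<^sub>R \<eta> p \<in> outside M"
      using outward p unfolding outward_pointing_def by blast
    define t where "t = min e r / 2"
    have t: "0 < t" "t < e" "t < r" using e r by (auto simp: t_def)
    have "p - a = r *\<^sub>R y" using r by (simp add: y_def)
    then have "p + t *\<^sub>R \<eta> p - a = - ((r - t) *\<^sub>R \<eta> p)" unfolding neg by (simp add: algebra_simps)
    then have "N (p + t *\<^sub>R \<eta> p - a) = r - t" using t N_eta[OF p] by (simp add: N_minus N_scale)
    then have "p + t *\<^sub>R \<eta> p \<in> inside M" unfolding M using N_ball_inside t by force
    then show False using e(2)[OF t(1,2)] inside_Int_outside by blast
  qed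
  ultimately have "y = \<eta> p" by blast
  moreover have "p - a = r *\<^sub>R y" using r by (simp add: y_def)
  ultimately show ?thesis by simp
qed

text \<open>On the sphere \<open>\<eta> = (p - a) / r\<close>, so \<open>H = 1 / r\<close> and the
  integrand has density \<open>r\<close> times the area density. The Jacobian of the cone map is
  \<open>t^2\<close> times this density, and \<open>t^2\<close> integrates to one third over the
  unit interval. The cone map is injective, so the change of variables is an equality.\<close>

lemma cone_volume:
  assumes M: "M = minkowski_sphere N a r" and r: "r > 0"
    and lp: "local_param M U \<phi>" and pos: "\<And>u. u \<in> U \<Longrightarrow> area_dens \<phi> u > 0"
    and A: "A \<in> sets borel" "A \<subseteq> U" and int: "pullback \<beta> \<phi> absolutely_integrable_on A"
  shows "cone_map a \<phi> ` cylinder A \<in> lmeasurable"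
    and "measure lebesgue (cone_map a \<phi> ` cylinder A) = integral A (pullback \<beta> \<phi>) / 3"
proof -
  note [measurable] = A(1)
  define C where "C = cylinder A"
  have eta: "\<phi> u - a = r *\<^sub>R \<eta> (\<phi> u)" if "u \<in> U" for u
    by (rule sphere_normal[OF M r chart_mem[OF lp that]])
  have dn: "fder (\<eta> \<circ> \<phi>) u v = (1 / r) *\<^sub>R fder \<phi> u v" if "u \<in> U" for u v
  proof -
    have "((\<lambda>x. (1 / r) *\<^sub>R (\<phi> x - a)) has_derivative (\<lambda>h. (1 / r) *\<^sub>R (fder \<phi> u h - 0))) (at u)"
      by (rule has_derivative_scaleR_right[OF has_derivative_diff[OF local_param_deriv(1)[OF lp that] has_derivative_const]])
    then have "((\<eta> \<circ> \<phi>) has_derivative (\<lambda>h. (1 / r) *\<^sub>R (fder \<phi> u h - 0))) (at u)"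
      by (rule has_derivative_transform_within_open[OF _ local_paramD(1)[OF lp] that]) (use r in \<open>simp add: eta\<close>)
    from frechet_derivative_at[OF this, symmetric] show ?thesis by simp
  qed
  have H: "Hm (\<phi> u) = 1 / r" if "u \<in> U" for u
  proof -
    let ?X = "fder \<phi> u (axis 1 1)" and ?Y = "fder \<phi> u (axis 2 1)"
    have "2 * Hm (\<phi> u) * area_dens \<phi> u = 2 * (1 / r) * area_dens \<phi> u"
      unfolding mean_curvature_formula[OF lp that] dn[OF that]
      using tri_lin[of "1 / r" ?X 0 ?Y 0 1 "\<eta> (\<phi> u)"] tri_lin[of 1 ?X 0 ?Y 0 "1 / r" "\<eta> (\<phi> u)"]
      by (simp add: area_dens_def)
    then have "2 * Hm (\<phi> u) = 2 * (1 / r)"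
      by (rule mult_right_cancel[THEN iffD1, rotated]) (use pos[OF that] in simp)
    then show ?thesis by simp
  qed
  define f where "f = pullback \<beta> \<phi>"
  have f: "f u = r * area_dens \<phi> u" "f u > 0" if "u \<in> U" for u
    using H[OF that] r pos[OF that] by (simp_all add: f_def pullback_\<beta>)
  have cf: "continuous_on A f" unfolding f_def
    by (rule continuous_on_subset[OF continuous_pullback_\<beta>[OF lp] A(2)])
  define fA where "fA = (\<lambda>u. indicator A u * f u)"
  have mf [measurable]: "fA \<in> borel_measurable borel"
    using borel_measurable_continuous_on_indicator[OF A(1) cf] by (simp add: fA_def)
  have "{z \<in> space borel. proj2 z \<in> A \<and> 0 < z $ 3 \<and> z $ 3 < 1} \<in> sets borel" by measurable
  then have C [measurable]: "C \<in> sets borel" by (simp add: C_def cylinder_def)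
  define I where "I = integral A f"
  define g where "g = (\<lambda>z. indicator C z * (fA (proj2 z) * (z $ 3)\<^sup>2))"
  have mg [measurable]: "g \<in> borel_measurable borel" unfolding g_def by measurable
  have f0: "0 \<le> f u" if "u \<in> A" for u using f(2) that A(2) less_imp_le by blast
  have fA0: "0 \<le> fA u" for u using f0 by (simp add: fA_def indicator_def)
  have g0: "0 \<le> g z" for z using fA0 by (simp add: g_def)
  have inner: "(\<integral>\<^sup>+t. ennreal (g (emb3 u t)) \<partial>lborel) = ennreal (1/3) * ennreal (fA u)" for u
  proof (cases "u \<in> A")
    case True
    have "(\<integral>\<^sup>+t. ennreal (g (emb3 u t)) \<partial>lborel) = (\<integral>\<^sup>+t. ennreal (fA u * t\<^sup>2) * indicator {0<..<1} t \<partial>lborel)"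
      using True by (intro nn_integral_cong) (auto simp: g_def C_def cylinder_def indicator_def)
    also have "\<dots> = ennreal (fA u / 3)" by (rule nn_integral_cone[OF fA0])
    finally show ?thesis using fA0 by (simp add: ennreal_mult[symmetric])
  next
    case False
    then show ?thesis by (simp add: g_def fA_def)
  qed
  note seg = integral_segments[OF A(1) cf f0 int[folded f_def] mg g0 inner[unfolded fA_def]]
  have ig: "integrable lborel g" by (rule seg(1))
  have Ig: "(\<integral>z. g z \<partial>lborel) = I / 3" unfolding I_def by (rule seg(2))
  define f' where "f' = (\<lambda>z h. z $ 3 *\<^sub>R (fder \<phi> (proj2 z) (proj2 h) - 0) + h $ 3 *\<^sub>R (\<phi> (proj2 z) - a))"
  have CU: "proj2 z \<in> A" "proj2 z \<in> U" "0 < z $ 3" "z $ 3 < 1" if "z \<in> C" for z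
    using that A(2) by (auto simp: C_def cylinder_def)
  have dC: "(cone_map a \<phi> has_derivative f' z) (at z within C)" if "z \<in> C" for z
  proof -
    have p: "(proj2 has_derivative proj2) (at z)"
      by (rule bounded_linear_imp_has_derivative[OF bounded_linear_proj2])
    have 3: "((\<lambda>z::real^3. z $ 3) has_derivative (\<lambda>h. h $ 3)) (at z)"
      by (rule bounded_linear_imp_has_derivative[OF bounded_linear_vec_nth])
    have 1: "((\<lambda>z. \<phi> (proj2 z) - a) has_derivative (\<lambda>h. fder \<phi> (proj2 z) (proj2 h) - 0)) (at z)"
      by (rule has_derivative_diff[OF has_derivative_compose[OF p local_param_deriv(1)[OF lp CU(2)[OF that]]] has_derivative_const])
    from has_derivative_add[OF has_derivative_const[of a] has_derivative_scaleR[OF 3 1]]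
    have "(cone_map a \<phi> has_derivative f' z) (at z)"
      by (simp add: cone_map_def[abs_def] f'_def)
    then show ?thesis by (rule has_derivative_at_withinI)
  qed
  have detC: "\<bar>det (matrix (f' z) :: real^3^3)\<bar> = g z" if "z \<in> C" for z
  proof -
    have ax: "axis 1 1 $ (3::3) = (0::real)" "axis 2 1 $ (3::3) = (0::real)" "axis 3 1 $ (3::3) = (1::real)"
      by (simp_all add: axis_def)
    let ?X = "fder \<phi> (proj2 z) (axis 1 1)" and ?Y = "fder \<phi> (proj2 z) (axis 2 1)"
    have "det (matrix (f' z) :: real^3^3) = tri (z $ 3 *\<^sub>R ?X) (z $ 3 *\<^sub>R ?Y) (r *\<^sub>R \<eta> (\<phi> (proj2 z)))"
      unfolding matrix_det_columns f'_def
      by (simp add: ax eta[OF CU(2)[OF that]] linear_0[OF local_param_deriv(2)[OF lp CU(2)[OF that]]])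
    also have "\<dots> = (z $ 3)\<^sup>2 * (r * area_dens \<phi> (proj2 z))"
      using tri_lin[of "z $ 3" ?X 0 ?Y 0 "z $ 3"] by (simp add: tri_scale3 area_dens_def power2_eq_square)
    finally show ?thesis using that CU[OF that] f[OF CU(2)[OF that]] r pos[OF CU(2)[OF that]]
      by (simp add: g_def fA_def abs_mult mult.commute)
  qed
  have "inj_on (cone_map a \<phi>) C"
  proof (rule inj_onI)
    fix z w assume z: "z \<in> C" and w: "w \<in> C" and eq: "cone_map a \<phi> z = cone_map a \<phi> w"
    note CU(2)[OF z] CU(2)[OF w]
    have "z $ 3 *\<^sub>R (r *\<^sub>R \<eta> (\<phi> (proj2 z))) = w $ 3 *\<^sub>R (r *\<^sub>R \<eta> (\<phi> (proj2 w)))"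
      using eq unfolding cone_map_def eta[OF CU(2)[OF z]] eta[OF CU(2)[OF w]] by simp
    then have e: "N (z $ 3 *\<^sub>R (r *\<^sub>R \<eta> (\<phi> (proj2 z)))) = N (w $ 3 *\<^sub>R (r *\<^sub>R \<eta> (\<phi> (proj2 w))))" by simp
    have z3: "z $ 3 = w $ 3"
      \<comment> \<open>Distance from the centre is \<open>r\<close> times the height, so equal
        images have equal heights; dividing by the height leaves equal points of the
        surface.\<close>
      using e r CU(3)[OF z] CU(3)[OF w] by (simp add: N_scale chart_N_eta[OF lp CU(2)[OF z]] chart_N_eta[OF lp CU(2)[OF w]])
    then have "\<phi> (proj2 z) = \<phi> (proj2 w)" using eq CU(3)[OF w] by (simp add: cone_map_def)
    then have "proj2 z = proj2 w" using inj_onD[OF local_paramD(6)[OF lp]] CU(2) z w by blast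
    then have "z $ 1 = w $ 1" "z $ 2 = w $ 2" by (metis proj2_nth(1), metis proj2_nth(2))
    then show "z = w" using z3 by (simp add: vec_eq_iff forall_3)
  qed
  moreover have "((\<lambda>z. \<bar>det (matrix (f' z) :: real^3^3)\<bar>) has_integral I / 3) C"
  proof -
    have "(g has_integral (I / 3)) UNIV" using has_integral_integral_lborel[OF ig] Ig by simp
    moreover have "g = (\<lambda>z. if z \<in> C then \<bar>det (matrix (f' z) :: real^3^3)\<bar> else 0)"
      by (auto simp: detC fun_eq_iff) (simp add: g_def)
    ultimately show ?thesis
      using has_integral_restrict_UNIV[of C "\<lambda>z. \<bar>det (matrix (f' z) :: real^3^3)\<bar>"] by simp
  qed
  ultimately have "cone_map a \<phi> ` C \<in> lmeasurable \<and> measure lebesgue (cone_map a \<phi> ` C) = I / 3"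
    using C dC by (subst has_measure_differentiable_image[where f'=f']) simp_all
  then show "cone_map a \<phi> ` cylinder A \<in> lmeasurable"
    "measure lebesgue (cone_map a \<phi> ` cylinder A) = integral A (pullback \<beta> \<phi>) / 3"
    by (simp_all add: C_def I_def f_def)
qed

text \<open>Both claims hold for every value that some dissection produces, in particular for the
  one that \<open>form_integral\<close> selects.\<close>

theorem heintze_karcher_minkowski:
  assumes J: "has_form_integral M (area_form \<eta>) \<beta> J"
  shows "3 * measure lebesgue (inside M) \<le> J"
    and "J = 3 * measure lebesgue (inside M) \<longleftrightarrow> (\<exists>a r. r > 0 \<and> M = minkowski_sphere N a r)"
proof -
  obtain n :: nat and U \<phi> A where
    all: "\<forall>i<n. oriented_param M (area_form \<eta>) (U i) (\<phi> i) \<and> A i \<in> sets borel \<and> A i \<subseteq> U i \<and>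
      pullback \<beta> (\<phi> i) absolutely_integrable_on A i" and
    disj: "disjoint_family_on (\<lambda>i. \<phi> i ` A i) {..<n}" and
    cover: "(\<Union>i<n. \<phi> i ` A i) = M" and Jeq: "J = (\<Sum>i<n. integral (A i) (pullback \<beta> (\<phi> i)))"
    using J unfolding has_form_integral_def by blast
  have par: "\<And>i. i < n \<Longrightarrow> oriented_param M (area_form \<eta>) (U i) (\<phi> i)"
    and A: "\<And>i. i < n \<Longrightarrow> A i \<in> sets borel" "\<And>i. i < n \<Longrightarrow> A i \<subseteq> U i"
    and int: "\<And>i. i < n \<Longrightarrow> pullback \<beta> (\<phi> i) absolutely_integrable_on A i"
    using all by simp_all
  note hk = heintze_karcher[OF par A int cover, folded Jeq]
  show le: "3 * measure lebesgue (inside M) \<le> J" by (rule hk(1))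
  show "J = 3 * measure lebesgue (inside M) \<longleftrightarrow> (\<exists>a r. r > 0 \<and> M = minkowski_sphere N a r)"
  proof
    assume "J = 3 * measure lebesgue (inside M)"
    from hk(2)[OF _ _ _ _ this] show "\<exists>a r. r > 0 \<and> M = minkowski_sphere N a r"
      by (intro umbilic_sphere)
  next
    assume "\<exists>a r. r > 0 \<and> M = minkowski_sphere N a r"
    then obtain a r where M: "M = minkowski_sphere N a r" and r: "r > 0" by blast
    let ?C = "\<lambda>i. cone_map a (\<phi> i) ` cylinder (A i)"
    note lp = oriented_paramD(1)[OF par] and pos = oriented_paramD(2)[OF par]
    have C: "?C i \<in> lmeasurable" "measure lebesgue (?C i) = integral (A i) (pullback \<beta> (\<phi> i)) / 3" if "i < n" for i
      using cone_volume[OF M r lp[OF that] pos[OF that] A[OF that] int[OF that]] by blast+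
    have eta: "\<phi> i (proj2 z) - a = r *\<^sub>R \<eta> (\<phi> i (proj2 z))" "N (\<phi> i (proj2 z) - a) = r" "0 < z $ 3" "z $ 3 < 1"
      if "i < n" "z \<in> cylinder (A i)" for i z
    proof -
      have z: "proj2 z \<in> U i" and zz: "0 < z $ 3" "z $ 3 < 1" using that A(2)[OF that(1)] by (auto simp: cylinder_def)
      show e: "\<phi> i (proj2 z) - a = r *\<^sub>R \<eta> (\<phi> i (proj2 z))"
        by (rule sphere_normal[OF M r chart_mem[OF lp[OF that(1)] z]])
      show "N (\<phi> i (proj2 z) - a) = r" unfolding e using r chart_N_eta[OF lp[OF that(1)] z] by (simp add: N_scale)
      show "0 < z $ 3" "z $ 3 < 1" by (fact zz)+
    qed
    \<comment> \<open>A common point of two cones would determine its height and then its radial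
      projection to \<open>M\<close>, which would lie in two disjoint pieces.\<close>
    have "?C i \<inter> ?C j = {}" if ij: "i < n" "j < n" "i \<noteq> j" for i j
    proof (rule ccontr)
      assume "?C i \<inter> ?C j \<noteq> {}"
      then obtain z w where z: "z \<in> cylinder (A i)" and w: "w \<in> cylinder (A j)"
        and eq: "cone_map a (\<phi> i) z = cone_map a (\<phi> j) w" by blast
      have e: "z $ 3 *\<^sub>R (\<phi> i (proj2 z) - a) = w $ 3 *\<^sub>R (\<phi> j (proj2 w) - a)" using eq by (simp add: cone_map_def)
      then have "N (z $ 3 *\<^sub>R (\<phi> i (proj2 z) - a)) = N (w $ 3 *\<^sub>R (\<phi> j (proj2 w) - a))" by (rule arg_cong)
      then have "z $ 3 = w $ 3"
        using eta(2,3)[OF ij(1) z] eta(2,3)[OF ij(2) w] r by (simp add: N_scale)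
      then have "\<phi> i (proj2 z) = \<phi> j (proj2 w)" using e eta(3)[OF ij(2) w] by simp
      moreover have "\<phi> i (proj2 z) \<in> \<phi> i ` A i" "\<phi> j (proj2 w) \<in> \<phi> j ` A j"
        using z w by (auto simp: cylinder_def)
      ultimately show False using disj ij unfolding disjoint_family_on_def by (metis IntI empty_iff lessThan_iff)
    qed
    then have "measure lebesgue (\<Union>(?C ` {..<n})) = (\<Sum>i<n. measure lebesgue (?C i))"
      by (intro measure_negligible_finite_Union_image) (auto simp: pairwise_def C(1))
    also have "\<dots> = (\<Sum>i<n. integral (A i) (pullback \<beta> (\<phi> i)) / 3)"
      by (rule sum.cong) (use C(2) in simp_all)
    also have "\<dots> = J / 3" by (simp add: Jeq sum_divide_distrib)
    finally have m: "measure lebesgue (\<Union>(?C ` {..<n})) = J / 3" .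
    \<comment> \<open>The disjoint cones of total volume \<open>J / 3\<close> fit into the region.
      Combined with the general inequality this gives equality.\<close>
    have "\<Union>(?C ` {..<n}) \<subseteq> inside M"
    proof
      fix x assume "x \<in> \<Union>(?C ` {..<n})"
      then obtain i z where i: "i < n" "z \<in> cylinder (A i)" "x = cone_map a (\<phi> i) z" by auto
      have "N (x - a) = z $ 3 * r" using eta(2,3)[OF i(1,2)] by (simp add: i(3) cone_map_def N_scale)
      also have "\<dots> < 1 * r" using eta(4)[OF i(1,2)] r by (intro mult_strict_right_mono)
      finally show "x \<in> inside M" unfolding M using N_ball_inside by auto
    qed
    moreover have "\<Union>(?C ` {..<n}) \<in> lmeasurable" by (rule fmeasurable.finite_UN) (use C(1) in auto)
    moreover have "inside M \<in> lmeasurable"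
      using open_inside[OF compact_imp_closed[OF compact]] bounded_inside[OF compact_imp_bounded[OF compact]]
      by (rule lmeasurable_open[rotated])
    ultimately have "J / 3 \<le> measure lebesgue (inside M)"
      unfolding m[symmetric] by (intro measure_mono_fmeasurable) auto
    then show "J = 3 * measure lebesgue (inside M)" using le by simp
  qed
qed

end


theorem theorem4p3:
  fixes N :: "real^3 \<Rightarrow> real" and M :: "(real^3) set" and \<eta> :: "real^3 \<Rightarrow> real^3"
  assumes "smooth_norm N" and "strictly_convex_norm N"
    and "\<forall>x \<in> minkowski_sphere N 0 1. gaussian_curvature (minkowski_sphere N 0 1) x \<noteq> 0"
    and "regular_surface M" and "compact M" and "connected M" and "M \<noteq> {}"
    and "birkhoff_gauss_map N M \<eta>" and "outward_pointing M \<eta>"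
    and "\<forall>p\<in>M. minkowski_mean_curvature M \<eta> p > 0"
  defines "J \<equiv> form_integral M (area_form \<eta>)
                 (\<lambda>p X Y. 1 / minkowski_mean_curvature M \<eta> p * area_form \<eta> p X Y)"
    and "D \<equiv> inside M"
  shows "J \<ge> 3 * measure lebesgue D \<and>
         (J = 3 * measure lebesgue D \<longleftrightarrow> (\<exists>a r. r > 0 \<and> M = minkowski_sphere N a r))"
proof -
  interpret closed_minkowski_surface N M \<eta>
    by unfold_locales (use assms(1-10) in auto)
  have "has_form_integral M (area_form \<eta>) \<beta> (form_integral M (area_form \<eta>) \<beta>)"
    unfolding form_integral_def using form_integral_exists by (rule someI_ex)
  moreover have "\<beta> = (\<lambda>p X Y. 1 / minkowski_mean_curvature M \<eta> p * area_form \<eta> p X Y)"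
    by (simp add: fun_eq_iff \<beta>_def)
  ultimately have "has_form_integral M (area_form \<eta>) \<beta> J" by (simp add: J_def)
  from heintze_karcher_minkowski[OF this] show ?thesis by (simp add: D_def)
qed

end
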